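(* Let $\mathcal D\subset\mathcal M$ be a bounded domain and suppose that the system $\nabla_{\dot x}\dot x=f(t\omega,x)$ is $U$-monotone in $\mathcal D$ (as defined in the context). If $x:\mathbb R\to\mathcal D$ is a solution of this system such that $\sup_{t\in\mathbb R}\|\dot x(t)\|<\infty$, then this solution is hyperbolic.
   Context: $(\mathcal M,\langle\cdot,\cdot\rangle)$ is a smooth complete connected $m$-dimensional Riemannian manifold, $\nabla$ its Levi-Civita connection, $\|\cdot\|=\sqrt{\langle\cdot,\cdot\rangle}$, $R$ its curvature tensor, with the convention that $K_\sigma(x)=\frac{\langle R(\xi,\eta)\eta,\xi\rangle}{\|\xi\|^2\|\eta\|^2-\langle\xi,\eta\rangle^2}$ is the sectional curvature of the plane $\sigma$ spanned by $\xi,\eta\in T_x\mathcal M$. Set $K(x):=\max\{0,\sup_\sigma K_\sigma(x)\}$, the supremum being over 2-dimensional subspaces $\sigma\subset T_x\mathcal M$. $\mathbb T^k=\mathbb R^k/2\pi\mathbb Z^k$; $\omega\in\mathbb R^k$ has rationally independent components; $f(\varphi,\cdot)$, $\varphi\in\mathbb T^k$, is a smooth family of vector fields on $\mathcal M$; $\nabla f(\varphi,x)\xi=\nabla_\xi f(\varphi,x)$. $U$-monotonicity: the system is called $U$-monotone in $\mathcal D$ if there exists a smooth $U:\mathcal M\to\mathbb R$ such that $$\lambda_f(\varphi,x)+\tfrac12\langle\nabla U(x),f(\varphi,x)\rangle>0\quad\forall(\varphi,x)\in\mathbb T^k\times\mathrm{cl}(\mathcal D),\qquad \mu_U(x)\ge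 2K(x)\quad\forall x\in\mathcal D,$$ where $\lambda_f(\varphi,x):=\min\{\langle\nabla f(\varphi,x)\eta,\eta\rangle:\eta\in T_x\mathcal M,\|\eta\|=1\}$ and $\mu_U(x):=\min\{\langle H_U(x)\eta,\eta\rangle-\tfrac12\langle\nabla U(x),\eta\rangle^2:\eta\in T_x\mathcal M,\|\eta\|=1\}$, with $\langle H_U(x)\xi,\eta\rangle=\langle\nabla_\xi\nabla U(x),\eta\rangle$. Hyperbolicity: a solution $x(t)$ defined on all of $\mathbb R$, with $\tau(t)=\dot x(t)$, is called hyperbolic if its linear variational system for vector fields $\eta,\zeta$ along $x(\cdot)$, $$\nabla_{\tau}\eta=\zeta,\qquad \nabla_{\tau}\zeta=\nabla f(t\omega,x(t))\eta-R(\eta,\tau(t))\tau(t),$$ is exponentially dichotomic on $\mathbb R$ (i.e., written in a parallel orthonormal frame along $x(\cdot)$, this linear ODE system on $\mathbb R^{2m}$ has an exponential dichotomy on $\mathbb R$). *)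

theory Defs
  imports "HOL-Analysis.Analysis"
begin

section \<open>Smooth functions between Euclidean spaces\<close>

text \<open>Meant for open \<open>S\<close>: all iterated partial derivatives exist and are differentiable on \<open>S\<close>.\<close>

primrec Ck_on :: "nat \<Rightarrow> 'e::euclidean_space set \<Rightarrow> ('e \<Rightarrow> 'f::real_normed_vector) \<Rightarrow> bool" where
  "Ck_on 0 S F \<longleftrightarrow> continuous_on S F"
| "Ck_on (Suc k) S F \<longleftrightarrow>
     F differentiable_on S \<and> (\<forall>b\<in>Basis. Ck_on k S (\<lambda>y. frechet_derivative F (at y) b))"

definition smooth_on :: "'e::euclidean_space set \<Rightarrow> ('e \<Rightarrow> 'f::real_normed_vector) \<Rightarrow> bool" where
  "smooth_on S F \<longleftrightarrow> (\<forall>k. Ck_on k S F)"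

definition partial :: "'n::finite \<Rightarrow> (real ^ 'n \<Rightarrow> real) \<Rightarrow> real ^ 'n \<Rightarrow> real" where
  "partial i F y = frechet_derivative F (at y) (axis i 1)"


section \<open>Smooth manifolds and tangent spaces\<close>

text \<open>The manifold is the whole type \<open>'a\<close>; its dimension is \<open>CARD('n)\<close>.
  A chart is a pair of its domain and its coordinate map; the values of the coordinate map
  outside the domain are irrelevant.\<close>

type_synonym ('a, 'n) chart = "'a set \<times> ('a \<Rightarrow> real ^ 'n)"

definition chart_inv :: "('a, 'n::finite) chart \<Rightarrow> real ^ 'n \<Rightarrow> 'a" where
  "chart_inv c = inv_into (fst c) (snd c)"

definition transition :: "('a, 'n::finite) chart \<Rightarrow> ('a, 'n) chart \<Rightarrow> real ^ 'n \<Rightarrow> real ^ 'n" where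
  "transition c c' = snd c' \<circ> chart_inv c"

definition smooth_atlas :: "('a::topological_space, 'n::finite) chart set \<Rightarrow> bool" where
  "smooth_atlas A \<longleftrightarrow>
     (\<Union>c\<in>A. fst c) = UNIV \<and>
     (\<forall>c\<in>A. open (fst c) \<and> open (snd c ` fst c) \<and>
             homeomorphism (fst c) (snd c ` fst c) (snd c) (chart_inv c)) \<and>
     (\<forall>c\<in>A. \<forall>c'\<in>A. smooth_on (snd c ` (fst c \<inter> fst c')) (transition c c'))"

definition charts_at :: "('a, 'n::finite) chart set \<Rightarrow> 'a \<Rightarrow> ('a, 'n) chart set" where
  "charts_at A p = {c \<in> A. p \<in> fst c}"

text \<open>A tangent vector at \<open>p\<close> is the family of its component vectors in all charts around \<open>p\<close>,
  which are related by the Jacobians of the transition maps. It is normalised to be \<open>0\<close> at all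
  other charts, so that vectors with equal components are equal. The vector space operations
  are pointwise.\<close>

type_synonym ('a, 'n) tvec = "('a, 'n) chart \<Rightarrow> real ^ 'n"

definition tangent_space :: "('a, 'n::finite) chart set \<Rightarrow> 'a \<Rightarrow> ('a, 'n) tvec set" where
  "tangent_space A p = {v.
     (\<forall>c\<in>charts_at A p. \<forall>c'\<in>charts_at A p.
        v c' = frechet_derivative (transition c c') (at (snd c p)) (v c)) \<and>
     (\<forall>c. c \<notin> charts_at A p \<longrightarrow> v c = 0)}"

text \<open>The coordinate vector field \<open>\<partial>/\<partial>y\<^sub>i\<close> of the chart \<open>c\<close> at the point \<open>p\<close> of its domain.\<close>

definition coord_vec :: "('a, 'n::finite) chart set \<Rightarrow> ('a, 'n) chart \<Rightarrow> 'a \<Rightarrow> 'n \<Rightarrow> ('a, 'n) tvec" where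
  "coord_vec A c p i = (\<lambda>c'. if c' \<in> charts_at A p
     then frechet_derivative (transition c c') (at (snd c p)) (axis i 1) else 0)"

definition smooth_function :: "('a, 'n::finite) chart set \<Rightarrow> ('a \<Rightarrow> real) \<Rightarrow> bool" where
  "smooth_function A U \<longleftrightarrow> (\<forall>c\<in>A. smooth_on (snd c ` fst c) (\<lambda>y. U (chart_inv c y)))"


section \<open>Riemannian metrics\<close>

type_synonym ('a, 'n) riem_metric = "'a \<Rightarrow> ('a, 'n) tvec \<Rightarrow> ('a, 'n) tvec \<Rightarrow> real"

definition gram :: "('a, 'n::finite) chart set \<Rightarrow> ('a, 'n) riem_metric \<Rightarrow> ('a, 'n) chart \<Rightarrow>
    real ^ 'n \<Rightarrow> real ^ 'n ^ 'n" where
  "gram A g c y = (\<chi> i j. g (chart_inv c y)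
     (coord_vec A c (chart_inv c y) i) (coord_vec A c (chart_inv c y) j))"

definition riemannian_metric :: "('a, 'n::finite) chart set \<Rightarrow> ('a, 'n) riem_metric \<Rightarrow> bool" where
  "riemannian_metric A g \<longleftrightarrow>
     (\<forall>p. \<forall>u\<in>tangent_space A p. \<forall>v\<in>tangent_space A p. \<forall>w\<in>tangent_space A p. \<forall>a b.
        g p (\<lambda>c. a *\<^sub>R u c + b *\<^sub>R v c) w = a * g p u w + b * g p v w) \<and>
     (\<forall>p. \<forall>u\<in>tangent_space A p. \<forall>v\<in>tangent_space A p. g p u v = g p v u) \<and>
     (\<forall>p. \<forall>u\<in>tangent_space A p. u \<noteq> (\<lambda>c. 0) \<longrightarrow> g p u u > 0) \<and>
     (\<forall>c\<in>A. \<forall>i j. smooth_on (snd c ` fst c) (\<lambda>y. gram A g c y $ i $ j))"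

definition tnorm :: "('a, 'n) riem_metric \<Rightarrow> 'a \<Rightarrow> ('a, 'n) tvec \<Rightarrow> real" where
  "tnorm g p v = sqrt (g p v v)"


section \<open>Curves and the Riemannian distance\<close>

definition differentiable_curve :: "('a::topological_space, 'n::finite) chart set \<Rightarrow> real set \<Rightarrow>
    (real \<Rightarrow> 'a) \<Rightarrow> bool" where
  "differentiable_curve A T x \<longleftrightarrow> continuous_on T x \<and>
     (\<forall>t\<in>T. \<forall>c\<in>charts_at A (x t). (\<lambda>s. snd c (x s)) differentiable (at t within T))"

definition velocity :: "('a, 'n::finite) chart set \<Rightarrow> real set \<Rightarrow> (real \<Rightarrow> 'a) \<Rightarrow>
    real \<Rightarrow> ('a, 'n) tvec" where
  "velocity A T x t = (\<lambda>c. if c \<in> charts_at A (x t)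
     then vector_derivative (\<lambda>s. snd c (x s)) (at t within T) else 0)"

definition C1_curve :: "('a::topological_space, 'n::finite) chart set \<Rightarrow> (real \<Rightarrow> 'a) \<Rightarrow> bool" where
  "C1_curve A x \<longleftrightarrow> differentiable_curve A {0..1} x \<and>
     (\<forall>t\<in>{0..1}. \<forall>c\<in>charts_at A (x t).
        continuous (at t within {0..1}) (\<lambda>s. velocity A {0..1} x s c))"

text \<open>\<open>joined_by A g p q L\<close>: some piecewise \<open>C\<^sup>1\<close> curve (a concatenation of finitely many
  \<open>C\<^sup>1\<close> curves, each parametrised over the unit interval) from \<open>p\<close> to \<open>q\<close> has length \<open>L\<close>.\<close>

inductive joined_by :: "('a::topological_space, 'n::finite) chart set \<Rightarrow> ('a, 'n) riem_metric \<Rightarrow>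
    'a \<Rightarrow> 'a \<Rightarrow> real \<Rightarrow> bool" for A g where
  piece: "C1_curve A x \<Longrightarrow>
    joined_by A g (x 0) (x 1) (integral {0..1} (\<lambda>t. tnorm g (x t) (velocity A {0..1} x t)))"
| concat: "joined_by A g p q L \<Longrightarrow> joined_by A g q r L' \<Longrightarrow> joined_by A g p r (L + L')"

text \<open>Meaningful on a connected manifold, where every two points are joined by such a curve.\<close>

definition riem_dist :: "('a::topological_space, 'n::finite) chart set \<Rightarrow> ('a, 'n) riem_metric \<Rightarrow>
    'a \<Rightarrow> 'a \<Rightarrow> real" where
  "riem_dist A g p q = Inf {L. joined_by A g p q L}"


section \<open>Levi-Civita connection and curvature\<close>

definition christoffel :: "('a, 'n::finite) chart set \<Rightarrow> ('a, 'n) riem_metric \<Rightarrow> ('a, 'n) chart \<Rightarrow>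
    real ^ 'n \<Rightarrow> 'n \<Rightarrow> 'n \<Rightarrow> 'n \<Rightarrow> real" where
  "christoffel A g c y k i j = (1/2) * (\<Sum>l\<in>UNIV. matrix_inv (gram A g c y) $ k $ l *
     (partial i (\<lambda>z. gram A g c z $ j $ l) y + partial j (\<lambda>z. gram A g c z $ i $ l) y
      - partial l (\<lambda>z. gram A g c z $ i $ j) y))"

definition Gam :: "('a, 'n::finite) chart set \<Rightarrow> ('a, 'n) riem_metric \<Rightarrow> ('a, 'n) chart \<Rightarrow>
    real ^ 'n \<Rightarrow> real ^ 'n \<Rightarrow> real ^ 'n \<Rightarrow> real ^ 'n" where
  "Gam A g c y u v = (\<chi> k. \<Sum>i\<in>UNIV. \<Sum>j\<in>UNIV. christoffel A g c y k i j * u $ i * v $ j)"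

text \<open>\<open>\<nabla>\<^sub>\<xi> X\<close> at \<open>p\<close>, for a vector field \<open>X\<close> and a tangent vector \<open>\<xi>\<close> at \<open>p\<close>.\<close>

definition cov_deriv :: "('a, 'n::finite) chart set \<Rightarrow> ('a, 'n) riem_metric \<Rightarrow>
    ('a \<Rightarrow> ('a, 'n) tvec) \<Rightarrow> 'a \<Rightarrow> ('a, 'n) tvec \<Rightarrow> ('a, 'n) tvec" where
  "cov_deriv A g X p \<xi> = (\<lambda>c. if c \<in> charts_at A p
     then frechet_derivative (\<lambda>y. X (chart_inv c y) c) (at (snd c p)) (\<xi> c)
          + Gam A g c (snd c p) (\<xi> c) (X p c)
     else 0)"

text \<open>Vector fields along a curve defined on the whole real line, and their covariant derivatives
  with respect to the velocity of the curve.\<close>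

definition differentiable_along :: "('a, 'n::finite) chart set \<Rightarrow> (real \<Rightarrow> 'a) \<Rightarrow>
    (real \<Rightarrow> ('a, 'n) tvec) \<Rightarrow> bool" where
  "differentiable_along A x \<eta> \<longleftrightarrow>
     (\<forall>t. \<eta> t \<in> tangent_space A (x t)) \<and>
     (\<forall>t. \<forall>c\<in>charts_at A (x t). (\<lambda>s. \<eta> s c) differentiable (at t))"

definition cov_deriv_along :: "('a, 'n::finite) chart set \<Rightarrow> ('a, 'n) riem_metric \<Rightarrow> (real \<Rightarrow> 'a) \<Rightarrow>
    (real \<Rightarrow> ('a, 'n) tvec) \<Rightarrow> real \<Rightarrow> ('a, 'n) tvec" where
  "cov_deriv_along A g x \<eta> t = (\<lambda>c. if c \<in> charts_at A (x t)
     then vector_derivative (\<lambda>s. \<eta> s c) (at t)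
          + Gam A g c (snd c (x t)) (velocity A UNIV x t c) (\<eta> t c)
     else 0)"

text \<open>Sign convention:
  \<open>R(\<xi>,\<eta>)\<zeta> = \<nabla>\<^sub>\<xi> \<nabla>\<^sub>\<eta> \<zeta> - \<nabla>\<^sub>\<eta> \<nabla>\<^sub>\<xi> \<zeta> - \<nabla>\<^bsub>[\<xi>,\<eta>]\<^esub> \<zeta>\<close>,
  evaluated on vector fields with constant components in the chart.\<close>

definition curvature :: "('a, 'n::finite) chart set \<Rightarrow> ('a, 'n) riem_metric \<Rightarrow> 'a \<Rightarrow>
    ('a, 'n) tvec \<Rightarrow> ('a, 'n) tvec \<Rightarrow> ('a, 'n) tvec \<Rightarrow> ('a, 'n) tvec" where
  "curvature A g p \<xi> \<eta> \<zeta> = (\<lambda>c. if c \<in> charts_at A p then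
       (let y = snd c p in
          frechet_derivative (\<lambda>z. Gam A g c z (\<eta> c) (\<zeta> c)) (at y) (\<xi> c)
          - frechet_derivative (\<lambda>z. Gam A g c z (\<xi> c) (\<zeta> c)) (at y) (\<eta> c)
          + Gam A g c y (\<xi> c) (Gam A g c y (\<eta> c) (\<zeta> c))
          - Gam A g c y (\<eta> c) (Gam A g c y (\<xi> c) (\<zeta> c)))
     else 0)"

definition sectional_curvature :: "('a, 'n::finite) chart set \<Rightarrow> ('a, 'n) riem_metric \<Rightarrow> 'a \<Rightarrow>
    ('a, 'n) tvec \<Rightarrow> ('a, 'n) tvec \<Rightarrow> real" where
  "sectional_curvature A g p \<xi> \<eta> = g p (curvature A g p \<xi> \<eta> \<eta>) \<xi>
     / ((tnorm g p \<xi>)\<^sup>2 * (tnorm g p \<eta>)\<^sup>2 - (g p \<xi> \<eta>)\<^sup>2)"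

text \<open>Planes are given by linearly independent pairs. Inserting \<open>0\<close> yields the maximum
  of \<open>0\<close> and the supremum, also in dimension one where there are no planes.\<close>

definition K_max :: "('a, 'n::finite) chart set \<Rightarrow> ('a, 'n) riem_metric \<Rightarrow> 'a \<Rightarrow> real" where
  "K_max A g p = Sup (insert 0 {sectional_curvature A g p \<xi> \<eta> |\<xi> \<eta>.
     \<xi> \<in> tangent_space A p \<and> \<eta> \<in> tangent_space A p \<and>
     (\<forall>a b. (\<lambda>c. a *\<^sub>R \<xi> c + b *\<^sub>R \<eta> c) = (\<lambda>c. 0) \<longrightarrow> a = 0 \<and> b = 0)})"

definition gradient :: "('a, 'n::finite) chart set \<Rightarrow> ('a, 'n) riem_metric \<Rightarrow> ('a \<Rightarrow> real) \<Rightarrow>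
    'a \<Rightarrow> ('a, 'n) tvec" where
  "gradient A g U p = (THE v. v \<in> tangent_space A p \<and>
     (\<forall>\<xi>\<in>tangent_space A p. \<forall>c\<in>charts_at A p.
        g p v \<xi> = frechet_derivative (\<lambda>y. U (chart_inv c y)) (at (snd c p)) (\<xi> c)))"

definition hessian :: "('a, 'n::finite) chart set \<Rightarrow> ('a, 'n) riem_metric \<Rightarrow> ('a \<Rightarrow> real) \<Rightarrow>
    'a \<Rightarrow> ('a, 'n) tvec \<Rightarrow> ('a, 'n) tvec" where
  "hessian A g U p \<xi> = cov_deriv A g (gradient A g U) p \<xi>"


section \<open>Quasi-periodic systems and monotonicity\<close>

definition rationally_independent :: "real ^ 'k::finite \<Rightarrow> bool" where
  "rationally_independent \<omega> \<longleftrightarrow>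
     (\<forall>q :: 'k \<Rightarrow> rat. (\<Sum>i\<in>UNIV. of_rat (q i) * \<omega> $ i) = 0 \<longrightarrow> (\<forall>i. q i = 0))"

text \<open>Functions on the torus are functions on \<open>real ^ 'k\<close> that are \<open>2\<pi>\<close>-periodic in
  each coordinate; smoothness is joint in the torus and the manifold variable.\<close>

definition smooth_torus_family :: "('a, 'n::finite) chart set \<Rightarrow>
    (real ^ 'k::finite \<Rightarrow> 'a \<Rightarrow> ('a, 'n) tvec) \<Rightarrow> bool" where
  "smooth_torus_family A f \<longleftrightarrow>
     (\<forall>\<phi> p. f \<phi> p \<in> tangent_space A p) \<and>
     (\<forall>\<phi> i. f (\<phi> + axis i (2 * pi)) = f \<phi>) \<and>
     (\<forall>c\<in>A. smooth_on (UNIV \<times> snd c ` fst c) (\<lambda>(\<phi>, y). f \<phi> (chart_inv c y) c))"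

text \<open>The next two infima are minima: continuous functions on the compact unit sphere.\<close>

definition lambda_min :: "('a, 'n::finite) chart set \<Rightarrow> ('a, 'n) riem_metric \<Rightarrow>
    (real ^ 'k::finite \<Rightarrow> 'a \<Rightarrow> ('a, 'n) tvec) \<Rightarrow> real ^ 'k \<Rightarrow> 'a \<Rightarrow> real" where
  "lambda_min A g f \<phi> p =
     Inf {g p (cov_deriv A g (f \<phi>) p \<eta>) \<eta> |\<eta>. \<eta> \<in> tangent_space A p \<and> tnorm g p \<eta> = 1}"

definition mu_min :: "('a, 'n::finite) chart set \<Rightarrow> ('a, 'n) riem_metric \<Rightarrow> ('a \<Rightarrow> real) \<Rightarrow>
    'a \<Rightarrow> real" where
  "mu_min A g U p =
     Inf {g p (hessian A g U p \<eta>) \<eta> - (1/2) * (g p (gradient A g U p) \<eta>)\<^sup>2 |\<eta>.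
          \<eta> \<in> tangent_space A p \<and> tnorm g p \<eta> = 1}"

definition U_monotone :: "('a::topological_space, 'n::finite) chart set \<Rightarrow> ('a, 'n) riem_metric \<Rightarrow>
    (real ^ 'k::finite \<Rightarrow> 'a \<Rightarrow> ('a, 'n) tvec) \<Rightarrow> 'a set \<Rightarrow> bool" where
  "U_monotone A g f D \<longleftrightarrow> (\<exists>U. smooth_function A U \<and>
     (\<forall>\<phi>. \<forall>p\<in>closure D. lambda_min A g f \<phi> p + (1/2) * g p (gradient A g U p) (f \<phi> p) > 0) \<and>
     (\<forall>p\<in>D. mu_min A g U p \<ge> 2 * K_max A g p))"

definition solution :: "('a::topological_space, 'n::finite) chart set \<Rightarrow> ('a, 'n) riem_metric \<Rightarrow>
    (real ^ 'k::finite \<Rightarrow> 'a \<Rightarrow> ('a, 'n) tvec) \<Rightarrow> real ^ 'k \<Rightarrow> (real \<Rightarrow> 'a) \<Rightarrow> bool" where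
  "solution A g f \<omega> x \<longleftrightarrow>
     differentiable_curve A UNIV x \<and> differentiable_along A x (velocity A UNIV x) \<and>
     (\<forall>t. cov_deriv_along A g x (velocity A UNIV x) t = f (t *\<^sub>R \<omega>) (x t))"


section \<open>Hyperbolicity\<close>

text \<open>Exponential dichotomy on the real line of the linear system \<open>z' = L(t) z\<close>, where \<open>X\<close> is
  the fundamental solution, \<open>Y\<close> its pointwise inverse and \<open>P\<close> the dichotomy projection.\<close>

definition exponential_dichotomy :: "(real \<Rightarrow> 'e::real_normed_vector \<Rightarrow>\<^sub>L 'e) \<Rightarrow> bool" where
  "exponential_dichotomy L \<longleftrightarrow> (\<exists>X Y P N \<alpha>.
     (\<forall>t. (X has_vector_derivative (L t o\<^sub>L X t)) (at t)) \<and> X 0 = id_blinfun \<and>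
     (\<forall>t. X t o\<^sub>L Y t = id_blinfun \<and> Y t o\<^sub>L X t = id_blinfun) \<and>
     P o\<^sub>L P = P \<and> N > 0 \<and> \<alpha> > 0 \<and>
     (\<forall>t s. s \<le> t \<longrightarrow> norm (X t o\<^sub>L P o\<^sub>L Y s) \<le> N * exp (- \<alpha> * (t - s))) \<and>
     (\<forall>t s. t \<le> s \<longrightarrow> norm (X t o\<^sub>L (id_blinfun - P) o\<^sub>L Y s) \<le> N * exp (- \<alpha> * (s - t))))"

definition parallel_orthonormal_frame :: "('a, 'n::finite) chart set \<Rightarrow> ('a, 'n) riem_metric \<Rightarrow>
    (real \<Rightarrow> 'a) \<Rightarrow> (real \<Rightarrow> 'n \<Rightarrow> ('a, 'n) tvec) \<Rightarrow> bool" where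
  "parallel_orthonormal_frame A g x E \<longleftrightarrow>
     (\<forall>i. differentiable_along A x (\<lambda>t. E t i)) \<and>
     (\<forall>t i. cov_deriv_along A g x (\<lambda>s. E s i) t = (\<lambda>c. 0)) \<and>
     (\<forall>t i j. g (x t) (E t i) (E t j) = (if i = j then 1 else 0))"

text \<open>The right-hand side \<open>\<nabla>f(t\<omega>,x(t))\<eta> - R(\<eta>,\<tau>(t))\<tau>(t)\<close> of the variational system.\<close>

definition variational_rhs :: "('a, 'n::finite) chart set \<Rightarrow> ('a, 'n) riem_metric \<Rightarrow>
    (real ^ 'k::finite \<Rightarrow> 'a \<Rightarrow> ('a, 'n) tvec) \<Rightarrow> real ^ 'k \<Rightarrow> (real \<Rightarrow> 'a) \<Rightarrow> real \<Rightarrow>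
    ('a, 'n) tvec \<Rightarrow> ('a, 'n) tvec" where
  "variational_rhs A g f \<omega> x t \<eta> = (\<lambda>c. cov_deriv A g (f (t *\<^sub>R \<omega>)) (x t) \<eta> c
     - curvature A g (x t) \<eta> (velocity A UNIV x t) (velocity A UNIV x t) c)"

text \<open>The variational system \<open>\<nabla>\<^sub>\<tau>\<eta> = \<zeta>\<close>, \<open>\<nabla>\<^sub>\<tau>\<zeta> = \<nabla>f \<eta> - R(\<eta>,\<tau>)\<tau>\<close> in a
  parallel orthonormal frame: if \<open>\<eta> = \<Sum>\<^sub>i a\<^sub>i E\<^sub>i\<close> and \<open>\<zeta> = \<Sum>\<^sub>i b\<^sub>i E\<^sub>i\<close>, then
  \<open>\<nabla>\<^sub>\<tau>\<eta> = \<Sum>\<^sub>i a\<^sub>i' E\<^sub>i\<close> and \<open>\<nabla>\<^sub>\<tau>\<zeta> = \<Sum>\<^sub>i b\<^sub>i' E\<^sub>i\<close>, so that it becomes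
  \<open>a' = b\<close>, \<open>b' = M(t) a\<close> with \<open>M\<close> the matrix of the right-hand side in the frame.\<close>

definition variational_matrix :: "('a, 'n::finite) chart set \<Rightarrow> ('a, 'n) riem_metric \<Rightarrow>
    (real ^ 'k::finite \<Rightarrow> 'a \<Rightarrow> ('a, 'n) tvec) \<Rightarrow> real ^ 'k \<Rightarrow> (real \<Rightarrow> 'a) \<Rightarrow>
    (real \<Rightarrow> 'n \<Rightarrow> ('a, 'n) tvec) \<Rightarrow> real \<Rightarrow> real ^ 'n ^ 'n" where
  "variational_matrix A g f \<omega> x E t =
     (\<chi> i j. g (x t) (variational_rhs A g f \<omega> x t (E t j)) (E t i))"

definition variational_system :: "('a, 'n::finite) chart set \<Rightarrow> ('a, 'n) riem_metric \<Rightarrow>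
    (real ^ 'k::finite \<Rightarrow> 'a \<Rightarrow> ('a, 'n) tvec) \<Rightarrow> real ^ 'k \<Rightarrow> (real \<Rightarrow> 'a) \<Rightarrow>
    (real \<Rightarrow> 'n \<Rightarrow> ('a, 'n) tvec) \<Rightarrow> real \<Rightarrow> (((real ^ 'n) \<times> (real ^ 'n)) \<Rightarrow>\<^sub>L ((real ^ 'n) \<times> (real ^ 'n)))" where
  "variational_system A g f \<omega> x E t =
     Blinfun (\<lambda>(a, b). (b, variational_matrix A g f \<omega> x E t *v a))"

text \<open>Two parallel orthonormal frames along \<open>x\<close> differ by a constant orthogonal matrix, so the
  choice of the frame is irrelevant; the existential form asserts that there is one.\<close>

definition hyperbolic :: "('a, 'n::finite) chart set \<Rightarrow> ('a, 'n) riem_metric \<Rightarrow>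
    (real ^ 'k::finite \<Rightarrow> 'a \<Rightarrow> ('a, 'n) tvec) \<Rightarrow> real ^ 'k \<Rightarrow> (real \<Rightarrow> 'a) \<Rightarrow> bool" where
  "hyperbolic A g f \<omega> x \<longleftrightarrow> (\<exists>E. parallel_orthonormal_frame A g x E \<and>
     exponential_dichotomy (variational_system A g f \<omega> x E))"

end

theory Submission
  imports Defs
begin

text \<open>
  Put \<open>u(t) = U(x(t))\<close> and let \<open>\<tau>\<close> be the velocity of the solution. In a parallel orthonormal
  frame the variational system is \<open>a' = b\<close>, \<open>b' = M(t) a\<close>, where \<open>\<langle>M a, a\<rangle>\<close> is
  \<open>\<langle>\<nabla>f \<eta>, \<eta>\<rangle> - \<langle>R(\<eta>,\<tau>)\<tau>, \<eta>\<rangle>\<close> for the vector \<open>\<eta>\<close> with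
  components \<open>a\<close>. The form \<open>Q = \<langle>a, b\<rangle> + (u'/2) \<bar>a\<bar>\<^sup>2\<close> has the derivative
  \<open>\<bar>b + (u'/2) a\<bar>\<^sup>2 + (u''/2 - (u'/2)\<^sup>2) \<bar>a\<bar>\<^sup>2 + \<langle>M a, a\<rangle>\<close> along solutions. Since
  \<open>u' = \<langle>\<nabla>U, \<tau>\<rangle>\<close> and \<open>u'' = \<langle>H\<^sub>U \<tau>, \<tau>\<rangle> + \<langle>\<nabla>U, f\<rangle>\<close>, the coefficient
  \<open>u''/2 - (u'/2)\<^sup>2\<close> is at least \<open>\<mu>\<^sub>U \<bar>\<tau>\<bar>\<^sup>2 / 2 + \<langle>\<nabla>U, f\<rangle> / 2\<close>, and the curvature term
  is at most \<open>K \<bar>\<tau>\<bar>\<^sup>2 \<bar>a\<bar>\<^sup>2\<close>. Hence \<open>\<mu>\<^sub>U \<ge> 2 K\<close> absorbs the curvature, and what remains is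
  \<open>\<lambda>\<^sub>f + \<langle>\<nabla>U, f\<rangle> / 2 > 0\<close>: the form \<open>Q\<close> increases strictly along nonzero solutions
  (\<open>monotone_estimate\<close>).

  The strict inequality is uniform because \<open>\<T>\<^sup>k \<times> cl(D)\<close> is compact. For \<open>cl(D)\<close> this is the
  theorem of Hopf and Rinow. It is obtained in its metric form: a complete, locally compact
  length space is proper (\<open>complete_length_space_proper\<close>). To apply it one needs that the Riemannian
  distance is a metric for the manifold topology and that curves can be cut at any prescribed
  length (\<open>bounded_closure_compact\<close>).

  A bounded form that increases uniformly along solutions and has complementary negative and positive
  subspaces forces an exponential dichotomy (\<open>exponential_dichotomy_of_monotone_form\<close>,
  \<open>second_order_dichotomy\<close>): the solutions on which \<open>Q\<close> is negative for all times decay, those on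
  which it is positive for all times grow, and the splitting is a limit of splittings that are
  prescribed at the times \<open>\<plusminus>T\<close>.

  Two geometric points need care. The metric is constrained on tangent vectors only, so that coordinate
  computations are meaningful only after the covariant derivative and the curvature have been shown
  to be tangent vectors (\<open>cov_deriv_tangent\<close>, \<open>curvature_tangent\<close>). And the supremum defining \<open>K\<close>
  bounds the sectional curvatures only because these are bounded at each point, which rests on the
  skew symmetries of the curvature (\<open>Rc_metric_skew\<close>, \<open>sectional_form_bound\<close>).
\<close>

section \<open>Linear ordinary differential equations\<close>

lemma continuous_has_antiderivative:
  fixes f :: "real \<Rightarrow> 'b::banach"
  assumes "continuous_on UNIV f"
  shows "\<exists>F. F 0 = 0 \<and> (\<forall>t. (F has_vector_derivative f t) (at t))"
proof -
  define F where "F t = integral {0..t} f - integral {t..0} f" for t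
  have int: "f integrable_on {a..b}" for a b
    by (rule integrable_continuous_real) (rule continuous_on_subset[OF assms], simp)
  have F: "F t = integral {-N..t} f - integral {-N..0} f" if "\<bar>t\<bar> < N" for t N
  proof (cases "t \<ge> 0")
    case True
    have "integral {-N..0} f + integral {0..t} f = integral {-N..t} f"
      by (rule Henstock_Kurzweil_Integration.integral_combine) (use that True int in auto)
    then show ?thesis using True unfolding F_def by (cases "t = 0") (auto simp: algebra_simps)
  next
    case False
    have "integral {-N..t} f + integral {t..0} f = integral {-N..0} f"
      by (rule Henstock_Kurzweil_Integration.integral_combine) (use that False int in auto)
    then show ?thesis using False unfolding F_def by (auto simp: algebra_simps)
  qed
  have "(F has_vector_derivative f t) (at t)" for t
  proof -
    define N where "N = \<bar>t\<bar> + 1"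
    have t: "t \<in> {-N..N}" "t \<in> {-N<..<N}" by (auto simp: N_def)
    have "((\<lambda>u. integral {-N..u} f) has_vector_derivative f t) (at t within {-N..N})"
      by (rule integral_has_vector_derivative) (use t continuous_on_subset[OF assms] in auto)
    then have "((\<lambda>u. integral {-N..u} f) has_vector_derivative f t) (at t)"
      using t(2) by (simp add: at_within_Icc_at)
    then have "((\<lambda>u. integral {-N..u} f - integral {-N..0} f) has_vector_derivative f t) (at t)"
      by (auto intro!: derivative_eq_intros)
    then show ?thesis
      by (rule has_vector_derivative_transform_within_open[where S = "{-N<..<N}"])
         (use t(2) F[of _ N] in auto)
  qed
  moreover have "F 0 = 0" by (simp add: F_def)
  ultimately show ?thesis by blast
qed

text \<open>The weight \<open>exp (2 K \<bar>t\<bar>)\<close> reproduces itself under integration up to the factor \<open>1 / (2 K)\<close>. A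
  right-hand side of size \<open>K\<close> therefore contracts by \<open>1/2\<close>.\<close>

lemma norm_le_exp_of_derivative_bound:
  fixes F :: "real \<Rightarrow> 'b::banach"
  assumes "F 0 = 0" "\<And>t. (F has_vector_derivative F' t) (at t)" "K > 0" "C \<ge> 0"
    and "\<And>t. norm (F' t) \<le> K * (C * exp (2 * K * \<bar>t\<bar>))"
  shows "norm (F t) \<le> C / 2 * exp (2 * K * \<bar>t\<bar>)"
proof -
  have main: "norm (G T) \<le> C / 2 * exp (2 * K * T)"
    if "G 0 = 0" "\<And>t. (G has_vector_derivative G' t) (at t)" "T > 0"
      "\<And>t. t > 0 \<Longrightarrow> norm (G' t) \<le> K * (C * exp (2 * K * t))" for G G' :: "real \<Rightarrow> 'b" and T
  proof -
    have "norm (G T - G 0) \<le> C / 2 * exp (2 * K * T) - C / 2 * exp (2 * K * 0)"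
    proof (rule differentiable_bound_general[where f' = G' and \<phi>' = "\<lambda>t. K * (C * exp (2 * K * t))"])
      show "continuous_on {0..T} G"
        by (rule continuous_on_vector_derivative) (use that(2) has_vector_derivative_at_within in blast)
      show "((\<lambda>t. C / 2 * exp (2 * K * t)) has_vector_derivative K * (C * exp (2 * K * x))) (at x)" for x
        by (auto intro!: derivative_eq_intros simp flip: has_real_derivative_iff_has_vector_derivative)
    qed (use that in \<open>auto intro!: continuous_intros\<close>)
    then show ?thesis using that(1) assms(4) by simp
  qed
  consider "t > 0" | "t = 0" | "t < 0" by linarith
  then show ?thesis
  proof cases
    case 1
    have "norm (F' t) \<le> K * (C * exp (2 * K * t))" if "t > 0" for t
      using assms(5)[of t] that by simp
    then show ?thesis using main[OF assms(1,2) 1] 1 by simp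
  next
    case 2
    then show ?thesis using assms by simp
  next
    case 3
    have d: "((\<lambda>t. F (- t)) has_vector_derivative - F' (- t)) (at t)" for t
      using vector_diff_chain_at[OF has_vector_derivative_minus[OF has_vector_derivative_id] assms(2), of t]
      by (simp add: o_def)
    have "norm (F' (- t)) \<le> K * (C * exp (2 * K * t))" if "t > 0" for t
      using assms(5)[of "-t"] that by simp
    then show ?thesis using main[OF _ d, of "-t"] assms 3 by simp
  qed
qed

text \<open>Picard iteration. In the norm with the weight \<open>exp (- 2 K \<bar>t\<bar>)\<close> each correction has at most half the
  size of the preceding one, so that the series of corrections converges geometrically, and
  uniformly on bounded intervals. The coefficient is a family of linear operators on a Banach space in order
  to cover matrix equations, multiplication from the left or the right, and parallel transport.\<close>

theorem linear_ode_solvable: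
  fixes a :: "real \<Rightarrow> 'b::banach \<Rightarrow> 'b"
  assumes lin: "\<And>t. linear (a t)" and bnd: "\<And>t y. norm (a t y) \<le> K * norm y"
    and cont: "\<And>y. continuous_on UNIV y \<Longrightarrow> continuous_on UNIV (\<lambda>t. a t (y t))"
  shows "\<exists>x. x t0 = x0 \<and> (\<forall>t. (x has_vector_derivative a t (x t)) (at t))"
proof -
  have main: "\<exists>x. x 0 = x0 \<and> (\<forall>t. (x has_vector_derivative b t (x t)) (at t))"
    if lin: "\<And>t. linear (b t)" and bnd: "\<And>t y. norm (b t y) \<le> K * norm y" and K: "K > 0"
      and cont: "\<And>y. continuous_on UNIV y \<Longrightarrow> continuous_on UNIV (\<lambda>t. b t (y t))" 
    for b :: "real \<Rightarrow> 'b \<Rightarrow> 'b" and K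
  proof -
    define I where "I g = (SOME F. F 0 = 0 \<and> (\<forall>t. (F has_vector_derivative g t) (at t)))"
      for g :: "real \<Rightarrow> 'b"
    have I: "I g 0 = 0" "(I g has_vector_derivative g t) (at t)" if "continuous_on UNIV g" for g t
      using someI_ex[OF continuous_has_antiderivative[OF that]] unfolding I_def by blast+
    define f where "f = rec_nat (\<lambda>t. x0) (\<lambda>n y. I (\<lambda>t. b t (y t)))"
    have f0: "f 0 = (\<lambda>t. x0)" and fS: "f (Suc n) = I (\<lambda>t. b t (f n t))" for n
      by (simp_all add: f_def)
    have fc: "continuous_on UNIV (f n)" for n
    proof (induction n)
      case (Suc n)
      show ?case unfolding fS
        by (rule continuous_on_vector_derivative)
           (use I(2)[OF cont[OF Suc]] has_vector_derivative_at_within in blast)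
    qed (simp add: f0)
    have fS0: "f (Suc n) 0 = 0" for n unfolding fS by (rule I(1)[OF cont[OF fc]])
    have fd: "(f (Suc n) has_vector_derivative b t (f n t)) (at t)" for n t
      unfolding fS by (rule I(2)[OF cont[OF fc]])
    define c where "c = norm x0"
    have fb: "norm (f n t) \<le> (c * (1/2)^n) * exp (2 * K * \<bar>t\<bar>)" for n t
    proof (induction n arbitrary: t)
      case 0
      then show ?case using K by (simp add: f0 c_def mult_le_cancel_left1)
    next
      case (Suc n)
      have "norm (b t (f n t)) \<le> K * ((c * (1/2)^n) * exp (2 * K * \<bar>t\<bar>))" for t
        using order_trans[OF bnd mult_left_mono[OF Suc]] K by simp
      from norm_le_exp_of_derivative_bound[OF fS0 fd K _ this, of t]
      show ?case by (simp add: c_def field_simps)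
    qed
    define x where "x t = (\<Sum>n. f n t)" for t
    have "(x has_vector_derivative b t (x t)) (at t)" for t
    proof -
      define R where "R = \<bar>t\<bar> + 1"
      define S where "S = {-R<..<R}"
      define M where "M n = (c * exp (2 * K * R)) * (1/2)^n" for n
      have Ms: "summable M" unfolding M_def by (intro summable_mult summable_geometric) simp
      have M: "norm (f n s) \<le> M n" if "s \<in> S" for n s
      proof -
        have "(c * (1/2)^n) * exp (2 * K * \<bar>s\<bar>) \<le> (c * (1/2)^n) * exp (2 * K * R)"
          by (rule mult_left_mono) (use that K in \<open>auto simp: S_def c_def\<close>)
        then show ?thesis using fb[of n s] unfolding M_def by (simp add: mult_ac)
      qed
      have unif: "uniform_limit S (\<lambda>n s. \<Sum>i<n. f i s) x sequentially"
        unfolding x_def by (rule Weierstrass_m_test[OF M Ms]) auto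
      have sums: "(\<lambda>n. f n s) sums x s" if "s \<in> S" for s
        unfolding x_def by (rule summable_sums, rule summable_comparison_test[OF _ Ms]) (use M that in auto)
      define f' where "f' n s h = h *\<^sub>R (case n of 0 \<Rightarrow> 0 | Suc m \<Rightarrow> b s (f m s))" for n s and h :: real
      have f': "(f n has_derivative f' n s) (at s within S)" for n s
      proof -
        have "(f n has_vector_derivative (case n of 0 \<Rightarrow> 0 | Suc m \<Rightarrow> b s (f m s))) (at s)"
          by (cases n) (auto simp: f0 fd)
        then have "(f n has_derivative f' n s) (at s)" unfolding has_vector_derivative_def f'_def .
        then show ?thesis by (rule has_derivative_at_withinI)
      qed
      have f'sum: "(\<Sum>i<Suc n. f' i s h) = h *\<^sub>R b s (\<Sum>i<n. f i s)" for n s h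
        by (induction n) (auto simp: f'_def linear_0[OF lin] linear_add[OF lin] algebra_simps)
      have ev: "\<forall>\<^sub>F n in sequentially. \<forall>s\<in>S. \<forall>h. norm ((\<Sum>i<n. f' i s h) - h *\<^sub>R b s (x s)) \<le> e * norm h"
        if "e > 0" for e
      proof -
        have "\<forall>\<^sub>F n in sequentially. \<forall>s\<in>S. dist (\<Sum>i<n. f i s) (x s) < e / K"
          using uniform_limitD[OF unif] that K by simp
        then have "\<forall>\<^sub>F n in sequentially. \<forall>s\<in>S. \<forall>h. norm ((\<Sum>i<Suc n. f' i s h) - h *\<^sub>R b s (x s)) \<le> e * norm h"
        proof eventually_elim
          case (elim n)
          show ?case
          proof (intro ballI allI)
            fix s h assume "s \<in> S"
            have "norm (b s ((\<Sum>i<n. f i s) - x s)) \<le> K * (e / K)"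
              using elim \<open>s \<in> S\<close> K by (intro order_trans[OF bnd] mult_left_mono) (auto simp: dist_norm less_imp_le)
            then have "norm (h *\<^sub>R b s ((\<Sum>i<n. f i s) - x s)) \<le> \<bar>h\<bar> * e"
              using K by (auto intro!: mult_left_mono)
            then show "norm ((\<Sum>i<Suc n. f' i s h) - h *\<^sub>R b s (x s)) \<le> e * norm h"
              unfolding f'sum by (simp add: linear_diff[OF lin] scaleR_diff_right mult.commute)
          qed
        qed
        then show ?thesis by (subst eventually_sequentially_Suc[symmetric])
      qed
      have t: "t \<in> S" by (auto simp: S_def R_def)
      obtain g where g: "\<And>s. s \<in> S \<Longrightarrow> (\<lambda>n. f n s) sums g s"
        "\<And>s. s \<in> S \<Longrightarrow> (g has_derivative (\<lambda>h. h *\<^sub>R b s (x s))) (at s within S)"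
        using has_derivative_series[of S f f' "\<lambda>s h. h *\<^sub>R b s (x s)" t "x t", OF _ f' ev t sums[OF t]]
          convex_real_interval(8)[of "-R" R] S_def by blast
      have "g s = x s" if "s \<in> S" for s using g(1)[OF that] sums[OF that] sums_unique2 by blast
      moreover have "(g has_vector_derivative b t (x t)) (at t)"
        using g(2)[OF t] at_within_open[OF t] unfolding has_vector_derivative_def
        by (simp add: S_def)
      ultimately show ?thesis
        by (intro has_vector_derivative_transform_within_open[of g _ t S x]) (use t in \<open>auto simp: S_def\<close>)
    qed
    moreover have "x 0 = x0"
    proof -
      have "f n 0 = 0" if "n \<notin> {0}" for n using that fS0 by (cases n) auto
      then show ?thesis unfolding x_def using suminf_finite[of "{0}" "\<lambda>n. f n 0"] by (simp add: f0)
    qed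
    ultimately show ?thesis by blast
  qed
  define K' where "K' = \<bar>K\<bar> + 1"
  have K': "K' > 0" by (simp add: K'_def)
  have "norm (a t y) \<le> K' * norm y" for t y
    by (rule order_trans[OF bnd mult_right_mono]) (auto simp: K'_def)
  moreover have "continuous_on UNIV (\<lambda>t. a (t + t0) (y t))" if "continuous_on UNIV y" for y
  proof -
    have "continuous_on UNIV (\<lambda>t. y (t - t0))"
      by (intro continuous_on_compose2[OF that] continuous_intros) auto
    from continuous_on_compose2[OF cont[OF this], of UNIV "\<lambda>t. t + t0"] show ?thesis
      by (simp add: continuous_on_add)
  qed
  ultimately obtain x where x: "x 0 = x0" "\<And>t. (x has_vector_derivative a (t + t0) (x t)) (at t)"
    using main[of "\<lambda>t. a (t + t0)" K'] lin K' by blast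
  have "((\<lambda>t. x (t - t0)) has_vector_derivative a t (x (t - t0))) (at t)" for t
  proof -
    have "((\<lambda>t. t - t0) has_vector_derivative 1) (at t)"
      unfolding has_real_derivative_iff_has_vector_derivative[symmetric] by (auto intro!: derivative_eq_intros)
    from vector_diff_chain_at[OF this x(2)] show ?thesis by (simp add: o_def)
  qed
  then show ?thesis using x(1) by (intro exI[of _ "\<lambda>t. x (t - t0)"]) auto
qed

text \<open>An injective endomorphism of a finite-dimensional space is surjective.\<close>

lemma blinfun_left_inverse_imp_right_inverse:
  fixes X Y :: "'e::euclidean_space \<Rightarrow>\<^sub>L 'e"
  assumes "Y o\<^sub>L X = id_blinfun"
  shows "X o\<^sub>L Y = id_blinfun"
proof -
  have YX: "Y (X v) = v" for v
    by (metis assms blinfun_apply_blinfun_compose blinfun_apply_id_blinfun id_apply)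
  have "linear (blinfun_apply X)" by (simp add: blinfun.bounded_linear_right bounded_linear.linear)
  moreover have "inj (blinfun_apply X)" by (metis YX injI)
  ultimately have "surj (blinfun_apply X)" by (rule linear_injective_imp_surjective) (rule refl)
  then have "X (Y v) = v" for v by (metis YX surjD)
  then show ?thesis by (intro blinfun_eqI) simp
qed

text \<open>The inverse is obtained as a solution of \<open>Y' = - Y L\<close>, because then \<open>Y X\<close> has derivative zero.\<close>

theorem fundamental_solution_exists:
  fixes L :: "real \<Rightarrow> 'e::euclidean_space \<Rightarrow>\<^sub>L 'e"
  assumes L: "continuous_on UNIV L" "\<And>t. norm (L t) \<le> K"
  shows "\<exists>X Y. X 0 = id_blinfun \<and> (\<forall>t. (X has_vector_derivative (L t o\<^sub>L X t)) (at t)) \<and>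
    (\<forall>t. X t o\<^sub>L Y t = id_blinfun \<and> Y t o\<^sub>L X t = id_blinfun)"
proof -
  note comp_linear = bounded_bilinear_blinfun_compose[THEN bounded_bilinear.bounded_linear_left]
    bounded_bilinear_blinfun_compose[THEN bounded_bilinear.bounded_linear_right]
  obtain X :: "real \<Rightarrow> 'e \<Rightarrow>\<^sub>L 'e" where X: "X 0 = id_blinfun"
    "\<And>t. (X has_vector_derivative (L t o\<^sub>L X t)) (at t)"
  proof (atomize_elim, rule exE[OF linear_ode_solvable[of "\<lambda>t Z. L t o\<^sub>L Z" K 0 id_blinfun]])
    show "linear ((o\<^sub>L) (L t))" for t
      by (rule bounded_linear.linear[OF comp_linear(2)])
    show "norm (L t o\<^sub>L y) \<le> K * norm y" for t and y :: "'e \<Rightarrow>\<^sub>L 'e"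
      by (rule order_trans[OF norm_blinfun_compose mult_right_mono[OF L(2)]]) simp
  qed (auto intro!: continuous_intros L)
  obtain Y :: "real \<Rightarrow> 'e \<Rightarrow>\<^sub>L 'e" where Y: "Y 0 = id_blinfun"
    "\<And>t. (Y has_vector_derivative - (Y t o\<^sub>L L t)) (at t)"
  proof (atomize_elim, rule exE[OF linear_ode_solvable[of "\<lambda>t Z. - (Z o\<^sub>L L t)" K 0 id_blinfun]])
    show "linear (\<lambda>Z::'e \<Rightarrow>\<^sub>L 'e. - (Z o\<^sub>L L t))" for t
      by (intro linear_compose_neg bounded_linear.linear[OF comp_linear(1)])
    show "norm (- (y o\<^sub>L L t)) \<le> K * norm y" for t and y :: "'e \<Rightarrow>\<^sub>L 'e"
      using order_trans[OF norm_blinfun_compose mult_left_mono[OF L(2)]] by (simp add: mult.commute)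
  qed (auto intro!: continuous_intros L)
  have "((\<lambda>t. Y t o\<^sub>L X t) has_vector_derivative 0) (at t)" for t
    using bounded_bilinear.has_vector_derivative[OF bounded_bilinear_blinfun_compose Y(2)[of t] X(2)[of t]]
    by (elim has_vector_derivative_eq_rhs) (auto intro!: blinfun_eqI simp: blinfun.bilinear_simps)
  then obtain c where "\<And>t. Y t o\<^sub>L X t = c"
    using has_vector_derivative_zero_constant[OF convex_UNIV, where f = "\<lambda>t. Y t o\<^sub>L X t"] by auto
  then have "Y t o\<^sub>L X t = id_blinfun" for t
    using X(1) Y(1) by (metis blinfun_apply_blinfun_compose blinfun_apply_id_blinfun blinfun_eqI id_apply)
  then show ?thesis using X blinfun_left_inverse_imp_right_inverse by blast
qed

section \<open>Exponential dichotomy from an indefinite Lyapunov form\<close>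

lemma exp_comparison:
  fixes q :: "real \<Rightarrow> real"
  assumes "\<And>t. (q has_real_derivative q' t) (at t)" "\<And>t. q' t \<le> - \<gamma> * q t" "s \<le> t"
  shows "q t \<le> exp (- \<gamma> * (t - s)) * q s"
proof -
  have "exp (\<gamma> * t) * q t \<le> exp (\<gamma> * s) * q s"
  proof (rule DERIV_nonpos_imp_nonincreasing[OF assms(3)])
    fix x
    have "((\<lambda>t. exp (\<gamma> * t) * q t) has_real_derivative exp (\<gamma> * x) * (\<gamma> * q x + q' x)) (at x)"
      by (auto intro!: derivative_eq_intros assms(1) simp: algebra_simps)
    moreover have "exp (\<gamma> * x) * (\<gamma> * q x + q' x) \<le> 0"
      using assms(2)[of x] by (intro mult_nonneg_nonpos) auto
    ultimately show "\<exists>y. ((\<lambda>t. exp (\<gamma> * t) * q t) has_real_derivative y) (at x) \<and> y \<le> 0" by blast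
  qed
  then have "exp (- \<gamma> * t) * (exp (\<gamma> * t) * q t) \<le> exp (- \<gamma> * t) * (exp (\<gamma> * s) * q s)"
    by (intro mult_left_mono) auto
  then show ?thesis by (simp add: algebra_simps flip: exp_add mult.assoc)
qed

text \<open>If a bounded quadratic form grows along solutions at a rate \<open>c \<bar>z\<bar>\<^sup>2\<close>, then so do its
  perturbations by \<open>\<plusminus> \<beta> \<bar>z\<bar>\<^sup>2\<close> for small \<open>\<beta>\<close>. Hence the condition \<open>Q \<le> - \<beta> \<bar>z\<bar>\<^sup>2\<close> is inherited by
  earlier times and \<open>Q \<ge> \<beta> \<bar>z\<bar>\<^sup>2\<close> by later ones. A splitting into solutions that are negative at the
  time \<open>T\<close> and solutions that are positive at \<open>- T\<close> is therefore negative and positive on all of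
  \<open>[-T, T]\<close>; this bounds its projections uniformly, and a limit along a sequence \<open>T \<rightarrow> \<infinity>\<close> consists of solutions that
  are negative, respectively positive, for all times. On these, \<open>\<bar>Q\<bar>\<close> is comparable to \<open>\<bar>z\<bar>\<^sup>2\<close> and satisfies
  a differential inequality that makes it decay exponentially. The hypothesis \<open>split\<close> fixes the
  dimensions: the equation \<open>z' = tanh(t) z\<close> with the increasing form \<open>tanh(t) z\<^sup>2\<close> shows that
  monotonicity alone yields dichotomies on the two half-lines only.\<close>

theorem exponential_dichotomy_of_monotone_form:
  fixes L :: "real \<Rightarrow> 'e::euclidean_space \<Rightarrow>\<^sub>L 'e" and B :: "real \<Rightarrow> 'e \<Rightarrow> 'e \<Rightarrow> real"
  assumes X: "\<And>t. (X has_vector_derivative (L t o\<^sub>L X t)) (at t)" "X 0 = id_blinfun"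
    and XY: "\<And>t. X t o\<^sub>L Y t = id_blinfun" "\<And>t. Y t o\<^sub>L X t = id_blinfun"
    and L: "\<And>t. norm (L t) \<le> K"
    and B: "\<And>t. bounded_bilinear (B t)" "\<And>t u v. B t u v = B t v u"
      "\<And>t u v. \<bar>B t u v\<bar> \<le> C * norm u * norm v"
    and mono: "\<And>v t. \<exists>d \<ge> c * (norm (X t v))\<^sup>2.
      ((\<lambda>s. B s (X s v) (X s v)) has_real_derivative d) (at t)"
    and pos: "c > 0" "b > 0" "C > 0"
    and split: "\<And>T. T \<ge> 0 \<Longrightarrow> \<exists>P. linear P \<and> (\<forall>z. P (P z) = P z) \<and>
      (\<forall>z. B T (X T (P z)) (X T (P z)) \<le> - b * (norm (X T (P z)))\<^sup>2) \<and>
      (\<forall>z. b * (norm (X (-T) (z - P z)))\<^sup>2 \<le> B (-T) (X (-T) (z - P z)) (X (-T) (z - P z)))"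
  shows "exponential_dichotomy L"
proof -
  have K0: "K \<ge> 0" using order_trans[OF norm_ge_zero L[of 0]] .
  define \<beta> where "\<beta> = min b (c / (2 * K + 1))"
  have \<beta>: "\<beta> > 0" "\<beta> \<le> b" "2 * K * \<beta> \<le> c"
  proof -
    have "(2 * K + 1) * \<beta> \<le> (2 * K + 1) * (c / (2 * K + 1))"
      unfolding \<beta>_def using K0 by (intro mult_left_mono) auto
    then have "(2 * K + 1) * \<beta> \<le> c" using K0 by simp
    moreover show "\<beta> > 0" using pos K0 by (simp add: \<beta>_def)
    ultimately show "2 * K * \<beta> \<le> c" by (simp add: algebra_simps)
    show "\<beta> \<le> b" by (simp add: \<beta>_def)
  qed
  define q where "q v t = B t (X t v) (X t v)" for v t
  obtain q' where q': "\<And>v t. q' v t \<ge> c * (norm (X t v))\<^sup>2"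
    "\<And>v t. (q v has_real_derivative q' v t) (at t)"
  proof (atomize_elim, intro exI conjI allI)
    let ?d = "\<lambda>v t. SOME d. d \<ge> c * (norm (X t v))\<^sup>2 \<and> ((\<lambda>s. B s (X s v) (X s v)) has_real_derivative d) (at t)"
    have d: "?d v t \<ge> c * (norm (X t v))\<^sup>2 \<and> ((\<lambda>s. B s (X s v) (X s v)) has_real_derivative ?d v t) (at t)" for v t
      by (rule someI_ex) (use mono[where v=v and t=t] in blast)
    show "?d v t \<ge> c * (norm (X t v))\<^sup>2" "(q v has_real_derivative ?d v t) (at t)" for v t
      using d[of t v] unfolding q_def[abs_def] by blast+
  qed
  have qC: "\<bar>q v t\<bar> \<le> C * (norm (X t v))\<^sup>2" for v t
    using B(3)[of t "X t v" "X t v"] by (simp add: q_def power2_eq_square)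
  have Xv: "((\<lambda>t. X t v) has_vector_derivative L t (X t v)) (at t)" for v t
    using bounded_linear.has_vector_derivative[OF blinfun.bounded_linear_left X(1)[of t], of v] by simp
  have n2: "((\<lambda>t. (norm (X t v))\<^sup>2) has_real_derivative 2 * (X t v \<bullet> L t (X t v))) (at t)" for v t
    unfolding power2_norm_eq_inner has_real_derivative_iff_has_vector_derivative
    using bounded_bilinear.has_vector_derivative[OF bounded_bilinear_inner Xv Xv, of v v t]
    by (simp add: inner_commute)
  have n2b: "\<bar>2 * (X t v \<bullet> L t (X t v))\<bar> \<le> 2 * K * (norm (X t v))\<^sup>2" for v t
  proof -
    have "\<bar>X t v \<bullet> L t (X t v)\<bar> \<le> norm (X t v) * norm (L t (X t v))" by (rule Cauchy_Schwarz_ineq2)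
    also have "\<dots> \<le> norm (X t v) * (K * norm (X t v))"
      using norm_blinfun[of "L t" "X t v"] mult_right_mono[OF L[of t] norm_ge_zero[of "X t v"]]
      by (intro mult_left_mono) auto
    finally show ?thesis by (simp add: power2_eq_square algebra_simps)
  qed
  \<comment> \<open>Adding \<open>\<plusminus>\<beta>\<bar>z\<bar>\<^sup>2\<close> does not destroy the monotonicity of the form.\<close>
  have mono_pert: "q v s + \<sigma> * (norm (X s v))\<^sup>2 \<le> q v t + \<sigma> * (norm (X t v))\<^sup>2"
    if "s \<le> t" "\<bar>\<sigma>\<bar> \<le> \<beta>" for v s t \<sigma>
  proof (rule DERIV_nonneg_imp_nondecreasing[OF that(1)])
    fix x
    have "((\<lambda>t. q v t + \<sigma> * (norm (X t v))\<^sup>2) has_real_derivative q' v x + \<sigma> * (2 * (X x v \<bullet> L x (X x v)))) (at x)"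
      by (intro DERIV_add DERIV_cmult q'(2) n2)
    moreover have "q' v x + \<sigma> * (2 * (X x v \<bullet> L x (X x v))) \<ge> 0"
    proof -
      have "\<bar>\<sigma> * (2 * (X x v \<bullet> L x (X x v)))\<bar> \<le> \<beta> * (2 * K * (norm (X x v))\<^sup>2)"
        unfolding abs_mult[of \<sigma>] by (intro mult_mono that n2b) (use \<beta> in auto)
      also have "\<dots> = (2 * K * \<beta>) * (norm (X x v))\<^sup>2" by simp
      also have "\<dots> \<le> c * (norm (X x v))\<^sup>2" by (intro mult_right_mono \<beta>) auto
      finally show ?thesis using q'(1)[where v=v and t=x] by linarith
    qed
    ultimately show "\<exists>y. ((\<lambda>t. q v t + \<sigma> * (norm (X t v))\<^sup>2) has_real_derivative y) (at x) \<and> 0 \<le> y" by blast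
  qed
  define Neg where "Neg v t \<longleftrightarrow> q v t \<le> - \<beta> * (norm (X t v))\<^sup>2" for v t
  define Pos where "Pos v t \<longleftrightarrow> \<beta> * (norm (X t v))\<^sup>2 \<le> q v t" for v t
  have Neg_back: "Neg v s" if "Neg v t" "s \<le> t" for v s t
    using mono_pert[OF that(2), of \<beta> v] that(1) \<beta> unfolding Neg_def by simp
  have Pos_forth: "Pos v t" if "Pos v s" "s \<le> t" for v s t
    using mono_pert[OF that(2), of "-\<beta>" v] that(1) \<beta> unfolding Pos_def by simp
  \<comment> \<open>Negative and positive vectors stay apart: the form changes by a definite amount between them.\<close>
  have transversal: "norm (X t v) + norm (X t w) \<le> 2 * C / \<beta> * norm (X t (v + w))"
    if "Neg v t" "Pos w t" for v w t
  proof -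
    define V W where "V = X t v" and "W = X t w"
    interpret B: bounded_bilinear "B t" by (rule B)
    have "\<beta> * ((norm V)\<^sup>2 + (norm W)\<^sup>2) \<le> B t W W - B t V V"
      using that unfolding Neg_def Pos_def q_def V_def W_def by (simp add: algebra_simps)
    also have "\<dots> = B t (V + W) (W - V)"
      by (simp add: B.add_left B.diff_right B(2)[of t V W])
    also have "\<dots> \<le> C * norm (V + W) * norm (W - V)" using B(3)[of t "V + W" "W - V"] by linarith
    also have "\<dots> \<le> C * norm (V + W) * (norm V + norm W)"
      using pos norm_triangle_ineq4[of W V] by (intro mult_left_mono) auto
    finally have "\<beta> * ((norm V)\<^sup>2 + (norm W)\<^sup>2) \<le> C * norm (V + W) * (norm V + norm W)" .
    moreover have "(norm V + norm W)\<^sup>2 \<le> 2 * ((norm V)\<^sup>2 + (norm W)\<^sup>2)"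
      using zero_le_power2[of "norm V - norm W"] by (simp add: power2_eq_square algebra_simps)
    moreover from this have "\<beta> * (norm V + norm W)\<^sup>2 \<le> \<beta> * (2 * ((norm V)\<^sup>2 + (norm W)\<^sup>2))"
      using \<beta>(1) by (intro mult_left_mono) auto
    moreover have "\<dots> = 2 * (\<beta> * ((norm V)\<^sup>2 + (norm W)\<^sup>2))" by (rule mult.left_commute)
    ultimately have "\<beta> * (norm V + norm W)\<^sup>2 \<le> 2 * (C * norm (V + W) * (norm V + norm W))"
      by linarith
    then have "(norm V + norm W) * (\<beta> * (norm V + norm W)) \<le> (norm V + norm W) * (2 * C * norm (V + W))"
      by (simp add: power2_eq_square algebra_simps)
    then have "norm V + norm W = 0 \<or> \<beta> * (norm V + norm W) \<le> 2 * C * norm (V + W)"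
      by (smt (verit, best) mult_le_cancel_left_pos norm_ge_zero)
    then have "\<beta> * (norm V + norm W) \<le> 2 * C * norm (V + W)" using pos by auto
    then show ?thesis
      using \<beta>(1) unfolding V_def W_def by (simp add: field_simps blinfun.bilinear_simps)
  qed
  \<comment> \<open>The decompositions at the times \<open>\<plusminus>T\<close> are uniformly bounded, hence a subsequence converges.\<close>
  have ex: "\<exists>P :: 'e \<Rightarrow>\<^sub>L 'e. P o\<^sub>L P = P \<and> norm P \<le> 2 * C / \<beta> \<and>
      (\<forall>z. Neg (P z) T) \<and> (\<forall>z. Pos (z - P z) (- T))" if T: "T \<ge> 0" for T
  proof -
    obtain P where P: "linear P" "\<And>z. P (P z) = P z"
      "\<And>z. q (P z) T \<le> - b * (norm (X T (P z)))\<^sup>2"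
      "\<And>z. b * (norm (X (-T) (z - P z)))\<^sup>2 \<le> q (z - P z) (- T)"
      using split[OF T] unfolding q_def by blast
    have N: "Neg (P z) T" for z
      unfolding Neg_def using P(3)[of z] mult_right_mono[OF \<beta>(2), of "(norm (X T (P z)))\<^sup>2"] by simp
    have Po: "Pos (z - P z) (-T)" for z
      unfolding Pos_def using P(4)[of z] mult_right_mono[OF \<beta>(2), of "(norm (X (-T) (z - P z)))\<^sup>2"] by simp
    have bl: "bounded_linear P" using P(1) by (simp add: linear_conv_bounded_linear)
    have "norm (Blinfun P) \<le> 2 * C / \<beta>"
    proof (rule norm_blinfun_bound)
      fix z
      have "norm (X 0 (P z)) + norm (X 0 (z - P z)) \<le> 2 * C / \<beta> * norm (X 0 (P z + (z - P z)))"
        using Neg_back[OF N] Pos_forth[OF Po] T by (intro transversal) auto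
      then show "norm (Blinfun P z) \<le> 2 * C / \<beta> * norm z"
        using bounded_linear_Blinfun_apply[OF bl] by (simp add: X(2)) (smt (verit) norm_ge_zero)
    qed (use pos \<beta> in auto)
    moreover have "Blinfun P o\<^sub>L Blinfun P = Blinfun P"
      by (rule blinfun_eqI) (simp add: bounded_linear_Blinfun_apply[OF bl] P(2))
    ultimately show ?thesis using N Po
      by (intro exI[of _ "Blinfun P"]) (simp add: bounded_linear_Blinfun_apply[OF bl])
  qed
  have "\<forall>n. \<exists>P :: 'e \<Rightarrow>\<^sub>L 'e. P o\<^sub>L P = P \<and> norm P \<le> 2 * C / \<beta> \<and>
      (\<forall>z. Neg (P z) (real n)) \<and> (\<forall>z. Pos (z - P z) (- real n))"
    using ex by simp
  from choice[OF this] obtain PT :: "nat \<Rightarrow> 'e \<Rightarrow>\<^sub>L 'e" where PT: "\<And>n. PT n o\<^sub>L PT n = PT n"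
    "\<And>n. norm (PT n) \<le> 2 * C / \<beta>" "\<And>n z. Neg (PT n z) (real n)" "\<And>n z. Pos (z - PT n z) (- real n)"
    by blast
  have "bounded (range PT)" using PT(2) by (auto simp: bounded_iff)
  then obtain P \<rho> where P: "strict_mono \<rho>" "(PT \<circ> \<rho>) \<longlonglongrightarrow> P"
    using bounded_imp_convergent_subsequence[of PT] by blast
  have Pz: "(\<lambda>n. PT (\<rho> n) z) \<longlonglongrightarrow> P z" for z
    using blinfun.tendsto[OF P(2) tendsto_const[of z]] by (simp add: o_def)
  have lim: "(\<lambda>n. q (a n) t) \<longlonglongrightarrow> q a0 t" "(\<lambda>n. (norm (X t (a n)))\<^sup>2) \<longlonglongrightarrow> (norm (X t a0))\<^sup>2"
    if "a \<longlonglongrightarrow> a0" for a a0 t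
    unfolding q_def by (intro bounded_bilinear.tendsto[OF B(1)] tendsto_intros that)+
  have ev: "\<forall>\<^sub>F n in sequentially. t \<le> real (\<rho> n)" for t
    using filterlim_compose[OF filterlim_real_sequentially filterlim_subseq[OF P(1)]]
    by (auto simp: filterlim_at_top)
  have PN: "Neg (P z) t" for z t
    unfolding Neg_def
  proof (rule tendsto_le[OF trivial_limit_sequentially _ lim(1)[OF Pz]])
    show "(\<lambda>n. - \<beta> * (norm (X t (PT (\<rho> n) z)))\<^sup>2) \<longlonglongrightarrow> - \<beta> * (norm (X t (P z)))\<^sup>2"
      by (intro tendsto_intros lim Pz)
    show "\<forall>\<^sub>F n in sequentially. q (PT (\<rho> n) z) t \<le> - \<beta> * (norm (X t (PT (\<rho> n) z)))\<^sup>2"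
      using ev[of t] by eventually_elim (use Neg_back[OF PT(3)] in \<open>simp add: Neg_def\<close>)
  qed
  have PP: "Pos (z - P z) t" for z t
    unfolding Pos_def
  proof (rule tendsto_le[OF trivial_limit_sequentially lim(1)])
    show "(\<lambda>n. z - PT (\<rho> n) z) \<longlonglongrightarrow> z - P z" by (intro tendsto_intros Pz)
    show "(\<lambda>n. \<beta> * (norm (X t (z - PT (\<rho> n) z)))\<^sup>2) \<longlonglongrightarrow> \<beta> * (norm (X t (z - P z)))\<^sup>2"
      by (intro tendsto_intros lim Pz)
    show "\<forall>\<^sub>F n in sequentially. \<beta> * (norm (X t (z - PT (\<rho> n) z)))\<^sup>2 \<le> q (z - PT (\<rho> n) z) t"
      using ev[of "-t"] by eventually_elim (use Pos_forth[OF PT(4)] in \<open>simp add: Pos_def\<close>)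
  qed
  have "P o\<^sub>L P = P"
  proof (rule LIMSEQ_unique)
    show "(\<lambda>n. (PT (\<rho> n) o\<^sub>L PT (\<rho> n))) \<longlonglongrightarrow> (P o\<^sub>L P)"
      using P(2) by (intro tendsto_intros) (simp_all add: o_def)
    show "(\<lambda>n. (PT (\<rho> n) o\<^sub>L PT (\<rho> n))) \<longlonglongrightarrow> P" using P(2) by (simp add: PT(1) o_def)
  qed
  define \<gamma> where "\<gamma> = c / C"
  have \<gamma>: "\<gamma> > 0" using pos by (simp add: \<gamma>_def)
  have \<gamma>q: "\<gamma> * \<bar>q v t\<bar> \<le> c * (norm (X t v))\<^sup>2" for v t
  proof -
    have "\<gamma> * \<bar>q v t\<bar> \<le> \<gamma> * (C * (norm (X t v))\<^sup>2)" by (intro mult_left_mono qC) (use \<gamma> in auto)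
    then show ?thesis using pos by (simp add: \<gamma>_def)
  qed
  define N where "N = sqrt (C / \<beta>)"
  \<comment> \<open>Common to both directions of time: the exponent is half the rate of \<open>Q\<close>, which is quadratic.\<close>
  have decay: "norm (X t v) \<le> N * exp (- (\<gamma> / 2) * r) * norm (X s v)"
    if "\<beta> * (norm (X t v))\<^sup>2 \<le> exp (- \<gamma> * r) * \<bar>q v s\<bar>" for t s v r
  proof (rule power2_le_imp_le)
    have "\<beta> * (norm (X t v))\<^sup>2 \<le> exp (- \<gamma> * r) * (C * (norm (X s v))\<^sup>2)"
      by (rule order_trans[OF that]) (intro mult_left_mono qC, simp)
    then have "(norm (X t v))\<^sup>2 \<le> C / \<beta> * exp (- \<gamma> * r) * (norm (X s v))\<^sup>2"
      using \<beta>(1) by (simp add: field_simps)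
    also have "\<dots> = (N * exp (- (\<gamma> / 2) * r) * norm (X s v))\<^sup>2"
      using pos \<beta> by (simp add: N_def power_mult_distrib flip: exp_of_nat_mult)
    finally show "(norm (X t v))\<^sup>2 \<le> \<dots>" .
  qed (use pos \<beta> in \<open>auto simp: N_def\<close>)
  have stable: "norm (X t v) \<le> N * exp (- (\<gamma> / 2) * (t - s)) * norm (X s v)"
    if "\<And>t. Neg v t" "s \<le> t" for v s t
  proof (rule decay)
    have nq: "q v t \<le> 0" for t using that(1)[of t] \<beta>(1) unfolding Neg_def
      by (smt (verit) mult_nonneg_nonneg zero_le_power2 mult_minus_left)
    have "- q v t \<le> exp (- \<gamma> * (t - s)) * - q v s"
    proof (rule exp_comparison[OF _ _ that(2)])
      show "((\<lambda>t. - q v t) has_real_derivative - q' v t) (at t)" for t by (intro derivative_intros q')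
      show "- q' v t \<le> - \<gamma> * - q v t" for t
        using q'(1)[where v=v and t=t] \<gamma>q[of v t] nq[of t] by simp
    qed
    then show "\<beta> * (norm (X t v))\<^sup>2 \<le> exp (- \<gamma> * (t - s)) * \<bar>q v s\<bar>"
      using that(1)[of t] nq[of s] unfolding Neg_def by simp
  qed
  have unstable: "norm (X t v) \<le> N * exp (- (\<gamma> / 2) * (s - t)) * norm (X s v)"
    if "\<And>t. Pos v t" "t \<le> s" for v s t
  proof (rule decay)
    have nq: "q v t \<ge> 0" for t using that(1)[of t] \<beta>(1) unfolding Pos_def
      by (smt (verit) mult_nonneg_nonneg zero_le_power2)
    have "q v (- (- t)) \<le> exp (- \<gamma> * (- t - (- s))) * q v (- (- s))"
    proof (rule exp_comparison)
      show "((\<lambda>t. q v (- t)) has_real_derivative - q' v (- t)) (at t)" for t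
        using DERIV_chain2[OF q'(2) DERIV_minus[OF DERIV_ident], of v t] by simp
      show "- q' v (- t) \<le> - \<gamma> * q v (- t)" for t
        using q'(1)[where v=v and t="-t"] \<gamma>q[of v "-t"] nq[of "-t"] by simp
    qed (use that in simp)
    then show "\<beta> * (norm (X t v))\<^sup>2 \<le> exp (- \<gamma> * (s - t)) * \<bar>q v s\<bar>"
      using that(1)[of t] nq[of s] unfolding Pos_def by (simp add: algebra_simps)
  qed
  have XYa: "X t (Y t z) = z" for t z
    by (metis XY(1) blinfun_apply_blinfun_compose blinfun_apply_id_blinfun id_apply)
  have N0: "N > 0" using pos \<beta> by (simp add: N_def)
  define N' where "N' = N * (2 * C / \<beta>)"
  have N': "N' > 0" using N0 pos \<beta> by (simp add: N'_def)
  have comp: "norm (X s (P (Y s y))) \<le> 2 * C / \<beta> * norm y" "norm (X s (Y s y - P (Y s y))) \<le> 2 * C / \<beta> * norm y" for s y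
    using transversal[OF PN[of "Y s y" s] PP[of "Y s y" s]]
    by (simp_all add: XYa) (smt (verit) norm_ge_zero)+
  have bound: "n1 \<le> N' * e * m" if "n1 \<le> N * e * n2" "n2 \<le> 2 * C / \<beta> * m" "e > 0" for n1 n2 e m :: real
  proof -
    have "N * e * n2 \<le> N * e * (2 * C / \<beta> * m)" by (intro mult_left_mono that) (use N0 that in auto)
    then show ?thesis using that(1) by (simp add: N'_def algebra_simps)
  qed
  have "norm (X t o\<^sub>L P o\<^sub>L Y s) \<le> N' * exp (- (\<gamma> / 2) * (t - s))" if "s \<le> t" for s t
    by (rule norm_blinfun_bound) (use N' bound[OF stable[OF PN that] comp(1)] in auto)
  moreover have "norm (X t o\<^sub>L (id_blinfun - P) o\<^sub>L Y s) \<le> N' * exp (- (\<gamma> / 2) * (s - t))" if "t \<le> s" for s t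
    by (rule norm_blinfun_bound)
       (use N' bound[OF unstable[OF PP that] comp(2)] in \<open>auto simp: blinfun.bilinear_simps\<close>)
  ultimately show ?thesis
    unfolding exponential_dichotomy_def
    using X XY \<open>P o\<^sub>L P = P\<close> N' \<gamma>
    by (intro exI[of _ X] exI[of _ Y] exI[of _ P] exI[of _ N'] exI[of _ "\<gamma> / 2"]) auto
qed

text \<open>The form \<open>Q = \<langle>a, b\<rangle> + s \<bar>a\<bar>\<^sup>2\<close> has the derivative
  \<open>\<bar>b + s a\<bar>\<^sup>2 + (s' - s\<^sup>2) \<bar>a\<bar>\<^sup>2 + \<langle>a, M a\<rangle>\<close> along solutions of \<open>a' = b\<close>, \<open>b' = M a\<close>. By the
  hypothesis this controls \<open>\<bar>a\<bar>\<^sup>2\<close> and \<open>\<bar>b + s a\<bar>\<^sup>2\<close>, hence also \<open>\<bar>b\<bar>\<^sup>2\<close>, as \<open>s\<close> is bounded.\<close>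

lemma second_order_dichotomy:
  fixes M :: "real \<Rightarrow> 'e::euclidean_space \<Rightarrow>\<^sub>L 'e"
  assumes M: "continuous_on UNIV M" "\<And>t. norm (M t) \<le> K"
    and s: "\<And>t. (s has_real_derivative s' t) (at t)" "\<And>t. \<bar>s t\<bar> \<le> S"
    and \<delta>: "\<delta> > 0" "\<And>t y. \<delta> * (norm y)\<^sup>2 \<le> (s' t - (s t)\<^sup>2) * (norm y)\<^sup>2 + y \<bullet> M t y"
  shows "exponential_dichotomy (\<lambda>t. Blinfun (\<lambda>(a, b). (b, M t a)))"
proof -
  define J :: "('e \<Rightarrow>\<^sub>L 'e) \<Rightarrow> ('e \<times> 'e) \<Rightarrow>\<^sub>L ('e \<times> 'e)"
    where "J A = Blinfun (\<lambda>z. (snd z, A (fst z)))" for A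
  have Jbl: "bounded_linear (\<lambda>z::'e\<times>'e. (snd z, A (fst z)))" for A :: "'e \<Rightarrow>\<^sub>L 'e"
    by (intro bounded_linear_intros)
  have J: "J A z = (snd z, A (fst z))" for A z
    unfolding J_def using bounded_linear_Blinfun_apply[OF Jbl] by metis
  define L where "L t = J (M t)" for t
  have L_eq: "(\<lambda>t. Blinfun (\<lambda>(a, b). (b, M t a))) = L"
    unfolding L_def J_def by (simp add: case_prod_unfold)
  have fst_le: "norm (fst z) \<le> norm z" and snd_le: "norm (snd z) \<le> norm z" for z :: "'e \<times> 'e"
    by (metis norm_fst_le norm_snd_le prod.collapse)+
  have S: "S \<ge> 0" using s(2)[of 0] by linarith
  have Jnorm: "norm (J A - J B) \<le> norm (A - B)" for A B
  proof (rule norm_blinfun_bound)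
    fix z
    have "(J A - J B) z = (0, (A - B) (fst z))" by (simp add: blinfun.bilinear_simps J)
    then have "norm ((J A - J B) z) = norm ((A - B) (fst z))" by (simp add: norm_Pair)
    also have "\<dots> \<le> norm (A - B) * norm z"
      by (rule order_trans[OF norm_blinfun mult_left_mono[OF fst_le]]) auto
    finally show "norm ((J A - J B) z) \<le> norm (A - B) * norm z" .
  qed simp
  have Lc: "continuous_on UNIV L"
    unfolding continuous_on_iff
  proof safe
    fix t e :: real assume "e > 0"
    then obtain d where "d > 0" "\<And>r. dist r t < d \<Longrightarrow> dist (M r) (M t) < e"
      using M(1) unfolding continuous_on_iff by blast
    then show "\<exists>d>0. \<forall>r\<in>UNIV. dist r t < d \<longrightarrow> dist (L r) (L t) < e"
      using Jnorm unfolding L_def dist_norm by (metis order_le_less_trans)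
  qed
  have Lb: "norm (L t) \<le> K + norm (J 0)" for t
    using norm_triangle_sub[of "J (M t)" "J 0"] Jnorm[of "M t" 0] M(2)[of t] unfolding L_def by simp
  obtain X Y where X: "X 0 = id_blinfun" "\<And>t. (X has_vector_derivative (L t o\<^sub>L X t)) (at t)"
    and XY: "\<And>t. X t o\<^sub>L Y t = id_blinfun" "\<And>t. Y t o\<^sub>L X t = id_blinfun"
    using fundamental_solution_exists[OF Lc Lb] by blast
  have XYa: "X t (Y t z) = z" for t z
    by (metis XY(1) blinfun_apply_blinfun_compose blinfun_apply_id_blinfun id_apply)
  have YXa: "Y t (X t z) = z" for t z
    by (metis XY(2) blinfun_apply_blinfun_compose blinfun_apply_id_blinfun id_apply)
  define B where "B t u v = (fst u \<bullet> snd v + snd u \<bullet> fst v) / 2 + s t * (fst u \<bullet> fst v)"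
    for t and u v :: "'e \<times> 'e"
  have BQ: "B t z z = fst z \<bullet> snd z + s t * (norm (fst z))\<^sup>2" for t z
    by (simp add: B_def power2_norm_eq_inner inner_commute)
  have Bb: "\<bar>B t u v\<bar> \<le> (1 + S) * norm u * norm v" for t u v
  proof -
    have arith: "\<bar>(p + q) / 2 + r\<bar> \<le> n + m" if "\<bar>r\<bar> \<le> m" "\<bar>p\<bar> \<le> n" "\<bar>q\<bar> \<le> n" for p q r n m :: real
      using that by (auto simp: abs_if field_simps split: if_splits)
    have p: "\<bar>x \<bullet> y\<bar> \<le> norm u * norm v" if "norm x \<le> norm u" "norm y \<le> norm v" for x y :: 'e
      by (rule order_trans[OF Cauchy_Schwarz_ineq2 mult_mono]) (use that in auto)
    have "\<bar>s t * (fst u \<bullet> fst v)\<bar> \<le> S * (norm u * norm v)"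
      unfolding abs_mult by (intro mult_mono s p fst_le) (use S in auto)
    moreover have "\<bar>fst u \<bullet> snd v\<bar> \<le> norm u * norm v" "\<bar>snd u \<bullet> fst v\<bar> \<le> norm u * norm v"
      by (intro p fst_le snd_le)+
    ultimately have "\<bar>B t u v\<bar> \<le> norm u * norm v + S * (norm u * norm v)"
      unfolding B_def using arith by blast
    then show ?thesis by (simp add: algebra_simps)
  qed
  have Bbil: "bounded_bilinear (B t)" for t
    by (rule bounded_bilinear.intro)
       (use Bb[of t] in \<open>auto simp: B_def inner_add algebra_simps add_divide_distrib mult.commute intro!: exI[of _ "1 + S"]\<close>)
  define c where "c = min (1/2) (\<delta> / (1 + 2 * S\<^sup>2))"
  have S1: "1 + 2 * S\<^sup>2 > 0" using zero_le_power2[of S] by linarith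
  have c: "c > 0" "2 * c \<le> 1" "c * (1 + 2 * S\<^sup>2) \<le> \<delta>"
  proof -
    have "c * (1 + 2 * S\<^sup>2) \<le> \<delta> / (1 + 2 * S\<^sup>2) * (1 + 2 * S\<^sup>2)"
      by (rule mult_right_mono) (use S1 in \<open>auto simp: c_def\<close>)
    then show "c * (1 + 2 * S\<^sup>2) \<le> \<delta>" using S1 by simp
  qed (use S1 \<delta>(1) in \<open>auto simp: c_def\<close>)
  \<comment> \<open>The derivative is written with \<open>w = b + s a\<close>, which absorbs the mixed term.\<close>
  have mono: "\<exists>d \<ge> c * (norm (X t v))\<^sup>2. ((\<lambda>r. B r (X r v) (X r v)) has_real_derivative d) (at t)" for v t
  proof -
    define a b where "a r = fst (X r v)" and "b r = snd (X r v)" for r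
    have Xv: "((\<lambda>r. X r v) has_vector_derivative L t (X t v)) (at t)"
      using bounded_linear.has_vector_derivative[OF blinfun.bounded_linear_left X(2)[of t], of v] by simp
    have a: "(a has_vector_derivative b t) (at t)"
      using bounded_linear.has_vector_derivative[OF bounded_linear_fst Xv] by (simp add: a_def[abs_def] b_def L_def J)
    have b: "(b has_vector_derivative M t (a t)) (at t)"
      using bounded_linear.has_vector_derivative[OF bounded_linear_snd Xv] by (simp add: b_def[abs_def] a_def L_def J)
    note inner = bounded_bilinear.has_vector_derivative[OF bounded_bilinear_inner,
      folded has_real_derivative_iff_has_vector_derivative]
    define d where "d = a t \<bullet> M t (a t) + b t \<bullet> b t + (s' t * (a t \<bullet> a t) + s t * (a t \<bullet> b t + b t \<bullet> a t))"
    have "((\<lambda>r. a r \<bullet> b r + s r * (a r \<bullet> a r)) has_real_derivative d) (at t)"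
      unfolding d_def
      by (rule DERIV_cong[OF DERIV_add[OF inner[OF a b] DERIV_mult[OF s(1) inner[OF a a]]]]) (simp add: algebra_simps)
    moreover have "(\<lambda>r. B r (X r v) (X r v)) = (\<lambda>r. a r \<bullet> b r + s r * (a r \<bullet> a r))"
      by (simp add: BQ a_def b_def power2_norm_eq_inner fun_eq_iff)
    moreover have "c * (norm (X t v))\<^sup>2 \<le> d"
    proof -
      define w where "w = b t + s t *\<^sub>R a t"
      define A where "A = (norm (a t))\<^sup>2"
      have b_eq: "b t = w - s t *\<^sub>R a t" by (simp add: w_def)
      have "(norm (b t))\<^sup>2 \<le> (norm w + norm (s t *\<^sub>R a t))\<^sup>2"
        unfolding b_eq by (intro power_mono norm_triangle_ineq4) auto
      also have "\<dots> \<le> 2 * (norm w)\<^sup>2 + 2 * (norm (s t *\<^sub>R a t))\<^sup>2"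
        using zero_le_power2[of "norm w - norm (s t *\<^sub>R a t)"] by (simp add: power2_eq_square algebra_simps)
      also have "(norm (s t *\<^sub>R a t))\<^sup>2 \<le> S\<^sup>2 * A"
        unfolding A_def using s(2)[of t] by (auto simp: power_mult_distrib abs_le_square_iff[symmetric] S intro!: mult_right_mono)
      finally have bb: "(norm (b t))\<^sup>2 \<le> 2 * (norm w)\<^sup>2 + 2 * (S\<^sup>2 * A)" by simp
      have "(norm (X t v))\<^sup>2 = A + (norm (b t))\<^sup>2"
        by (cases "X t v") (simp add: a_def b_def A_def norm_Pair)
      then have "(norm (X t v))\<^sup>2 \<le> 2 * (norm w)\<^sup>2 + (1 + 2 * S\<^sup>2) * A" using bb by (simp add: algebra_simps)
      then have "c * (norm (X t v))\<^sup>2 \<le> c * (2 * (norm w)\<^sup>2 + (1 + 2 * S\<^sup>2) * A)"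
        using c(1) by (intro mult_left_mono) auto
      also have "\<dots> = (2 * c) * (norm w)\<^sup>2 + (c * (1 + 2 * S\<^sup>2)) * A" by (simp add: algebra_simps)
      also have "\<dots> \<le> 1 * (norm w)\<^sup>2 + \<delta> * A"
        by (intro add_mono mult_right_mono c) (auto simp: A_def)
      also have "\<dots> \<le> (norm w)\<^sup>2 + ((s' t - (s t)\<^sup>2) * A + a t \<bullet> M t (a t))"
        using \<delta>(2)[of "a t" t] by (simp add: A_def)
      also have "\<dots> = d"
        unfolding d_def w_def A_def power2_norm_eq_inner
        by (simp add: inner_add inner_commute power2_eq_square algebra_simps)
      finally show ?thesis .
    qed
    ultimately show ?thesis by auto
  qed
  define \<kappa> where "\<kappa> = 1 / (1 + (1 + S)\<^sup>2)"
  have \<kappa>1: "1 + (1 + S)\<^sup>2 > 0" using zero_le_power2[of "1 + S"] by linarith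
  have \<kappa>: "\<kappa> > 0" using \<kappa>1 by (simp add: \<kappa>_def)
  \<comment> \<open>In the coordinates \<open>(a, b + s a)\<close> the form is the inner product of the two components, so
    that it is negative on the antidiagonal and positive on the diagonal.\<close>
  define j where "j \<sigma> t a = (a, \<sigma> *\<^sub>R a - s t *\<^sub>R a)" for \<sigma> t and a :: 'e
  have jlin: "linear (j \<sigma> t)" for \<sigma> t
    by (rule linearI) (simp_all add: j_def algebra_simps)
  have jQ: "B t (j \<sigma> t a) (j \<sigma> t a) = \<sigma> * (norm a)\<^sup>2" for \<sigma> t a
    unfolding BQ by (simp add: j_def inner_diff power2_norm_eq_inner algebra_simps)
  have jn: "\<kappa> * (norm (j \<sigma> t a))\<^sup>2 \<le> (norm a)\<^sup>2" if "\<bar>\<sigma>\<bar> = 1" for \<sigma> t a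
  proof -
    have "\<bar>\<sigma> - s t\<bar> \<le> 1 + S" using s(2)[of t] that by linarith
    then have "(\<sigma> - s t)\<^sup>2 \<le> (1 + S)\<^sup>2" using S by (simp add: abs_le_square_iff[symmetric])
    then have "(norm (j \<sigma> t a))\<^sup>2 \<le> (1 + (1 + S)\<^sup>2) * (norm a)\<^sup>2"
      by (auto simp: j_def norm_Pair power_mult_distrib distrib_right simp flip: scaleR_left_diff_distrib intro!: mult_right_mono)
    then show ?thesis using \<kappa>1 by (simp add: \<kappa>_def field_simps)
  qed
  have split: "\<exists>P. linear P \<and> (\<forall>z. P (P z) = P z) \<and>
      (\<forall>z. B T (X T (P z)) (X T (P z)) \<le> - \<kappa> * (norm (X T (P z)))\<^sup>2) \<and>
      (\<forall>z. \<kappa> * (norm (X (-T) (z - P z)))\<^sup>2 \<le> B (-T) (X (-T) (z - P z)) (X (-T) (z - P z)))"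
    if T: "T \<ge> 0" for T
  proof -
    \<comment> \<open>The boundary value problem: negative at time \<open>T\<close>, positive at \<open>- T\<close>. Monotonicity makes it uniquely solvable.\<close>
    define \<Psi> where "\<Psi> w = Y T (j (-1) T (fst w)) + Y (-T) (j 1 (-T) (snd w))" for w :: "'e \<times> 'e"
    have \<Psi>lin: "linear \<Psi>"
      unfolding \<Psi>_def by (rule linearI)
        (simp_all add: linear_add[OF jlin] linear_scale[OF jlin] blinfun.bilinear_simps scaleR_add_right)
    have "inj \<Psi>"
      unfolding linear_injective_0[OF \<Psi>lin]
    proof safe
      fix a b assume "\<Psi> (a, b) = 0"
      define v where "v = Y T (j (-1) T a)"
      have v: "v = - Y (-T) (j 1 (-T) b)" using \<open>\<Psi> (a, b) = 0\<close> by (simp add: \<Psi>_def v_def eq_neg_iff_add_eq_0)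
      have "B (-T) (X (-T) v) (X (-T) v) \<le> B T (X T v) (X T v)"
      proof (rule DERIV_nonneg_imp_nondecreasing[of "-T" T])
        fix t
        obtain d where "d \<ge> c * (norm (X t v))\<^sup>2" "((\<lambda>r. B r (X r v) (X r v)) has_real_derivative d) (at t)"
          using mono by blast
        moreover have "c * (norm (X t v))\<^sup>2 \<ge> 0" using c(1) by simp
        ultimately show "\<exists>d. ((\<lambda>r. B r (X r v) (X r v)) has_real_derivative d) (at t) \<and> 0 \<le> d" by force
      qed (use T in auto)
      moreover have "X T v = j (-1) T a" by (simp add: v_def XYa)
      moreover have "X (-T) v = - j 1 (-T) b" by (simp add: v XYa blinfun.bilinear_simps)
      moreover have "B t (- z) (- z) = B t z z" for t z by (simp add: B_def)
      ultimately have "(norm b)\<^sup>2 \<le> - (norm a)\<^sup>2" by (simp add: jQ)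
      then have "(norm a)\<^sup>2 = 0" "(norm b)\<^sup>2 = 0" using zero_le_power2[of "norm a"] zero_le_power2[of "norm b"] by linarith+
      then show "(a, b) = 0" by (simp add: zero_prod_def)
    qed
    obtain \<Phi> where \<Phi>: "linear \<Phi>" "\<And>w. \<Phi> (\<Psi> w) = w" "\<And>z. \<Psi> (\<Phi> z) = z"
      using linear_injective_isomorphism[OF \<Psi>lin \<open>inj \<Psi>\<close>] by blast
    define P where "P z = Y T (j (-1) T (fst (\<Phi> z)))" for z
    have "linear P"
      unfolding P_def by (rule linearI)
        (simp_all add: linear_add[OF jlin] linear_scale[OF jlin] linear_add[OF \<Phi>(1)] linear_scale[OF \<Phi>(1)] blinfun.bilinear_simps)
    moreover have "P (P z) = P z" for z
    proof -
      have "P z = \<Psi> (fst (\<Phi> z), 0)" by (simp add: P_def \<Psi>_def linear_0[OF jlin] blinfun.bilinear_simps)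
      then show ?thesis by (simp add: P_def \<Phi>)
    qed
    moreover have "z - P z = Y (-T) (j 1 (-T) (snd (\<Phi> z)))" for z
      using \<Phi>(3)[of z] by (simp add: P_def \<Psi>_def algebra_simps)
    ultimately show ?thesis
      using jn[of "-1" T] jn[of 1 "-T"] by (intro exI[of _ P]) (auto simp: P_def XYa jQ)
  qed
  show ?thesis
    unfolding L_eq
    by (rule exponential_dichotomy_of_monotone_form[OF X(2,1) XY Lb Bbil _ Bb mono c(1) \<kappa> _ split])
       (use S in \<open>auto simp: B_def inner_commute\<close>)
qed

section \<open>Smooth functions and their derivatives\<close>

abbreviation dd :: "('e::real_normed_vector \<Rightarrow> 'f::real_normed_vector) \<Rightarrow> 'e \<Rightarrow> 'e \<Rightarrow> 'f" where
  "dd F y v \<equiv> frechet_derivative F (at y) v"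

lemma has_derivative_dd: "F differentiable at y \<Longrightarrow> (F has_derivative dd F y) (at y)"
  by (simp add: frechet_derivative_works)

lemma dd_eqI: "(F has_derivative F') (at y) \<Longrightarrow> dd F y v = F' v"
  by (metis frechet_derivative_at)

lemma Ck_on_cong:
  assumes "open S" "\<And>y. y \<in> S \<Longrightarrow> F y = G y"
  shows "Ck_on k S F \<longleftrightarrow> Ck_on k S G"
proof -
  have "Ck_on k S G" if "Ck_on k S F" "\<And>y. y \<in> S \<Longrightarrow> F y = G y" for F G
    using that
  proof (induction k arbitrary: F G)
    case 0
    then show ?case by (simp cong: continuous_on_cong)
  next
    case (Suc k)
    have F: "F differentiable at y" if "y \<in> S" for y
      using Suc.prems(1) that assms(1) by (simp add: differentiable_on_eq_differentiable_at)
    have "(G has_derivative dd F y) (at y)" if "y \<in> S" for y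
      using has_derivative_transform_within_open[OF has_derivative_dd[OF F[OF that]] assms(1) that] Suc.prems(2) by blast
    then have "G differentiable_on S" and "dd F y = dd G y" if "y \<in> S" for y
      using that assms(1) by (auto simp: differentiable_on_eq_differentiable_at differentiable_def intro: frechet_derivative_at)
    moreover have "Ck_on k S (\<lambda>y. dd G y b)" if "b \<in> Basis" for b
      using Suc.IH[of "\<lambda>y. dd F y b" "\<lambda>y. dd G y b"] Suc.prems(1) that calculation(2) by simp
    ultimately show ?case
      using Suc.prems Ck_on.simps(2) by (metis differentiable_on_empty ex_in_conv)
  qed
  then show ?thesis using assms(2) by metis
qed

text \<open>Closure properties of \<open>Ck_on\<close> are proved by induction. For them it matters that the derivative may be
  given by any expression, and not only as \<open>frechet_derivative\<close>.\<close>

lemma Ck_on_SucI: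
  fixes F :: "'e::euclidean_space \<Rightarrow> 'f::real_normed_vector"
  assumes "open S" "\<And>y. y \<in> S \<Longrightarrow> (F has_derivative F' y) (at y)"
    "\<And>b. b \<in> Basis \<Longrightarrow> Ck_on k S (\<lambda>y. F' y b)"
  shows "Ck_on (Suc k) S F"
proof -
  have "Ck_on k S (\<lambda>y. dd F y b)" if "b \<in> Basis" for b
    using assms(3)[OF that] Ck_on_cong[OF assms(1), of "\<lambda>y. dd F y b" "\<lambda>y. F' y b"] dd_eqI[OF assms(2)] by blast
  then show ?thesis
    using assms(1,2) by (auto simp: differentiable_on_eq_differentiable_at differentiable_def)
qed

lemma Ck_on_SucD:
  assumes "open S" "Ck_on (Suc k) S F"
  shows "y \<in> S \<Longrightarrow> (F has_derivative dd F y) (at y)" "b \<in> Basis \<Longrightarrow> Ck_on k S (\<lambda>y. dd F y b)"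
  using assms by (auto simp: differentiable_on_eq_differentiable_at has_derivative_dd)

lemma Ck_on_Suc_imp: "open S \<Longrightarrow> Ck_on (Suc k) S F \<Longrightarrow> Ck_on k S F"
proof (induction k arbitrary: F)
  case 0
  then show ?case by (auto intro: differentiable_imp_continuous_on)
next
  case (Suc k)
  then show ?case by (metis Ck_on.simps(2))
qed

lemma Ck_on_const: "open S \<Longrightarrow> Ck_on k S (\<lambda>y. c)"
  by (induction k arbitrary: c) (auto intro!: Ck_on_SucI[where F' = "\<lambda>y v. 0"])

lemma Ck_on_bounded_linear:
  "open S \<Longrightarrow> bounded_linear T \<Longrightarrow> Ck_on k S F \<Longrightarrow> Ck_on k S (\<lambda>y. T (F y))"
proof (induction k arbitrary: F)
  case 0
  then show ?case by (auto intro: bounded_linear.continuous_on)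
next
  case (Suc k)
  note D = Ck_on_SucD[OF Suc.prems(1,3)]
  show ?case
    by (rule Ck_on_SucI[where F' = "\<lambda>y v. T (dd F y v)", OF Suc.prems(1)
        bounded_linear.has_derivative[OF Suc.prems(2) D(1)] Suc.IH[OF Suc.prems(1,2) D(2)]])
qed

lemma Ck_on_add:
  "open S \<Longrightarrow> Ck_on k S F \<Longrightarrow> Ck_on k S G \<Longrightarrow> Ck_on k S (\<lambda>y. F y + G y)"
proof (induction k arbitrary: F G)
  case (Suc k)
  note D = Ck_on_SucD[OF Suc.prems(1,2)] Ck_on_SucD[OF Suc.prems(1,3)]
  show ?case
    by (rule Ck_on_SucI[where F' = "\<lambda>y v. dd F y v + dd G y v", OF Suc.prems(1)
        has_derivative_add[OF D(1,3)] Suc.IH[OF Suc.prems(1) D(2,4)]])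
qed (auto intro: continuous_on_add)

lemma Ck_on_sum:
  assumes "open S" "\<And>i. i \<in> I \<Longrightarrow> Ck_on k S (F i)"
  shows "Ck_on k S (\<lambda>y. \<Sum>i\<in>I. F i y)"
  using assms(2)
  by (induction I rule: infinite_finite_induct) (auto intro!: Ck_on_add Ck_on_const assms(1))

text \<open>One product rule for multiplication, scaling and inner products. The functions are generalised in
  the induction, because the derivative mixes \<open>F\<close> with \<open>G'\<close>.\<close>

lemma Ck_on_bilinear:
  assumes "bounded_bilinear \<beta>" "open S"
  shows "Ck_on k S F \<Longrightarrow> Ck_on k S G \<Longrightarrow> Ck_on k S (\<lambda>y. \<beta> (F y) (G y))"
proof (induction k arbitrary: F G)
  case 0
  then show ?case by (auto intro: bounded_bilinear.continuous_on[OF assms(1)])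
next
  case (Suc k)
  note D = Ck_on_SucD[OF assms(2) Suc.prems(1)] Ck_on_SucD[OF assms(2) Suc.prems(2)]
  show ?case
    by (rule Ck_on_SucI[where F' = "\<lambda>y v. \<beta> (F y) (dd G y v) + \<beta> (dd F y v) (G y)", OF assms(2)
        bounded_bilinear.FDERIV[OF assms(1) D(1,3)] Ck_on_add[OF assms(2)
          Suc.IH[OF Ck_on_Suc_imp[OF assms(2) Suc.prems(1)] D(4)] Suc.IH[OF D(2) Ck_on_Suc_imp[OF assms(2) Suc.prems(2)]]]])
qed

lemma Ck_on_inverse:
  fixes F :: "'e::euclidean_space \<Rightarrow> real"
  assumes "open S" "\<And>y. y \<in> S \<Longrightarrow> F y \<noteq> 0"
  shows "Ck_on k S F \<Longrightarrow> Ck_on k S (\<lambda>y. inverse (F y))"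
proof (induction k)
  case 0
  then show ?case using assms by (auto intro!: continuous_intros)
next
  case (Suc k)
  note bil = Ck_on_bilinear[OF bounded_bilinear_mult assms(1)]
  have I: "Ck_on k S (\<lambda>y. inverse (F y))" using Suc assms Ck_on_Suc_imp by blast
  note D = Ck_on_SucD[OF assms(1) Suc.prems]
  show ?case
    by (rule Ck_on_SucI[where F' = "\<lambda>y v. - (inverse (F y) * dd F y v * inverse (F y))", OF assms(1)
        Deriv.has_derivative_inverse[OF assms(2) D(1)]
        Ck_on_bounded_linear[OF assms(1) bounded_linear_minus[OF bounded_linear_ident] bil[OF bil[OF I D(2)] I]]])
qed

lemma smooth_on_has_derivative:
  "smooth_on S F \<Longrightarrow> open S \<Longrightarrow> y \<in> S \<Longrightarrow> (F has_derivative dd F y) (at y)"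
  unfolding smooth_on_def using Ck_on_SucD(1) by blast

lemma smooth_on_continuous: "smooth_on S F \<Longrightarrow> continuous_on S F"
  unfolding smooth_on_def by (metis Ck_on.simps(1))

lemma smooth_on_const: "open S \<Longrightarrow> smooth_on S (\<lambda>y. c)"
  by (simp add: smooth_on_def Ck_on_const)

lemma smooth_on_bounded_linear:
  "smooth_on S F \<Longrightarrow> bounded_linear T \<Longrightarrow> open S \<Longrightarrow> smooth_on S (\<lambda>y. T (F y))"
  by (simp add: smooth_on_def Ck_on_bounded_linear)

lemma smooth_on_add:
  "smooth_on S F \<Longrightarrow> smooth_on S G \<Longrightarrow> open S \<Longrightarrow> smooth_on S (\<lambda>y. F y + G y)"
  by (simp add: smooth_on_def Ck_on_add)

lemma smooth_on_sum:
  "(\<And>i. i \<in> I \<Longrightarrow> smooth_on S (F i)) \<Longrightarrow> open S \<Longrightarrow> smooth_on S (\<lambda>y. \<Sum>i\<in>I. F i y)"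
  by (simp add: smooth_on_def Ck_on_sum)

lemma smooth_on_bilinear:
  "bounded_bilinear \<beta> \<Longrightarrow> smooth_on S F \<Longrightarrow> smooth_on S G \<Longrightarrow> open S \<Longrightarrow> smooth_on S (\<lambda>y. \<beta> (F y) (G y))"
  by (simp add: smooth_on_def Ck_on_bilinear)

lemmas smooth_on_mult = smooth_on_bilinear[OF bounded_bilinear_mult]

lemma smooth_on_diff:
  "smooth_on S F \<Longrightarrow> smooth_on S G \<Longrightarrow> open S \<Longrightarrow> smooth_on S (\<lambda>y. F y - G y)"
  using smooth_on_add[OF _ smooth_on_bounded_linear[OF _ bounded_linear_minus[OF bounded_linear_ident]], of S F G] by simp

lemma smooth_on_prod:
  fixes F :: "'i \<Rightarrow> 'e::euclidean_space \<Rightarrow> real"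
  assumes "\<And>i. i \<in> I \<Longrightarrow> smooth_on S (F i)" "open S"
  shows "smooth_on S (\<lambda>y. \<Prod>i\<in>I. F i y)"
  using assms(1)
  by (induction I rule: infinite_finite_induct) (auto intro!: smooth_on_mult smooth_on_const assms(2))

lemma smooth_on_inverse:
  fixes F :: "'e::euclidean_space \<Rightarrow> real"
  shows "smooth_on S F \<Longrightarrow> (\<And>y. y \<in> S \<Longrightarrow> F y \<noteq> 0) \<Longrightarrow> open S \<Longrightarrow> smooth_on S (\<lambda>y. inverse (F y))"
  by (simp add: smooth_on_def Ck_on_inverse)

lemma smooth_on_eq:
  assumes "smooth_on S G" "open S" "\<And>y. y \<in> S \<Longrightarrow> F y = G y"
  shows "smooth_on S F"
  using assms(1) Ck_on_cong[OF assms(2,3)] by (simp add: smooth_on_def)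

lemma dd_basis_sum:
  fixes F :: "'e::euclidean_space \<Rightarrow> 'f::real_normed_vector"
  assumes "(F has_derivative dd F y) (at y)"
  shows "dd F y v = (\<Sum>b\<in>Basis. (v \<bullet> b) *\<^sub>R dd F y b)"
proof -
  have lin: "linear (dd F y)" using assms by (rule has_derivative_linear)
  have "dd F y v = dd F y (\<Sum>b\<in>Basis. (v \<bullet> b) *\<^sub>R b)" by (simp add: euclidean_representation)
  then show ?thesis by (simp add: linear_sum[OF lin] linear_scale[OF lin])
qed

lemma smooth_on_dd:
  fixes F :: "'e::euclidean_space \<Rightarrow> 'f::real_normed_vector"
  assumes "smooth_on S F" "open S"
  shows "smooth_on S (\<lambda>y. dd F y v)"
proof -
  have "smooth_on S (\<lambda>y. \<Sum>b\<in>Basis. (v \<bullet> b) *\<^sub>R dd F y b)"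
  proof (intro smooth_on_sum smooth_on_bounded_linear[OF _ bounded_linear_scaleR_right] assms(2))
    show "smooth_on S (\<lambda>y. dd F y b)" if "b \<in> Basis" for b
      using assms that Ck_on_SucD(2) unfolding smooth_on_def by blast
  qed
  then show ?thesis
    by (rule smooth_on_eq[OF _ assms(2) dd_basis_sum[OF smooth_on_has_derivative[OF assms]]])
qed

text \<open>The derivative is jointly continuous in the point and the direction, as it is a combination of finitely many
  directional derivatives with the coordinates of the direction as coefficients.\<close>

lemma continuous_on_dd:
  fixes F :: "'e::euclidean_space \<Rightarrow> 'f::real_normed_vector"
  assumes "smooth_on S F" "open S" "continuous_on T p" "continuous_on T q" "\<And>t. t \<in> T \<Longrightarrow> p t \<in> S"
  shows "continuous_on T (\<lambda>t. dd F (p t) (q t))"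
proof -
  have "continuous_on T (\<lambda>t. \<Sum>b\<in>Basis. (q t \<bullet> b) *\<^sub>R dd F (p t) b)"
  proof (intro continuous_intros assms(4))
    show "continuous_on T (\<lambda>t. dd F (p t) b)" for b
      by (rule continuous_on_compose2[OF smooth_on_continuous[OF smooth_on_dd[OF assms(1,2)]] assms(3)])
         (use assms(5) in auto)
  qed
  then show ?thesis
    by (rule continuous_on_eq) (use dd_basis_sum[OF smooth_on_has_derivative[OF assms(1,2)]] assms(5) in auto)
qed

text \<open>The mean value theorem, applied once in each direction, turns a second difference into a mixed second
  derivative at an intermediate point.\<close>

lemma second_difference_mean_value:
  fixes F :: "'e::euclidean_space \<Rightarrow> real"
  assumes F: "\<And>z. z \<in> cball y (h * (norm u + norm v)) \<Longrightarrow> (F has_derivative dd F z) (at z)"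
    and G: "\<And>z. z \<in> cball y (h * (norm u + norm v)) \<Longrightarrow>
      ((\<lambda>z. dd F z u) has_derivative dd (\<lambda>z. dd F z u) z) (at z)"
    and h: "h > 0"
  shows "\<exists>z \<in> cball y (h * (norm u + norm v)).
    F (y + h *\<^sub>R u + h *\<^sub>R v) - F (y + h *\<^sub>R u) - F (y + h *\<^sub>R v) + F y = h * (h * dd (\<lambda>z. dd F z u) z v)"
proof -
  have ball: "y + s *\<^sub>R u + t *\<^sub>R v \<in> cball y (h * (norm u + norm v))" if "0 \<le> s" "s \<le> h" "0 \<le> t" "t \<le> h" for s t
  proof -
    have "norm (s *\<^sub>R u + t *\<^sub>R v) \<le> s * norm u + t * norm v"
      using norm_triangle_ineq[of "s *\<^sub>R u" "t *\<^sub>R v"] that by simp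
    also have "\<dots> \<le> h * norm u + h * norm v" using that by (intro add_mono mult_right_mono) auto
    finally have "norm (s *\<^sub>R u + t *\<^sub>R v) \<le> h * (norm u + norm v)" by (simp add: distrib_left)
    moreover have "dist y (y + s *\<^sub>R u + t *\<^sub>R v) = norm (s *\<^sub>R u + t *\<^sub>R v)"
      by (metis add.assoc add.right_neutral dist_0_norm dist_add_cancel)
    ultimately show ?thesis by simp
  qed
  have line: "((\<lambda>s. K (a + s *\<^sub>R w)) has_real_derivative dd K (a + s *\<^sub>R w) w) (at s)"
    if "(K has_derivative dd K (a + s *\<^sub>R w)) (at (a + s *\<^sub>R w))" for K :: "'e \<Rightarrow> real" and a w s
  proof -
    have "((\<lambda>s. a + s *\<^sub>R w) has_derivative (\<lambda>r. r *\<^sub>R w)) (at s)"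
      by (auto intro!: derivative_eq_intros)
    from has_derivative_compose[OF this that]
    have "((\<lambda>s. K (a + s *\<^sub>R w)) has_derivative (\<lambda>r. dd K (a + s *\<^sub>R w) (r *\<^sub>R w))) (at s)" .
    then show ?thesis
      unfolding has_field_derivative_def
      by (rule has_derivative_eq_rhs) (simp add: fun_eq_iff linear_scale[OF has_derivative_linear[OF that]])
  qed
  let ?g = "\<lambda>s. F (y + h *\<^sub>R v + s *\<^sub>R u) - F (y + s *\<^sub>R u)"
  obtain s where s: "0 < s" "s < h"
    "?g h - ?g 0 = (h - 0) * (dd F (y + h *\<^sub>R v + s *\<^sub>R u) u - dd F (y + s *\<^sub>R u) u)"
  proof (atomize_elim, rule exE[OF MVT2[of 0 h ?g "\<lambda>s. dd F (y + h *\<^sub>R v + s *\<^sub>R u) u - dd F (y + s *\<^sub>R u) u"]])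
    fix s assume "0 \<le> s" "s \<le> h"
    then show "(?g has_real_derivative dd F (y + h *\<^sub>R v + s *\<^sub>R u) u - dd F (y + s *\<^sub>R u) u) (at s)"
      using ball[of s h] ball[of s 0] h by (intro DERIV_diff line F) (auto simp: algebra_simps)
  qed (use h in auto)
  let ?G = "\<lambda>z. dd F z u"
  let ?k = "\<lambda>t. ?G (y + s *\<^sub>R u + t *\<^sub>R v)"
  obtain t where t: "0 < t" "t < h" "?k h - ?k 0 = (h - 0) * dd ?G (y + s *\<^sub>R u + t *\<^sub>R v) v"
  proof (atomize_elim, rule exE[OF MVT2[of 0 h ?k "\<lambda>t. dd ?G (y + s *\<^sub>R u + t *\<^sub>R v) v"]])
    fix t assume "0 \<le> t" "t \<le> h"
    then show "(?k has_real_derivative dd ?G (y + s *\<^sub>R u + t *\<^sub>R v) v) (at t)"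
      using ball[of s t] s by (intro line[of ?G] G) auto
  qed (use h in auto)
  show ?thesis
    using s t ball[of s t] by (intro bexI[of _ "y + s *\<^sub>R u + t *\<^sub>R v"]) (auto simp: algebra_simps)
qed

text \<open>The second difference is symmetric in the two directions, and the two mixed derivatives that represent it
  converge to their values at \<open>y\<close> as the step size shrinks.\<close>

lemma second_derivative_symmetric_real:
  fixes F :: "'e::euclidean_space \<Rightarrow> real"
  assumes F: "smooth_on S F" and S: "open S" "y \<in> S"
  shows "dd (\<lambda>z. dd F z u) y v = dd (\<lambda>z. dd F z v) y u"
proof (rule ccontr)
  let ?a = "\<lambda>u v z. dd (\<lambda>z. dd F z u) z v"
  assume ne: "?a u v y \<noteq> ?a v u y"
  define e where "e = \<bar>?a u v y - ?a v u y\<bar> / 2"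
  have e: "e > 0" using ne by (simp add: e_def)
  have "\<exists>d>0. \<forall>z\<in>cball y d. z \<in> S \<and> \<bar>?a u v z - ?a u v y\<bar> < e" for u v
  proof -
    have "continuous_on S (?a u v)"
      by (intro smooth_on_continuous smooth_on_dd F S)
    then obtain d where d: "d > 0" "\<And>z. z \<in> S \<Longrightarrow> dist z y < d \<Longrightarrow> dist (?a u v z) (?a u v y) < e"
      using S(2) e unfolding continuous_on_iff by meson
    obtain d' where d': "d' > 0" "cball y d' \<subseteq> S" using S open_contains_cball by meson
    have "z \<in> S \<and> \<bar>?a u v z - ?a u v y\<bar> < e" if "z \<in> cball y (min (d/2) d')" for z
    proof -
      have "z \<in> S" "dist z y < d" using that d d' by (auto simp: dist_commute)
      then show ?thesis using d(2)[of z] by (simp add: dist_real_def)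
    qed
    then show ?thesis using d(1) d'(1) by (intro exI[of _ "min (d/2) d'"]) auto
  qed
  then obtain d1 d2 where d: "d1 > 0" "d2 > 0" "\<And>z. z \<in> cball y d1 \<Longrightarrow> z \<in> S \<and> \<bar>?a u v z - ?a u v y\<bar> < e"
    "\<And>z. z \<in> cball y d2 \<Longrightarrow> z \<in> S \<and> \<bar>?a v u z - ?a v u y\<bar> < e" by metis
  define h where "h = min d1 d2 / (norm u + norm v + 1)"
  have n1: "norm u + norm v + 1 > 0" using norm_ge_zero[of u] norm_ge_zero[of v] by linarith
  have h: "h > 0" using d n1 by (simp add: h_def)
  have "h * (norm u + norm v) \<le> h * (norm u + norm v + 1)" using h by (intro mult_left_mono) auto
  also have "\<dots> = min d1 d2" using n1 by (simp add: h_def)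
  finally have hd: "h * (norm u + norm v) \<le> min d1 d2" .
  have sub: "cball y (h * (norm u + norm v)) \<subseteq> cball y d1" "cball y (h * (norm u + norm v)) \<subseteq> cball y d2"
    using hd by auto
  have dF: "(F has_derivative dd F z) (at z)" "((\<lambda>z. dd F z w) has_derivative dd (\<lambda>z. dd F z w) z) (at z)"
    if "z \<in> cball y (h * (norm u + norm v))" for z w
  proof -
    have "z \<in> S" using that sub(1) d(3) by blast
    then show "(F has_derivative dd F z) (at z)" "((\<lambda>z. dd F z w) has_derivative dd (\<lambda>z. dd F z w) z) (at z)"
      by (auto intro!: smooth_on_has_derivative[OF _ S(1)] F smooth_on_dd[OF F S(1)])
  qed
  obtain z1 where z1: "z1 \<in> cball y (h * (norm u + norm v))"
    "F (y + h *\<^sub>R u + h *\<^sub>R v) - F (y + h *\<^sub>R u) - F (y + h *\<^sub>R v) + F y = h * (h * ?a u v z1)"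
    using second_difference_mean_value[OF dF h] by blast
  obtain z2 where z2: "z2 \<in> cball y (h * (norm v + norm u))"
    "F (y + h *\<^sub>R v + h *\<^sub>R u) - F (y + h *\<^sub>R v) - F (y + h *\<^sub>R u) + F y = h * (h * ?a v u z2)"
    using second_difference_mean_value[where u = v and v = u, of y h F] dF[unfolded add.commute[of "norm u"]] h by blast
  have "h * (h * ?a u v z1) = h * (h * ?a v u z2)"
    unfolding z1(2)[symmetric] z2(2)[symmetric] by (simp add: algebra_simps)
  then have "?a u v z1 = ?a v u z2" using h by simp
  moreover have "\<bar>?a u v z1 - ?a u v y\<bar> < e" using d(3) sub(1) z1(1) by blast
  moreover have "\<bar>?a v u z2 - ?a v u y\<bar> < e" using d(4) sub(2) z2(1) by (metis add.commute subsetD)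
  ultimately show False unfolding e_def by (simp add: abs_if field_simps split: if_splits)
qed

lemma second_derivative_symmetric:
  fixes F :: "'e::euclidean_space \<Rightarrow> 'f::euclidean_space"
  assumes F: "smooth_on S F" and S: "open S" "y \<in> S"
  shows "dd (\<lambda>z. dd F z u) y v = dd (\<lambda>z. dd F z v) y u"
proof (rule euclidean_eqI)
  fix b :: 'f assume "b \<in> Basis"
  let ?F = "\<lambda>z. F z \<bullet> b"
  have smF: "smooth_on S ?F"
    by (rule smooth_on_bounded_linear[OF F bounded_linear_inner_left S(1)])
  have 1: "dd ?F z w = dd F z w \<bullet> b" if "z \<in> S" for z w
    by (rule dd_eqI) (intro bounded_linear.has_derivative[OF bounded_linear_inner_left] smooth_on_has_derivative[OF F S(1) that])
  have 2: "dd (\<lambda>z. dd ?F z w) y w' = dd (\<lambda>z. dd F z w) y w' \<bullet> b" for w w'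
  proof (rule dd_eqI)
    have "((\<lambda>z. dd F z w \<bullet> b) has_derivative (\<lambda>w'. dd (\<lambda>z. dd F z w) y w' \<bullet> b)) (at y)"
      by (intro bounded_linear.has_derivative[OF bounded_linear_inner_left]
          smooth_on_has_derivative[OF smooth_on_dd[OF F S(1)] S])
    then show "((\<lambda>z. dd ?F z w) has_derivative (\<lambda>w'. dd (\<lambda>z. dd F z w) y w' \<bullet> b)) (at y)"
      by (rule has_derivative_transform_within_open[OF _ S]) (simp add: 1)
  qed
  show "dd (\<lambda>z. dd F z u) y v \<bullet> b = dd (\<lambda>z. dd F z v) y u \<bullet> b"
    using second_derivative_symmetric_real[OF smF S, of u v] by (simp only: 2)
qed

lemma matrix_inv_works:
  fixes A :: "real^'n^'n"
  assumes "invertible A"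
  shows "A ** matrix_inv A = mat 1" "matrix_inv A ** A = mat 1"
  using someI_ex[OF assms[unfolded invertible_def]] unfolding matrix_inv_def by blast+

text \<open>By the rule of Cramer the entries are quotients of determinants, and determinants are polynomials in the
  entries of the matrix.\<close>

lemma smooth_on_matrix_inv:
  fixes G :: "'e::euclidean_space \<Rightarrow> real^'n^'n"
  assumes G: "\<And>i j. smooth_on S (\<lambda>y. G y $ i $ j)" and inv: "\<And>y. y \<in> S \<Longrightarrow> invertible (G y)" and S: "open S"
  shows "smooth_on S (\<lambda>y. matrix_inv (G y) $ k $ l)"
proof -
  have det: "smooth_on S (\<lambda>y. det (H y))" if "\<And>i j. smooth_on S (\<lambda>y. H y $ i $ j)" for H :: "'e \<Rightarrow> real^'n^'n"
    unfolding det_def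
    by (intro smooth_on_sum smooth_on_mult smooth_on_prod smooth_on_const S that)
  let ?C = "\<lambda>y. (\<chi> i j. if j = k then (axis l 1 :: real^'n) $ i else G y $ i $ j) :: real^'n^'n"
  have "smooth_on S (\<lambda>y. det (?C y))"
  proof (rule det)
    show "smooth_on S (\<lambda>y. ?C y $ i $ j)" for i j
      by (cases "j = k") (auto intro: smooth_on_const S G)
  qed
  moreover have "smooth_on S (\<lambda>y. inverse (det (G y)))"
    by (intro smooth_on_inverse det G S) (use inv in \<open>auto simp: invertible_det_nz\<close>)
  ultimately have sm: "smooth_on S (\<lambda>y. det (?C y) * inverse (det (G y)))" by (rule smooth_on_mult) (rule S)
  have eq: "det (?C y) * inverse (det (G y)) = matrix_inv (G y) $ k $ l" if "y \<in> S" for y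
  proof -
    have "det (G y) \<noteq> 0" using inv[OF that] by (simp add: invertible_det_nz)
    moreover have "G y *v (matrix_inv (G y) *v axis l 1) = axis l 1"
      by (simp add: matrix_vector_mul_assoc matrix_inv_works[OF inv[OF that]])
    ultimately have "matrix_inv (G y) *v axis l 1 = (\<chi> k. det (\<chi> i j. if j = k then (axis l 1 :: real^'n) $ i else G y $ i $ j) / det (G y))"
      by (simp add: cramer)
    then have "(matrix_inv (G y) *v axis l 1) $ k = det (?C y) / det (G y)"
      by simp
    moreover have "(matrix_inv (G y) *v axis l 1) $ k = matrix_inv (G y) $ k $ l"
      by (simp add: matrix_vector_mul_component inner_axis)
    ultimately show ?thesis by (simp add: divide_inverse)
  qed
  show ?thesis by (rule smooth_on_eq[OF sm S eq[symmetric]])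
qed

section \<open>Smooth families of linear and bilinear maps\<close>

text \<open>Jacobians, the metric and the Christoffel symbols are families of linear or bilinear maps that are smooth
  in the base point for fixed arguments. In finite dimension this suffices for joint
  continuity and for a product rule in the point and the arguments.\<close>

definition smooth_linear :: "'e::euclidean_space set \<Rightarrow> ('e \<Rightarrow> 'a::euclidean_space \<Rightarrow> 'f::real_normed_vector) \<Rightarrow> bool" where
  "smooth_linear S T \<longleftrightarrow> open S \<and> (\<forall>y\<in>S. linear (T y)) \<and> (\<forall>u. smooth_on S (\<lambda>y. T y u))"

definition smooth_bilinear :: "'e::euclidean_space set \<Rightarrow>
    ('e \<Rightarrow> 'a::euclidean_space \<Rightarrow> 'b::euclidean_space \<Rightarrow> 'f::real_normed_vector) \<Rightarrow> bool" where
  "smooth_bilinear S T \<longleftrightarrow> open S \<and> (\<forall>y\<in>S. bilinear (T y)) \<and> (\<forall>u v. smooth_on S (\<lambda>y. T y u v))"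

lemma linear_basis_expansion:
  assumes "linear (T :: 'a::euclidean_space \<Rightarrow> 'f::real_vector)"
  shows "T u = (\<Sum>b\<in>Basis. (u \<bullet> b) *\<^sub>R T b)"
proof -
  have "T u = T (\<Sum>b\<in>Basis. (u \<bullet> b) *\<^sub>R b)" by (simp add: euclidean_representation)
  then show ?thesis by (simp add: linear_sum[OF assms] linear_scale[OF assms])
qed

lemma smooth_linear_dd: "smooth_on S F \<Longrightarrow> open S \<Longrightarrow> smooth_linear S (\<lambda>y. dd F y)"
  unfolding smooth_linear_def
  by (auto intro: smooth_on_dd has_derivative_linear[OF smooth_on_has_derivative])

lemma eventually_in_open_of_has_derivative:
  assumes "(Y has_derivative Y') (at z within X)" "open S" "Y z \<in> S"
  shows "\<forall>\<^sub>F z in at z within X. Y z \<in> S"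
  using has_derivative_continuous[OF assms(1)] assms(2,3) unfolding continuous_within
  by (rule topological_tendstoD)

text \<open>Split \<open>T (Y x) (U x)\<close> into \<open>T (Y x) (U z)\<close>, where only the point varies, and \<open>T (Y x) (U x - U z)\<close>. The
  second part is expanded in a basis; its coefficients vanish at \<open>z\<close>, so that the variation of \<open>T\<close> does not
  contribute.\<close>

lemma smooth_linear_has_derivative:
  assumes T: "smooth_linear S T" and Y: "(Y has_derivative Y') (at z within X)" "Y z \<in> S"
    and U: "(U has_derivative U') (at z within X)" and z: "z \<in> X"
  shows "((\<lambda>z. T (Y z) (U z)) has_derivative
    (\<lambda>w. dd (\<lambda>y. T y (U z)) (Y z) (Y' w) + T (Y z) (U' w))) (at z within X)"
proof -
  have S: "open S" and lin: "\<And>y. y \<in> S \<Longrightarrow> linear (T y)" using T by (auto simp: smooth_linear_def)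
  have d: "((\<lambda>z. T (Y z) u) has_derivative (\<lambda>w. dd (\<lambda>y. T y u) (Y z) (Y' w))) (at z within X)" for u
    by (rule has_derivative_compose[OF Y(1) smooth_on_has_derivative])
       (use T Y(2) in \<open>auto simp: smooth_linear_def\<close>)
  let ?E = "\<lambda>x. T (Y x) (U z) + (\<Sum>b\<in>Basis. ((U x - U z) \<bullet> b) *\<^sub>R T (Y x) b)"
  have E: "T (Y x) (U x) = ?E x" if "Y x \<in> S" for x
  proof -
    have "T (Y x) (U x) = T (Y x) (U z) + T (Y x) (U x - U z)" by (simp add: linear_diff[OF lin[OF that]])
    then show ?thesis using linear_basis_expansion[OF lin[OF that], of "U x - U z"] by simp
  qed
  have "(?E has_derivative (\<lambda>w. dd (\<lambda>y. T y (U z)) (Y z) (Y' w) +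
      (\<Sum>b\<in>Basis. ((U z - U z) \<bullet> b) *\<^sub>R dd (\<lambda>y. T y b) (Y z) (Y' w) + ((U' w - 0) \<bullet> b) *\<^sub>R T (Y z) b))) (at z within X)"
    by (intro has_derivative_add has_derivative_sum has_derivative_scaleR has_derivative_inner_left has_derivative_diff d U
        has_derivative_const)
  then have "(?E has_derivative (\<lambda>w. dd (\<lambda>y. T y (U z)) (Y z) (Y' w) + T (Y z) (U' w))) (at z within X)"
    by (rule has_derivative_eq_rhs) (simp add: fun_eq_iff linear_basis_expansion[OF lin[OF Y(2)], symmetric])
  then show ?thesis
  proof (rule has_derivative_transform_eventually)
    show "\<forall>\<^sub>F x in at z within X. ?E x = T (Y x) (U x)"
      using eventually_in_open_of_has_derivative[OF Y(1) S Y(2)] by eventually_elim (simp add: E)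
  qed (use z in simp_all)
qed

lemma smooth_bilinear_linear:
  assumes "smooth_bilinear S T"
  shows "smooth_linear S (\<lambda>y u. T y u v)" "smooth_linear S (\<lambda>y. T y u)"
  using assms unfolding smooth_bilinear_def smooth_linear_def bilinear_def by auto

lemma smooth_bilinear_has_derivative:
  assumes T: "smooth_bilinear S T" and Y: "(Y has_derivative Y') (at z within X)" "Y z \<in> S"
    and U: "(U has_derivative U') (at z within X)" and V: "(V has_derivative V') (at z within X)"
    and z: "z \<in> X"
  shows "((\<lambda>z. T (Y z) (U z) (V z)) has_derivative
    (\<lambda>w. dd (\<lambda>y. T y (U z) (V z)) (Y z) (Y' w) + T (Y z) (U' w) (V z) + T (Y z) (U z) (V' w))) (at z within X)"
proof -
  have S: "open S" and lin: "\<And>y u. y \<in> S \<Longrightarrow> linear (T y u)"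
    using T by (auto simp: smooth_bilinear_def bilinear_def)
  note d = smooth_linear_has_derivative[OF smooth_bilinear_linear(1)[OF T] Y U z]
  let ?E = "\<lambda>x. T (Y x) (U x) (V z) + (\<Sum>b\<in>Basis. ((V x - V z) \<bullet> b) *\<^sub>R T (Y x) (U x) b)"
  have E: "T (Y x) (U x) (V x) = ?E x" if "Y x \<in> S" for x
  proof -
    have "T (Y x) (U x) (V x) = T (Y x) (U x) (V z) + T (Y x) (U x) (V x - V z)" by (simp add: linear_diff[OF lin[OF that]])
    then show ?thesis using linear_basis_expansion[OF lin[OF that], of "U x" "V x - V z"] by simp
  qed
  have "(?E has_derivative (\<lambda>w. (dd (\<lambda>y. T y (U z) (V z)) (Y z) (Y' w) + T (Y z) (U' w) (V z)) +
      (\<Sum>b\<in>Basis. ((V z - V z) \<bullet> b) *\<^sub>R (dd (\<lambda>y. T y (U z) b) (Y z) (Y' w) + T (Y z) (U' w) b)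
        + ((V' w - 0) \<bullet> b) *\<^sub>R T (Y z) (U z) b))) (at z within X)"
    by (intro has_derivative_add[OF d] has_derivative_sum has_derivative_scaleR[OF _ d] has_derivative_inner_left has_derivative_diff V
        has_derivative_const)
  then have "(?E has_derivative (\<lambda>w. dd (\<lambda>y. T y (U z) (V z)) (Y z) (Y' w) + T (Y z) (U' w) (V z) + T (Y z) (U z) (V' w))) (at z within X)"
    by (rule has_derivative_eq_rhs) (simp add: fun_eq_iff linear_basis_expansion[OF lin[OF Y(2)], symmetric])
  then show ?thesis
  proof (rule has_derivative_transform_eventually)
    show "\<forall>\<^sub>F x in at z within X. ?E x = T (Y x) (U x) (V x)"
      using eventually_in_open_of_has_derivative[OF Y(1) S Y(2)] by eventually_elim (simp add: E)
  qed (use z in simp_all)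
qed

lemma smooth_linear_continuous_on:
  assumes T: "smooth_linear S T" and "continuous_on X Y" "continuous_on X U" "\<And>x. x \<in> X \<Longrightarrow> Y x \<in> S"
  shows "continuous_on X (\<lambda>x. T (Y x) (U x))"
proof -
  have "continuous_on X (\<lambda>x. \<Sum>b\<in>Basis. (U x \<bullet> b) *\<^sub>R T (Y x) b)"
  proof (intro continuous_intros assms)
    show "continuous_on X (\<lambda>x. T (Y x) b)" for b
      by (rule continuous_on_compose2[OF smooth_on_continuous assms(2)])
         (use T assms(4) in \<open>auto simp: smooth_linear_def\<close>)
  qed
  then show ?thesis
  proof (rule continuous_on_eq)
    fix x assume "x \<in> X"
    then have "linear (T (Y x))" using T assms(4) by (auto simp: smooth_linear_def)
    then show "(\<Sum>b\<in>Basis. (U x \<bullet> b) *\<^sub>R T (Y x) b) = T (Y x) (U x)"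
      by (rule linear_basis_expansion[symmetric])
  qed
qed

lemma smooth_bilinear_continuous_on:
  assumes T: "smooth_bilinear S T" and "continuous_on X Y" "continuous_on X U" "continuous_on X V" "\<And>x. x \<in> X \<Longrightarrow> Y x \<in> S"
  shows "continuous_on X (\<lambda>x. T (Y x) (U x) (V x))"
proof -
  have "continuous_on X (\<lambda>x. \<Sum>b\<in>Basis. (V x \<bullet> b) *\<^sub>R T (Y x) (U x) b)"
    by (intro continuous_intros assms smooth_linear_continuous_on[OF smooth_bilinear_linear(1)[OF T]])
  then show ?thesis
  proof (rule continuous_on_eq)
    fix x assume "x \<in> X"
    then have "linear (T (Y x) (U x))" using T assms(5) by (auto simp: smooth_bilinear_def bilinear_def)
    then show "(\<Sum>b\<in>Basis. (V x \<bullet> b) *\<^sub>R T (Y x) (U x) b) = T (Y x) (U x) (V x)"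
      by (rule linear_basis_expansion[symmetric])
  qed
qed

section \<open>Charts and tangent vectors\<close>

locale riemannian_manifold =
  fixes A :: "('a::t2_space, 'n::finite) chart set" and g :: "('a, 'n) riem_metric"
  assumes atlas: "smooth_atlas A" and metric: "riemannian_metric A g"
begin

lemma chart_open: "c \<in> A \<Longrightarrow> open (fst c)" "c \<in> A \<Longrightarrow> open (snd c ` fst c)"
  and chart_homeo: "c \<in> A \<Longrightarrow> homeomorphism (fst c) (snd c ` fst c) (snd c) (chart_inv c)"
  using atlas by (auto simp: smooth_atlas_def)

lemma chart_inv_inv: "c \<in> A \<Longrightarrow> p \<in> fst c \<Longrightarrow> chart_inv c (snd c p) = p"
  using chart_homeo unfolding homeomorphism_def by blast

lemma chart_inv_in: "c \<in> A \<Longrightarrow> y \<in> snd c ` fst c \<Longrightarrow> chart_inv c y \<in> fst c"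
  and chart_chart_inv: "c \<in> A \<Longrightarrow> y \<in> snd c ` fst c \<Longrightarrow> snd c (chart_inv c y) = y"
  using chart_inv_inv[of c] by (force simp del: split_paired_all)+

lemma chart_continuous: "c \<in> A \<Longrightarrow> continuous_on (fst c) (snd c)"
  and chart_inv_continuous: "c \<in> A \<Longrightarrow> continuous_on (snd c ` fst c) (chart_inv c)"
  using chart_homeo unfolding homeomorphism_def by blast+

lemma charts_atD: "c \<in> charts_at A p \<Longrightarrow> c \<in> A" "c \<in> charts_at A p \<Longrightarrow> p \<in> fst c"
  "c \<in> charts_at A p \<Longrightarrow> snd c p \<in> snd c ` fst c"
  by (auto simp: charts_at_def)

lemma charts_atI: "c \<in> A \<Longrightarrow> p \<in> fst c \<Longrightarrow> c \<in> charts_at A p"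
  by (simp add: charts_at_def)

lemma ex_chart: "\<exists>c. c \<in> charts_at A p"
  using atlas unfolding smooth_atlas_def charts_at_def by blast

definition overlap :: "('a, 'n) chart \<Rightarrow> ('a, 'n) chart \<Rightarrow> (real^'n) set" where
  "overlap c c' = snd c ` (fst c \<inter> fst c')"

lemma overlap_iff: "c \<in> A \<Longrightarrow> y \<in> overlap c c' \<longleftrightarrow> y \<in> snd c ` fst c \<and> chart_inv c y \<in> fst c'"
  using chart_inv_inv[of c] by (force simp: overlap_def)

lemma overlap_open: assumes "c \<in> A" "c' \<in> A" shows "open (overlap c c')"
proof -
  have "overlap c c' = snd c ` fst c \<inter> chart_inv c -` fst c'"
    using chart_inv_inv[OF assms(1)] by (auto simp: overlap_def)
  then show ?thesis
    using continuous_open_preimage[OF chart_inv_continuous chart_open(2) chart_open(1)] assms by simp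
qed

lemma overlap_subset: "overlap c c' \<subseteq> snd c ` fst c" by (auto simp: overlap_def)

lemma transition_smooth: "c \<in> A \<Longrightarrow> c' \<in> A \<Longrightarrow> smooth_on (overlap c c') (transition c c')"
  using atlas by (auto simp: smooth_atlas_def overlap_def)

lemma transition_chart: "c \<in> A \<Longrightarrow> p \<in> fst c \<Longrightarrow> transition c c' (snd c p) = snd c' p"
  by (simp add: transition_def chart_inv_inv)

lemma overlap_at: "c \<in> charts_at A p \<Longrightarrow> c' \<in> charts_at A p \<Longrightarrow> snd c p \<in> overlap c c'"
  by (auto simp: overlap_def charts_at_def)

lemma transition_in: "c \<in> A \<Longrightarrow> y \<in> overlap c c' \<Longrightarrow> transition c c' y \<in> overlap c' c"
  by (auto simp: overlap_def transition_chart)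

lemma transition_has_derivative:
  "c \<in> A \<Longrightarrow> c' \<in> A \<Longrightarrow> y \<in> overlap c c' \<Longrightarrow>
    (transition c c' has_derivative dd (transition c c') y) (at y)"
  by (rule smooth_on_has_derivative[OF transition_smooth overlap_open])

lemma jacobian_linear: "c \<in> A \<Longrightarrow> c' \<in> A \<Longrightarrow> y \<in> overlap c c' \<Longrightarrow> linear (dd (transition c c') y)"
  using has_derivative_linear[OF transition_has_derivative] .

lemma jacobian_id:
  assumes "c \<in> A" "y \<in> snd c ` fst c" shows "dd (transition c c) y v = v"
proof -
  have "((\<lambda>y. y) has_derivative (\<lambda>v. v)) (at y)" by (rule has_derivative_ident)
  then have "(transition c c has_derivative (\<lambda>v. v)) (at y)"
    by (rule has_derivative_transform_within_open[OF _ chart_open(2)[OF assms(1)] assms(2)])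
       (auto simp: transition_chart assms)
  then show ?thesis by (rule dd_eqI)
qed

text \<open>The chain rule. This cocycle identity makes the component in a single chart determine a tangent vector.\<close>

lemma jacobian_comp:
  assumes c: "c \<in> charts_at A p" "c' \<in> charts_at A p" "c'' \<in> charts_at A p"
  shows "dd (transition c' c'') (snd c' p) (dd (transition c c') (snd c p) v) = dd (transition c c'') (snd c p) v"
proof -
  note A = charts_atD[OF c(1)] charts_atD[OF c(2)] charts_atD[OF c(3)]
  have tr: "transition c c' (snd c p) = snd c' p" using A by (simp add: transition_chart)
  define S where "S = overlap c c' \<inter> overlap c c''"
  have S: "open S" "snd c p \<in> S" unfolding S_def by (blast intro: overlap_open overlap_at c A)+
  have d2: "(transition c' c'' has_derivative dd (transition c' c'') (snd c' p)) (at (transition c c' (snd c p)))"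
    unfolding tr using transition_has_derivative overlap_at[OF c(2,3)] A by blast
  have "((\<lambda>y. transition c' c'' (transition c c' y)) has_derivative
    (\<lambda>v. dd (transition c' c'') (snd c' p) (dd (transition c c') (snd c p) v))) (at (snd c p))"
    by (rule has_derivative_compose[OF transition_has_derivative d2]) (use A overlap_at[OF c(1,2)] in auto)
  moreover have "transition c' c'' (transition c c' y) = transition c c'' y" if "y \<in> S" for y
    using that A by (simp add: S_def overlap_iff transition_def chart_inv_inv)
  ultimately have "(transition c c'' has_derivative
    (\<lambda>v. dd (transition c' c'') (snd c' p) (dd (transition c c') (snd c p) v))) (at (snd c p))"
    using has_derivative_transform_within_open[OF _ S] by blast
  then show ?thesis by (simp add: dd_eqI)
qed

lemma jacobian_inverse:
  assumes c: "c \<in> charts_at A p" "c' \<in> charts_at A p"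
  shows "dd (transition c' c) (snd c' p) (dd (transition c c') (snd c p) v) = v"
  using jacobian_comp[OF c c(1)] jacobian_id charts_atD[OF c(1)] by simp

text \<open>The tangent vector at \<open>p\<close> whose component in the chart \<open>c\<close> is \<open>h\<close>.\<close>

definition tvec_of :: "('a, 'n) chart \<Rightarrow> 'a \<Rightarrow> real^'n \<Rightarrow> ('a, 'n) tvec" where
  "tvec_of c p h = (\<lambda>c'. if c' \<in> charts_at A p then dd (transition c c') (snd c p) h else 0)"

lemma tangent_space_jacobian:
  "v \<in> tangent_space A p \<Longrightarrow> c \<in> charts_at A p \<Longrightarrow> c' \<in> charts_at A p \<Longrightarrow>
    v c' = dd (transition c c') (snd c p) (v c)"
  unfolding tangent_space_def by blast

lemma tangent_space_outside: "v \<in> tangent_space A p \<Longrightarrow> c \<notin> charts_at A p \<Longrightarrow> v c = 0"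
  unfolding tangent_space_def by blast

lemma tangent_spaceI:
  assumes c: "c \<in> charts_at A p" and "\<And>c'. c' \<in> charts_at A p \<Longrightarrow> v c' = dd (transition c c') (snd c p) (v c)"
    "\<And>c'. c' \<notin> charts_at A p \<Longrightarrow> v c' = 0"
  shows "v \<in> tangent_space A p"
proof -
  have "v c'' = dd (transition c' c'') (snd c' p) (v c')" if "c' \<in> charts_at A p" "c'' \<in> charts_at A p" for c' c''
    using jacobian_comp[OF c that] assms(2)[OF that(1)] assms(2)[OF that(2)] by simp
  then show ?thesis using assms(3) unfolding tangent_space_def by blast
qed

lemma tvec_of_self: "c \<in> charts_at A p \<Longrightarrow> tvec_of c p h c = h"
  using jacobian_id charts_atD by (simp add: tvec_of_def)

lemma tvec_of_in: "c \<in> charts_at A p \<Longrightarrow> tvec_of c p h \<in> tangent_space A p"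
  by (rule tangent_spaceI[where c = c], assumption, unfold tvec_of_self) (simp_all add: tvec_of_def)

lemma tangent_eqI:
  assumes "v \<in> tangent_space A p" "w \<in> tangent_space A p" "c \<in> charts_at A p" "v c = w c"
  shows "v = w"
proof
  fix c' show "v c' = w c'"
    by (cases "c' \<in> charts_at A p")
       (metis assms tangent_space_jacobian, metis assms tangent_space_outside)
qed

lemma tvec_of_component: "v \<in> tangent_space A p \<Longrightarrow> c \<in> charts_at A p \<Longrightarrow> tvec_of c p (v c) = v"
  by (rule tangent_eqI) (auto intro: tvec_of_in simp: tvec_of_self)

lemma tangent_lincomb:
  assumes "\<And>i. i \<in> I \<Longrightarrow> v i \<in> tangent_space A p"
  shows "(\<lambda>c. \<Sum>i\<in>I. a i *\<^sub>R v i c) \<in> tangent_space A p"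
proof -
  obtain c where c: "c \<in> charts_at A p" using ex_chart by blast
  show ?thesis
  proof (rule tangent_spaceI[OF c])
    fix c' assume c': "c' \<in> charts_at A p"
    have lin: "linear (dd (transition c c') (snd c p))"
      using jacobian_linear overlap_at[OF c c'] charts_atD c c' by blast
    show "(\<Sum>i\<in>I. a i *\<^sub>R v i c') = dd (transition c c') (snd c p) (\<Sum>i\<in>I. a i *\<^sub>R v i c)"
      unfolding linear_sum[OF lin] linear_scale[OF lin] o_def
      by (intro sum.cong refl arg_cong[where f = "scaleR _"] tangent_space_jacobian[OF assms c c'])
  next
    fix c' assume "c' \<notin> charts_at A p"
    then show "(\<Sum>i\<in>I. a i *\<^sub>R v i c') = 0" 
      by (intro sum.neutral ballI) (simp add: tangent_space_outside[OF assms])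
  qed
qed

lemma tangent_lincomb2:
  assumes "u \<in> tangent_space A p" "v \<in> tangent_space A p"
  shows "(\<lambda>c. a *\<^sub>R u c + b *\<^sub>R v c) \<in> tangent_space A p"
  using tangent_lincomb[of "{True, False}" "\<lambda>i. if i then u else v" p "\<lambda>i. if i then a else b"] assms by simp

lemma tangent_diff: "u \<in> tangent_space A p \<Longrightarrow> v \<in> tangent_space A p \<Longrightarrow> (\<lambda>c. u c - v c) \<in> tangent_space A p"
  using tangent_lincomb2[of u p v 1 "-1"] by simp

lemma tangent_scaleR: "u \<in> tangent_space A p \<Longrightarrow> (\<lambda>c. a *\<^sub>R u c) \<in> tangent_space A p"
  using tangent_lincomb2[of u p u a 0] by simp

lemma tangent_zero: "(\<lambda>c. 0) \<in> tangent_space A p"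
  using tangent_lincomb[of "{}"] by simp

section \<open>The metric in coordinates\<close>

definition G :: "('a, 'n) chart \<Rightarrow> real^'n \<Rightarrow> real^'n \<Rightarrow> real^'n \<Rightarrow> real" where
  "G c y u v = u \<bullet> (gram A g c y *v v)"

lemma metric_linear:
  "\<lbrakk>u \<in> tangent_space A p; v \<in> tangent_space A p; w \<in> tangent_space A p\<rbrakk> \<Longrightarrow>
    g p (\<lambda>c. a *\<^sub>R u c + b *\<^sub>R v c) w = a * g p u w + b * g p v w"
  and metric_sym: "u \<in> tangent_space A p \<Longrightarrow> v \<in> tangent_space A p \<Longrightarrow> g p u v = g p v u"
  and metric_pos: "u \<in> tangent_space A p \<Longrightarrow> u \<noteq> (\<lambda>c. 0) \<Longrightarrow> g p u u > 0"
  and gram_smooth: "c \<in> A \<Longrightarrow> smooth_on (snd c ` fst c) (\<lambda>y. gram A g c y $ i $ j)"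
  using metric unfolding riemannian_metric_def by blast+

lemma metric_lincomb:
  assumes "finite I" "\<And>i. i \<in> I \<Longrightarrow> v i \<in> tangent_space A p" "w \<in> tangent_space A p"
  shows "g p (\<lambda>c. \<Sum>i\<in>I. a i *\<^sub>R v i c) w = (\<Sum>i\<in>I. a i * g p (v i) w)"
  using assms(1,2)
proof (induction I rule: finite_induct)
  case empty
  then show ?case using metric_linear[OF tangent_zero tangent_zero assms(3), of 0 0] by simp
next
  case (insert i I)
  have "g p (\<lambda>c. a i *\<^sub>R v i c + 1 *\<^sub>R (\<Sum>i\<in>I. a i *\<^sub>R v i c)) w = a i * g p (v i) w + 1 * g p (\<lambda>c. \<Sum>i\<in>I. a i *\<^sub>R v i c) w"
    by (rule metric_linear) (use insert assms in \<open>auto intro!: tangent_lincomb\<close>)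
  then show ?case using insert by simp
qed

lemma coord_vec_eq: "c \<in> charts_at A p \<Longrightarrow> coord_vec A c p i = tvec_of c p (axis i 1)"
  by (simp add: coord_vec_def tvec_of_def)

lemma vec_axis_sum: "(\<Sum>i\<in>UNIV. h $ i *\<^sub>R axis i 1) = (h :: real^'n)"
  using basis_expansion[of h] by (simp add: scalar_mult_eq_scaleR)

text \<open>Only on tangent vectors is \<open>g\<close> bilinear, hence the hypotheses: the components in one chart may replace the
  vectors because the coordinate vectors span the tangent space.\<close>

lemma metric_coord:
  assumes u: "u \<in> tangent_space A p" and v: "v \<in> tangent_space A p" and c: "c \<in> charts_at A p"
  shows "g p u v = G c (snd c p) (u c) (v c)"
proof -
  have p: "chart_inv c (snd c p) = p" using charts_atD[OF c] chart_inv_inv by blast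
  define e where "e i = coord_vec A c p i" for i
  have e: "e i \<in> tangent_space A p" "e i c = axis i 1" for i
    using c by (simp_all add: e_def coord_vec_eq tvec_of_in tvec_of_self)
  have ex: "w = (\<lambda>c'. \<Sum>i\<in>UNIV. w c $ i *\<^sub>R e i c')" if "w \<in> tangent_space A p" for w
    by (rule tangent_eqI[OF that tangent_lincomb c]) (simp_all add: e vec_axis_sum)
  have "g p u v = (\<Sum>i\<in>UNIV. u c $ i * g p (e i) v)"
    by (subst ex[OF u], rule metric_lincomb) (auto simp: e v)
  also have "\<dots> = (\<Sum>i\<in>UNIV. u c $ i * (\<Sum>j\<in>UNIV. v c $ j * g p (e i) (e j)))"
  proof -
    have "g p (e i) v = g p v (e i)" for i by (intro metric_sym e v)
    moreover have "g p v (e i) = (\<Sum>j\<in>UNIV. v c $ j * g p (e j) (e i))" for i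
      by (subst ex[OF v], rule metric_lincomb) (auto simp: e)
    moreover have "g p (e j) (e i) = g p (e i) (e j)" for i j by (intro metric_sym e)
    ultimately show ?thesis by simp
  qed
  also have "\<dots> = G c (snd c p) (u c) (v c)"
    by (simp add: G_def gram_def p inner_vec_def matrix_vector_mult_def e_def mult.commute)
  finally show ?thesis .
qed

lemma G_tvec_of:
  "c \<in> A \<Longrightarrow> y \<in> snd c ` fst c \<Longrightarrow>
    G c y u v = g (chart_inv c y) (tvec_of c (chart_inv c y) u) (tvec_of c (chart_inv c y) v)"
  using metric_coord[of "tvec_of c (chart_inv c y) u" "chart_inv c y" "tvec_of c (chart_inv c y) v" c]
  by (simp add: tvec_of_in tvec_of_self charts_atI chart_inv_in chart_chart_inv)

lemma G_sym: "c \<in> A \<Longrightarrow> y \<in> snd c ` fst c \<Longrightarrow> G c y u v = G c y v u"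
  using metric_sym by (simp add: G_tvec_of tvec_of_in charts_atI chart_inv_in)

lemma G_pos: assumes "c \<in> A" "y \<in> snd c ` fst c" "h \<noteq> 0" shows "G c y h h > 0"
proof -
  have c: "c \<in> charts_at A (chart_inv c y)" using assms by (simp add: charts_atI chart_inv_in)
  have "tvec_of c (chart_inv c y) h \<noteq> (\<lambda>c. 0)" using tvec_of_self[OF c, of h] assms(3) by metis
  then show ?thesis using G_tvec_of[OF assms(1,2)] metric_pos[OF tvec_of_in[OF c]] by simp
qed

lemma G_bilinear: "bilinear (G c y)"
  unfolding G_def bilinear_def by (auto intro!: linearI simp: inner_add_left inner_add_right matrix_vector_right_distrib
    matrix_vector_mult_scaleR)

lemma G_smooth: assumes "c \<in> A" shows "smooth_bilinear (snd c ` fst c) (G c)"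
proof -
  have "smooth_on (snd c ` fst c) (\<lambda>y. \<Sum>i\<in>UNIV. u $ i * (\<Sum>j\<in>UNIV. gram A g c y $ i $ j * v $ j))" for u v
    by (intro smooth_on_sum smooth_on_mult smooth_on_const gram_smooth chart_open assms)
  then have "smooth_on (snd c ` fst c) (\<lambda>y. G c y u v)" for u v
    by (simp add: G_def inner_vec_def matrix_vector_mult_def)
  then show ?thesis using chart_open(2)[OF assms] G_bilinear by (simp add: smooth_bilinear_def)
qed

lemmas G_simps = bilinear_ladd[OF G_bilinear] bilinear_radd[OF G_bilinear] bilinear_lmul[OF G_bilinear]
  bilinear_rmul[OF G_bilinear] bilinear_lneg[OF G_bilinear] bilinear_rneg[OF G_bilinear]
  bilinear_lsub[OF G_bilinear] bilinear_rsub[OF G_bilinear] bilinear_lzero[OF G_bilinear] bilinear_rzero[OF G_bilinear]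

lemma G_nondegenerate:
  assumes "c \<in> A" "y \<in> snd c ` fst c" "\<And>w. G c y u w = G c y v w" shows "u = v"
proof (rule ccontr)
  assume "u \<noteq> v"
  then have "G c y (u - v) (u - v) > 0" using G_pos assms by simp
  moreover have "G c y (u - v) (u - v) = 0" using assms(3) by (simp add: G_simps)
  ultimately show False by simp
qed

lemma gram_invertible: assumes "c \<in> A" "y \<in> snd c ` fst c" shows "invertible (gram A g c y)"
proof -
  have "h = 0" if "gram A g c y *v h = 0" for h
    using G_pos[OF assms, of h] that by (force simp: G_def)
  then show ?thesis
    by (metis invertible_left_inverse matrix_left_invertible_ker)
qed

end

lemma smooth_on_vec:
  fixes F :: "'e::euclidean_space \<Rightarrow> real^'n"
  assumes "\<And>k. smooth_on S (\<lambda>y. F y $ k)" "open S"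
  shows "smooth_on S F"
proof -
  have "smooth_on S (\<lambda>y. \<Sum>k\<in>UNIV. F y $ k *\<^sub>R (axis k 1 :: real^'n))"
    by (intro smooth_on_sum smooth_on_bounded_linear[OF _ bounded_linear_scaleR_left] assms)
  moreover have "(\<Sum>k\<in>UNIV. F y $ k *\<^sub>R axis k 1) = F y" for y
    using basis_expansion[of "F y"] by (simp add: scalar_mult_eq_scaleR)
  ultimately show ?thesis by simp
qed

lemma smooth_linear_dd_linear:
  assumes T: "smooth_linear S T" and y: "y \<in> S"
  shows "linear (\<lambda>u. dd (\<lambda>z. T z u) y w)"
proof -
  have S: "open S" and lin: "\<And>z. z \<in> S \<Longrightarrow> linear (T z)"
    and d: "\<And>u. ((\<lambda>z. T z u) has_derivative dd (\<lambda>z. T z u) y) (at y)"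
    using T y by (auto simp: smooth_linear_def intro: smooth_on_has_derivative)
  show ?thesis
  proof (rule linearI)
    fix u v
    have "((\<lambda>z. T z u + T z v) has_derivative (\<lambda>w. dd (\<lambda>z. T z u) y w + dd (\<lambda>z. T z v) y w)) (at y)"
      by (intro has_derivative_add d)
    then have "((\<lambda>z. T z (u + v)) has_derivative (\<lambda>w. dd (\<lambda>z. T z u) y w + dd (\<lambda>z. T z v) y w)) (at y)"
      by (rule has_derivative_transform_within_open[OF _ S y]) (simp add: linear_add[OF lin])
    then show "dd (\<lambda>z. T z (u + v)) y w = dd (\<lambda>z. T z u) y w + dd (\<lambda>z. T z v) y w" by (rule dd_eqI)
  next
    fix r u
    have "((\<lambda>z. r *\<^sub>R T z u) has_derivative (\<lambda>w. r *\<^sub>R dd (\<lambda>z. T z u) y w)) (at y)"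
      by (intro has_derivative_scaleR_right d)
    then have "((\<lambda>z. T z (r *\<^sub>R u)) has_derivative (\<lambda>w. r *\<^sub>R dd (\<lambda>z. T z u) y w)) (at y)"
      by (rule has_derivative_transform_within_open[OF _ S y]) (simp add: linear_scale[OF lin])
    then show "dd (\<lambda>z. T z (r *\<^sub>R u)) y w = r *\<^sub>R dd (\<lambda>z. T z u) y w" by (rule dd_eqI)
  qed
qed

lemma smooth_bilinear_dd:
  assumes T: "smooth_bilinear S T"
  shows "smooth_bilinear S (\<lambda>y u v. dd (\<lambda>z. T z u v) y w)"
  unfolding smooth_bilinear_def bilinear_def
proof (intro conjI allI ballI)
  show "open S" using T by (simp add: smooth_bilinear_def)
  show "smooth_on S (\<lambda>y. dd (\<lambda>z. T z u v) y w)" for u v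
    using T by (auto simp: smooth_bilinear_def intro: smooth_on_dd)
qed (auto intro: smooth_linear_dd_linear smooth_bilinear_linear[OF T])

lemma smooth_bilinear_dd_direction:
  assumes "smooth_bilinear S T" "y \<in> S"
  shows "((\<lambda>z. T z u v) has_derivative dd (\<lambda>z. T z u v) y) (at y)"
  using assms unfolding smooth_bilinear_def by (auto intro: smooth_on_has_derivative)

lemma smooth_bilinear_dd_continuous_on:
  assumes T: "smooth_bilinear S T" and c: "continuous_on X Y" "continuous_on X U" "continuous_on X V" "continuous_on X W"
    and S: "\<And>x. x \<in> X \<Longrightarrow> Y x \<in> S"
  shows "continuous_on X (\<lambda>x. dd (\<lambda>z. T z (U x) (V x)) (Y x) (W x))"
proof -
  have "continuous_on X (\<lambda>x. \<Sum>b\<in>Basis. (W x \<bullet> b) *\<^sub>R dd (\<lambda>z. T z (U x) (V x)) (Y x) b)"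
    by (intro continuous_intros c smooth_bilinear_continuous_on[OF smooth_bilinear_dd[OF T] c(1-3) S])
  then show ?thesis
    by (rule continuous_on_eq) (simp add: dd_basis_sum[OF smooth_bilinear_dd_direction[OF T S], symmetric])
qed

context riemannian_manifold
begin

section \<open>Christoffel symbols\<close>

abbreviation "\<Gamma> \<equiv> Gam A g"

text \<open>The derivative in the direction \<open>w\<close> of the inner product of two coordinate fields with constant components
  \<open>u\<close> and \<open>v\<close>.\<close>

definition DG :: "('a, 'n) chart \<Rightarrow> real^'n \<Rightarrow> real^'n \<Rightarrow> real^'n \<Rightarrow> real^'n \<Rightarrow> real" where
  "DG c y w u v = dd (\<lambda>z. G c z u v) y w"

lemma G_has_derivative:
  "c \<in> A \<Longrightarrow> y \<in> snd c ` fst c \<Longrightarrow> ((\<lambda>z. G c z u v) has_derivative (\<lambda>w. DG c y w u v)) (at y)"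
  unfolding DG_def using smooth_bilinear_dd_direction[OF G_smooth] by simp

lemma DG_sym:
  assumes "c \<in> A" "y \<in> snd c ` fst c" shows "DG c y w u v = DG c y w v u"
proof -
  have "((\<lambda>z. G c z u v) has_derivative (\<lambda>w. DG c y w v u)) (at y)"
    by (rule has_derivative_transform_within_open[OF G_has_derivative[OF assms] chart_open(2)[OF assms(1)] assms(2)])
       (rule G_sym[OF assms(1)])
  then show ?thesis unfolding DG_def[of c y w u v] by (rule dd_eqI)
qed

lemma DG_expand:
  assumes c: "c \<in> A" "y \<in> snd c ` fst c"
  shows "DG c y w u v = (\<Sum>i\<in>UNIV. \<Sum>j\<in>UNIV. \<Sum>k\<in>UNIV. u $ i * v $ j * w $ k * partial k (\<lambda>z. gram A g c z $ i $ j) y)"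
proof -
  have d: "((\<lambda>z. gram A g c z $ i $ j) has_derivative dd (\<lambda>z. gram A g c z $ i $ j) y) (at y)" for i j
    by (rule smooth_on_has_derivative[OF gram_smooth chart_open(2)]) (use c in auto)
  have "((\<lambda>z. \<Sum>i\<in>UNIV. \<Sum>j\<in>UNIV. (u $ i * v $ j) * gram A g c z $ i $ j) has_derivative
    (\<lambda>w. \<Sum>i\<in>UNIV. \<Sum>j\<in>UNIV. (u $ i * v $ j) * dd (\<lambda>z. gram A g c z $ i $ j) y w)) (at y)"
    by (intro has_derivative_sum has_derivative_mult_right d)
  moreover have "(\<lambda>z. G c z u v) = (\<lambda>z. \<Sum>i\<in>UNIV. \<Sum>j\<in>UNIV. (u $ i * v $ j) * gram A g c z $ i $ j)"
    by (simp add: G_def inner_vec_def matrix_vector_mult_def sum_distrib_left mult_ac)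
  ultimately have "DG c y w u v = (\<Sum>i\<in>UNIV. \<Sum>j\<in>UNIV. (u $ i * v $ j) * dd (\<lambda>z. gram A g c z $ i $ j) y w)"
    unfolding DG_def by (simp add: dd_eqI)
  moreover have "dd (\<lambda>z. gram A g c z $ i $ j) y w = (\<Sum>k\<in>UNIV. w $ k * partial k (\<lambda>z. gram A g c z $ i $ j) y)" for i j
  proof -
    note lin = has_derivative_linear[OF d[of i j]]
    have "dd (\<lambda>z. gram A g c z $ i $ j) y w = dd (\<lambda>z. gram A g c z $ i $ j) y (\<Sum>k\<in>UNIV. w $ k *\<^sub>R axis k 1)"
      by (simp add: vec_axis_sum)
    then show ?thesis by (simp add: partial_def linear_sum[OF lin] linear_scale[OF lin])
  qed
  ultimately show ?thesis by (simp add: sum_distrib_left mult_ac)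
qed

text \<open>The formula of Koszul for fields with constant components, whose brackets vanish. Since the metric is
  nondegenerate, it determines the Christoffel symbols, and their
  transformation rule and metric compatibility are read off from it without the inverse of the Gram matrix.\<close>

lemma koszul:
  assumes c: "c \<in> A" "y \<in> snd c ` fst c"
  shows "2 * G c y (\<Gamma> c y u v) w = DG c y u v w + DG c y v u w - DG c y w u v"
proof -
  define P where "P k i j = partial k (\<lambda>z. gram A g c z $ i $ j) y" for k i j
  define B where "B l = (\<Sum>i\<in>UNIV. \<Sum>j\<in>UNIV. (P i j l + P j i l - P l i j) * u $ i * v $ j)" for l
  have "\<Gamma> c y u v = matrix_inv (gram A g c y) *v (\<chi> l. (1/2) * B l)"
  proof (rule vec_eq_iff[THEN iffD2], rule allI)
    fix k
    have "\<Gamma> c y u v $ k = (\<Sum>i\<in>UNIV. \<Sum>j\<in>UNIV. \<Sum>l\<in>UNIV. matrix_inv (gram A g c y) $ k $ l *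
        ((1/2) * ((P i j l + P j i l - P l i j) * u $ i * v $ j)))"
      by (simp add: Gam_def christoffel_def P_def sum_distrib_left sum_distrib_right mult_ac)
    also have "\<dots> = (\<Sum>l\<in>UNIV. \<Sum>i\<in>UNIV. \<Sum>j\<in>UNIV. matrix_inv (gram A g c y) $ k $ l *
        ((1/2) * ((P i j l + P j i l - P l i j) * u $ i * v $ j)))"
      by (rule trans[OF sum.cong[OF refl sum.swap] sum.swap])
    also have "\<dots> = (matrix_inv (gram A g c y) *v (\<chi> l. (1/2) * B l)) $ k"
      by (simp add: matrix_vector_mult_def B_def sum_distrib_left)
    finally show "\<Gamma> c y u v $ k = (matrix_inv (gram A g c y) *v (\<chi> l. (1/2) * B l)) $ k" .
  qed
  then have "gram A g c y *v \<Gamma> c y u v = (\<chi> l. (1/2) * B l)"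
    by (simp add: matrix_vector_mul_assoc matrix_inv_works[OF gram_invertible[OF c]])
  moreover have "G c y (\<Gamma> c y u v) w = G c y w (\<Gamma> c y u v)" by (rule G_sym[OF c])
  ultimately have "2 * G c y (\<Gamma> c y u v) w = (\<Sum>l\<in>UNIV. w $ l * B l)"
    by (simp add: G_def inner_vec_def sum_distrib_left)
  also have "\<dots> = (\<Sum>l\<in>UNIV. \<Sum>i\<in>UNIV. \<Sum>j\<in>UNIV. u $ i * v $ j * w $ l * P i j l)
      + (\<Sum>l\<in>UNIV. \<Sum>i\<in>UNIV. \<Sum>j\<in>UNIV. u $ i * v $ j * w $ l * P j i l)
      - (\<Sum>l\<in>UNIV. \<Sum>i\<in>UNIV. \<Sum>j\<in>UNIV. u $ i * v $ j * w $ l * P l i j)"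
    by (simp add: B_def sum_distrib_left sum.distrib sum_subtractf algebra_simps)
  also have "(\<Sum>l\<in>UNIV. \<Sum>i\<in>UNIV. \<Sum>j\<in>UNIV. u $ i * v $ j * w $ l * P i j l) = DG c y u v w"
    unfolding DG_expand[OF c] P_def[symmetric]
    by (rule trans[OF sum.cong[OF refl sum.swap]], rule trans[OF sum.swap], rule sum.cong[OF refl])
       (simp add: mult_ac)
  also have "(\<Sum>l\<in>UNIV. \<Sum>i\<in>UNIV. \<Sum>j\<in>UNIV. u $ i * v $ j * w $ l * P j i l) = DG c y v u w"
    unfolding DG_expand[OF c] P_def[symmetric]
    by (rule trans[OF sum.swap], rule sum.cong[OF refl]) (simp add: mult_ac)
  also have "(\<Sum>l\<in>UNIV. \<Sum>i\<in>UNIV. \<Sum>j\<in>UNIV. u $ i * v $ j * w $ l * P l i j) = DG c y w u v"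
    unfolding DG_expand[OF c] P_def[symmetric]
    by (rule trans[OF sum.swap], rule sum.cong[OF refl], rule sum.swap)
  finally show ?thesis .
qed

lemma \<Gamma>_bilinear: "bilinear (\<Gamma> c y)"
  unfolding bilinear_def
  by (auto intro!: linearI simp: Gam_def vec_eq_iff algebra_simps sum.distrib sum_distrib_left)

lemma \<Gamma>_smooth: assumes c: "c \<in> A" shows "smooth_bilinear (snd c ` fst c) (\<Gamma> c)"
proof -
  let ?S = "snd c ` fst c"
  have o: "open ?S" by (rule chart_open(2)[OF c])
  have p: "smooth_on ?S (partial k (\<lambda>z. gram A g c z $ i $ j))" for i j k
    unfolding partial_def by (rule smooth_on_dd[OF gram_smooth[OF c] o])
  have inv: "smooth_on ?S (\<lambda>y. matrix_inv (gram A g c y) $ k $ l)" for k l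
    by (rule smooth_on_matrix_inv[OF gram_smooth[OF c] gram_invertible[OF c] o])
  have chr: "smooth_on ?S (\<lambda>y. christoffel A g c y k i j)" for k i j
    unfolding christoffel_def
    by (intro smooth_on_mult smooth_on_sum smooth_on_diff smooth_on_add smooth_on_const inv p o)
  have "smooth_on ?S (\<lambda>y. \<Gamma> c y u v)" for u v
  proof (rule smooth_on_vec[OF _ o])
    show "smooth_on ?S (\<lambda>y. \<Gamma> c y u v $ k)" for k
      unfolding Gam_def vec_lambda_beta
      by (intro smooth_on_mult smooth_on_sum smooth_on_const chr o)
  qed
  then show ?thesis using o \<Gamma>_bilinear by (simp add: smooth_bilinear_def)
qed

lemma metric_compatible:
  assumes c: "c \<in> A" "y \<in> snd c ` fst c"
  shows "DG c y w u v = G c y (\<Gamma> c y w u) v + G c y u (\<Gamma> c y w v)"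
proof -
  have "G c y u (\<Gamma> c y w v) = G c y (\<Gamma> c y w v) u" by (rule G_sym[OF c])
  then show ?thesis
    using koszul[OF c, of w u v] koszul[OF c, of w v u] DG_sym[OF c, of w u v] DG_sym[OF c, of u w v]
      DG_sym[OF c, of v w u] by simp
qed

lemma G_transform:
  assumes c: "c \<in> A" "c' \<in> A" and y: "y \<in> overlap c c'"
  shows "G c y u v = G c' (transition c c' y) (dd (transition c c') y u) (dd (transition c c') y v)"
proof -
  define p where "p = chart_inv c y"
  have y': "y \<in> snd c ` fst c" "p \<in> fst c'" using y c by (auto simp: overlap_iff p_def)
  have p: "c \<in> charts_at A p" "c' \<in> charts_at A p" "snd c p = y" "snd c' p = transition c c' y"
    using c y' by (auto simp: p_def transition_def chart_inv_in chart_chart_inv intro: charts_atI)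
  have "G c (snd c p) (tvec_of c p u c) (tvec_of c p v c) = G c' (snd c' p) (tvec_of c p u c') (tvec_of c p v c')"
    using metric_coord[OF tvec_of_in tvec_of_in, of c p c _ u v] p by metis
  then show ?thesis using p by (simp add: tvec_of_self) (simp add: tvec_of_def)
qed

lemma jacobian_surj:
  assumes c: "c \<in> A" "c' \<in> A" and y: "y \<in> overlap c c'"
  shows "\<exists>u. dd (transition c c') y u = w"
proof -
  define p where "p = chart_inv c y"
  have y': "y \<in> snd c ` fst c" "p \<in> fst c'" using y c by (auto simp: overlap_iff p_def)
  have p: "c \<in> charts_at A p" "c' \<in> charts_at A p" "snd c p = y"
    using c y' by (auto simp: p_def chart_inv_in chart_chart_inv intro: charts_atI)
  show ?thesis using jacobian_inverse[OF p(2,1)] p(3) by metis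
qed

text \<open>Differentiating the transformation rule of the metric produces second derivatives of the transition map.
  In the combination of Koszul's formula all but one of them cancel, by the symmetry of the second derivative,
  and the remaining one is the inhomogeneous term.\<close>

lemma \<Gamma>_transform:
  assumes c: "c \<in> A" "c' \<in> A" and y: "y \<in> overlap c c'"
  defines "\<phi> \<equiv> transition c c'"
  shows "dd \<phi> y (\<Gamma> c y u v) = dd (\<lambda>z. dd \<phi> z v) y u + \<Gamma> c' (\<phi> y) (dd \<phi> y u) (dd \<phi> y v)"
proof -
  have o: "open (overlap c c')" and sm: "smooth_on (overlap c c') \<phi>"
    unfolding \<phi>_def by (rule overlap_open[OF c], rule transition_smooth[OF c])
  have y1: "y \<in> snd c ` fst c" using y overlap_subset by blast
  have y2: "\<phi> y \<in> snd c' ` fst c'" using transition_in[OF c(1) y] overlap_subset unfolding \<phi>_def by blast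
  let ?J = "dd \<phi> y"
  let ?D = "\<lambda>v w. dd (\<lambda>z. dd \<phi> z v) y w"
  have D: "((\<lambda>z. dd \<phi> z v) has_derivative ?D v) (at y)" for v
    by (rule smooth_on_has_derivative[OF smooth_on_dd[OF sm o] o y])
  have Dsym: "?D u v = ?D v u" for u v by (rule second_derivative_symmetric[OF sm o y])
  have DGt: "DG c y w u v = DG c' (\<phi> y) (?J w) (?J u) (?J v) + G c' (\<phi> y) (?D u w) (?J v) + G c' (\<phi> y) (?J u) (?D v w)" for w u v
  proof -
    have "((\<lambda>z. G c' (\<phi> z) (dd \<phi> z u) (dd \<phi> z v)) has_derivative
      (\<lambda>w. dd (\<lambda>z. G c' z (?J u) (?J v)) (\<phi> y) (?J w) + G c' (\<phi> y) (?D u w) (?J v) + G c' (\<phi> y) (?J u) (?D v w))) (at y)"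
      by (rule smooth_bilinear_has_derivative[OF G_smooth[OF c(2)] smooth_on_has_derivative[OF sm o y] y2 D D UNIV_I])
    then have "((\<lambda>z. G c z u v) has_derivative
      (\<lambda>w. dd (\<lambda>z. G c' z (?J u) (?J v)) (\<phi> y) (?J w) + G c' (\<phi> y) (?D u w) (?J v) + G c' (\<phi> y) (?J u) (?D v w))) (at y)"
      by (rule has_derivative_transform_within_open[OF _ o y]) (simp add: G_transform[OF c] \<phi>_def)
    then show ?thesis unfolding DG_def by (rule dd_eqI)
  qed
  show ?thesis
  proof (rule G_nondegenerate[OF c(2) y2])
    fix w'
    obtain w where w: "?J w = w'" using jacobian_surj[OF c y] unfolding \<phi>_def by blast
    have "2 * G c' (\<phi> y) (?J (\<Gamma> c y u v)) (?J w) = 2 * G c y (\<Gamma> c y u v) w"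
      using G_transform[OF c y] by (simp add: \<phi>_def)
    also have "\<dots> = 2 * G c' (\<phi> y) (?D v u + \<Gamma> c' (\<phi> y) (?J u) (?J v)) (?J w)"
    proof -
      have "G c' (\<phi> y) (?D u v) (?J w) = G c' (\<phi> y) (?D v u) (?J w)"
        "G c' (\<phi> y) (?J u) (?D v w) = G c' (\<phi> y) (?J u) (?D w v)"
        "G c' (\<phi> y) (?D u w) (?J v) = G c' (\<phi> y) (?J v) (?D w u)"
        by (simp_all only: Dsym[of u v] Dsym[of v w] Dsym[of u w]) (rule G_sym[OF c(2) y2])
      then show ?thesis
        unfolding koszul[OF c(1) y1] DGt G_simps distrib_left koszul[OF c(2) y2] by linarith
    qed
    finally show "G c' (\<phi> y) (?J (\<Gamma> c y u v)) w' = G c' (\<phi> y) (?D v u + \<Gamma> c' (\<phi> y) (?J u) (?J v)) w'"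
      using w by simp
  qed
qed

section \<open>Covariant derivatives and curvature are tensorial\<close>

text \<open>The inhomogeneous term in the transformation of the Christoffel symbols cancels the derivative of the Jacobian
  that arises when the components of the field are differentiated.\<close>

lemma cov_deriv_tangent:
  assumes X: "\<And>q. X q \<in> tangent_space A q" and \<xi>: "\<xi> \<in> tangent_space A p"
    and d: "\<And>c. c \<in> charts_at A p \<Longrightarrow> (\<lambda>y. X (chart_inv c y) c) differentiable (at (snd c p))"
  shows "cov_deriv A g X p \<xi> \<in> tangent_space A p"
proof -
  obtain c where c: "c \<in> charts_at A p" using ex_chart by blast
  show ?thesis
  proof (rule tangent_spaceI[OF c])
    fix c' assume c': "c' \<in> charts_at A p"
    define y where "y = snd c p"
    define \<phi> where "\<phi> = transition c c'"
    define K where "K d z = X (chart_inv d z) d" for d z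
    have cA: "c \<in> A" "c' \<in> A" and pc: "p \<in> fst c" "p \<in> fst c'" using c c' by (auto simp: charts_at_def)
    have o: "open (overlap c c')" and sm: "smooth_on (overlap c c') \<phi>" and y: "y \<in> overlap c c'"
      unfolding \<phi>_def y_def using overlap_open transition_smooth overlap_at c c' cA by auto
    have \<phi>y: "\<phi> y = snd c' p" using transition_chart[OF cA(1) pc(1)] by (simp add: \<phi>_def y_def)
    have dK: "(K c has_derivative dd (K c) y) (at y)" "(K c' has_derivative dd (K c') (\<phi> y)) (at (\<phi> y))"
      using d[OF c] d[OF c', folded \<phi>y] unfolding K_def[abs_def] y_def by (auto intro: has_derivative_dd)
    have eq: "K c' (\<phi> z) = dd \<phi> z (K c z)" if "z \<in> overlap c c'" for z
    proof -
      define q where "q = chart_inv c z"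
      have q: "c \<in> charts_at A q" "c' \<in> charts_at A q" "snd c q = z" "chart_inv c' (\<phi> z) = q"
        using that cA by (auto simp: q_def overlap_iff chart_inv_in chart_chart_inv \<phi>_def transition_def chart_inv_inv intro: charts_atI)
      show ?thesis using tangent_space_jacobian[OF X q(1,2)] q(3,4) by (simp add: K_def \<phi>_def flip: q_def)
    qed
    have D1: "((\<lambda>z. K c' (\<phi> z)) has_derivative (\<lambda>w. dd (K c') (\<phi> y) (dd \<phi> y w))) (at y)"
      by (rule has_derivative_compose[OF smooth_on_has_derivative[OF sm o y] dK(2)])
    have "((\<lambda>z. dd \<phi> z (K c z)) has_derivative (\<lambda>w. dd (\<lambda>z. dd \<phi> z (K c y)) y w + dd \<phi> y (dd (K c) y w))) (at y)"
      by (rule smooth_linear_has_derivative[OF smooth_linear_dd[OF sm o] has_derivative_ident y dK(1) UNIV_I])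
    then have D2: "((\<lambda>z. K c' (\<phi> z)) has_derivative (\<lambda>w. dd (\<lambda>z. dd \<phi> z (K c y)) y w + dd \<phi> y (dd (K c) y w))) (at y)"
      by (rule has_derivative_transform_within_open[OF _ o y]) (simp add: eq)
    have D: "dd (K c') (\<phi> y) (dd \<phi> y w) = dd (\<lambda>z. dd \<phi> z (K c y)) y w + dd \<phi> y (dd (K c) y w)" for w
      by (rule fun_cong[OF has_derivative_unique[OF D1 D2]])
    have "\<xi> c' = dd \<phi> y (\<xi> c)" using tangent_space_jacobian[OF \<xi> c c'] by (simp add: \<phi>_def y_def)
    moreover have "X p c' = dd \<phi> y (X p c)" using tangent_space_jacobian[OF X c c'] by (simp add: \<phi>_def y_def)
    moreover have "K c y = X p c" using chart_inv_inv[OF cA(1) pc(1)] by (simp add: K_def y_def)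
    ultimately have "dd (K c') (\<phi> y) (\<xi> c') + \<Gamma> c' (\<phi> y) (\<xi> c') (X p c') = dd \<phi> y (dd (K c) y (\<xi> c)) + dd \<phi> y (\<Gamma> c y (\<xi> c) (X p c))"
      using D[of "\<xi> c"] \<Gamma>_transform[OF cA y, folded \<phi>_def, of "\<xi> c" "X p c"] by simp
    moreover have "linear (dd \<phi> y)" using jacobian_linear[OF cA y] by (simp add: \<phi>_def)
    moreover have "cov_deriv A g X p \<xi> c' = dd (K c') (\<phi> y) (\<xi> c') + \<Gamma> c' (\<phi> y) (\<xi> c') (X p c')"
      using c' by (simp only: cov_deriv_def K_def[abs_def] \<phi>y if_True)
    moreover have "cov_deriv A g X p \<xi> c = dd (K c) y (\<xi> c) + \<Gamma> c y (\<xi> c) (X p c)"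
      using c by (simp only: cov_deriv_def K_def[abs_def] y_def if_True)
    ultimately show "cov_deriv A g X p \<xi> c' = dd (transition c c') (snd c p) (cov_deriv A g X p \<xi> c)"
      unfolding \<phi>_def[symmetric] y_def[symmetric] by (simp only: linear_add)
  qed (simp add: cov_deriv_def)
qed

text \<open>The curvature tensor in coordinates, applied to vectors with the components \<open>u\<close>, \<open>v\<close>, \<open>w\<close>.\<close>

definition Rc :: "('a, 'n) chart \<Rightarrow> real^'n \<Rightarrow> real^'n \<Rightarrow> real^'n \<Rightarrow> real^'n \<Rightarrow> real^'n" where
  "Rc c y u v w = dd (\<lambda>z. \<Gamma> c z v w) y u - dd (\<lambda>z. \<Gamma> c z u w) y v + \<Gamma> c y u (\<Gamma> c y v w) - \<Gamma> c y v (\<Gamma> c y u w)"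

lemma curvature_coord:
  "c \<in> charts_at A p \<Longrightarrow> curvature A g p \<xi> \<eta> \<zeta> c = Rc c (snd c p) (\<xi> c) (\<eta> c) (\<zeta> c)"
  by (simp add: curvature_def Rc_def Let_def)

text \<open>Differentiate the transformation rule of the Christoffel symbols once more and eliminate second derivatives of
  the transition map by means of that rule. The third derivatives and the
  other inhomogeneous terms are symmetric in \<open>u\<close> and \<open>v\<close>, so that they cancel in the curvature.\<close>

lemma Rc_transform:
  assumes c: "c \<in> A" "c' \<in> A" and y: "y \<in> overlap c c'"
  defines "\<phi> \<equiv> transition c c'"
  shows "dd \<phi> y (Rc c y u v w) = Rc c' (\<phi> y) (dd \<phi> y u) (dd \<phi> y v) (dd \<phi> y w)"
proof -
  have o: "open (overlap c c')" and sm: "smooth_on (overlap c c') \<phi>"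
    unfolding \<phi>_def by (rule overlap_open[OF c], rule transition_smooth[OF c])
  have y1: "y \<in> snd c ` fst c" using y overlap_subset by blast
  have y2: "\<phi> y \<in> snd c' ` fst c'" using transition_in[OF c(1) y] overlap_subset unfolding \<phi>_def by blast
  let ?J = "dd \<phi> y"
  let ?D = "\<lambda>v w. dd (\<lambda>z. dd \<phi> z v) y w"
  have lin: "linear ?J" using jacobian_linear[OF c y] by (simp add: \<phi>_def)
  have D: "((\<lambda>z. dd \<phi> z v) has_derivative ?D v) (at y)" for v
    by (rule smooth_on_has_derivative[OF smooth_on_dd[OF sm o] o y])
  have Dsym: "?D u v = ?D v u" for u v by (rule second_derivative_symmetric[OF sm o y])
  note tr = \<Gamma>_transform[OF c, folded \<phi>_def]
  have bil: "\<Gamma> d z (a + b) e = \<Gamma> d z a e + \<Gamma> d z b e" "\<Gamma> d z e (a + b) = \<Gamma> d z e a + \<Gamma> d z e b" for d z a b e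
    using bilinear_ladd[OF \<Gamma>_bilinear] bilinear_radd[OF \<Gamma>_bilinear] by auto
  define D3 where "D3 u v = dd (\<lambda>z. dd (\<lambda>z'. dd \<phi> z' w) z v) y u" for u v
  define dc where "dc u v = dd (\<lambda>z. \<Gamma> c z v w) y u" for u v
  define dc' where "dc' u v = dd (\<lambda>z. \<Gamma> c' z v (?J w)) (\<phi> y) u" for u v
  \<comment> \<open>Writing the second derivative as \<open>\<partial>\<^sub>v (\<partial>\<^sub>w \<phi>)\<close> makes the third one visibly symmetric in \<open>u, v\<close>.\<close>
  have D3sym: "D3 u v = D3 v u" for u v
    unfolding D3_def by (rule second_derivative_symmetric[OF smooth_on_dd[OF sm o] o y])
  have main: "?J (dc u v) + ?J (\<Gamma> c y u (\<Gamma> c y v w)) =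
      D3 u v + dc' (?J u) (?J v) + \<Gamma> c' (\<phi> y) (?J u) (\<Gamma> c' (\<phi> y) (?J v) (?J w)) + \<Gamma> c' (\<phi> y) (?D v u) (?J w)
      + (\<Gamma> c' (\<phi> y) (?J v) (?D w u) + \<Gamma> c' (\<phi> y) (?J u) (?D w v))" for u v
  proof -
    have D1: "((\<lambda>z. dd \<phi> z (\<Gamma> c z v w)) has_derivative
        (\<lambda>u. dd (\<lambda>z. dd \<phi> z (\<Gamma> c y v w)) y u + ?J (dc u v))) (at y)"
      unfolding dc_def
      by (rule smooth_linear_has_derivative[OF smooth_linear_dd[OF sm o] has_derivative_ident y _ UNIV_I])
         (rule smooth_bilinear_dd_direction[OF \<Gamma>_smooth[OF c(1)] y1])
    have "((\<lambda>z. dd (\<lambda>z'. dd \<phi> z' w) z v + \<Gamma> c' (\<phi> z) (dd \<phi> z v) (dd \<phi> z w)) has_derivative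
        (\<lambda>u. D3 u v + (dc' (?J u) (?J v) + \<Gamma> c' (\<phi> y) (?D v u) (?J w) + \<Gamma> c' (\<phi> y) (?J v) (?D w u)))) (at y)"
      unfolding D3_def dc'_def
      by (intro has_derivative_add smooth_bilinear_has_derivative[OF \<Gamma>_smooth[OF c(2)] smooth_on_has_derivative[OF sm o y] y2 D D UNIV_I]
          smooth_on_has_derivative[OF smooth_on_dd[OF smooth_on_dd[OF sm o] o] o y])
    then have D2: "((\<lambda>z. dd \<phi> z (\<Gamma> c z v w)) has_derivative
        (\<lambda>u. D3 u v + (dc' (?J u) (?J v) + \<Gamma> c' (\<phi> y) (?D v u) (?J w) + \<Gamma> c' (\<phi> y) (?J v) (?D w u)))) (at y)"
      by (rule has_derivative_transform_within_open[OF _ o y]) (simp add: tr)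
    have "dd (\<lambda>z. dd \<phi> z (\<Gamma> c y v w)) y u + ?J (dc u v) =
        D3 u v + (dc' (?J u) (?J v) + \<Gamma> c' (\<phi> y) (?D v u) (?J w) + \<Gamma> c' (\<phi> y) (?J v) (?D w u))"
      by (rule fun_cong[OF has_derivative_unique[OF D1 D2]])
    moreover have "dd (\<lambda>z. dd \<phi> z (\<Gamma> c y v w)) y u = ?J (\<Gamma> c y u (\<Gamma> c y v w)) -
        (\<Gamma> c' (\<phi> y) (?J u) (?D w v) + \<Gamma> c' (\<phi> y) (?J u) (\<Gamma> c' (\<phi> y) (?J v) (?J w)))"
      using tr[OF y, of u "\<Gamma> c y v w"] tr[OF y, of v w] by (simp add: bil)
    ultimately show ?thesis by (simp add: algebra_simps)
  qed
  have "?J (Rc c y u v w) = (?J (dc u v) + ?J (\<Gamma> c y u (\<Gamma> c y v w))) - (?J (dc v u) + ?J (\<Gamma> c y v (\<Gamma> c y u w)))"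
    unfolding Rc_def dc_def by (simp add: linear_add[OF lin] linear_diff[OF lin])
  also have "\<dots> = dc' (?J u) (?J v) - dc' (?J v) (?J u) + \<Gamma> c' (\<phi> y) (?J u) (\<Gamma> c' (\<phi> y) (?J v) (?J w)) - \<Gamma> c' (\<phi> y) (?J v) (\<Gamma> c' (\<phi> y) (?J u) (?J w))"
    unfolding main using D3sym[of u v] Dsym[of u v] by simp
  also have "\<dots> = Rc c' (\<phi> y) (?J u) (?J v) (?J w)" by (simp add: Rc_def dc'_def)
  finally show ?thesis .
qed

lemma curvature_tangent:
  assumes "\<xi> \<in> tangent_space A p" "\<eta> \<in> tangent_space A p" "\<zeta> \<in> tangent_space A p"
  shows "curvature A g p \<xi> \<eta> \<zeta> \<in> tangent_space A p"
proof -
  obtain c where c: "c \<in> charts_at A p" using ex_chart by blast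
  show ?thesis
  proof (rule tangent_spaceI[OF c])
    fix c' assume c': "c' \<in> charts_at A p"
    have "transition c c' (snd c p) = snd c' p" using c by (auto simp: charts_at_def transition_chart)
    then show "curvature A g p \<xi> \<eta> \<zeta> c' = dd (transition c c') (snd c p) (curvature A g p \<xi> \<eta> \<zeta> c)"
      using Rc_transform[OF charts_atD(1)[OF c] charts_atD(1)[OF c'] overlap_at[OF c c'], of "\<xi> c" "\<eta> c" "\<zeta> c"]
        tangent_space_jacobian[OF assms(1) c c'] tangent_space_jacobian[OF assms(2) c c'] tangent_space_jacobian[OF assms(3) c c']
      unfolding curvature_coord[OF c] curvature_coord[OF c'] by metis
  qed (simp add: curvature_def)
qed

lemma Rc_antisym: "Rc c y u v w = - Rc c y v u w"
  by (simp add: Rc_def)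

lemma Rc_linear:
  assumes c: "c \<in> A" "y \<in> snd c ` fst c"
  shows "linear (\<lambda>u. Rc c y u v w)" "linear (\<lambda>w. Rc c y u v w)"
proof -
  note sm = \<Gamma>_smooth[OF c(1)]
  have l1: "linear (\<lambda>u. dd (\<lambda>z. \<Gamma> c z v w) y u)" for v w
    by (rule has_derivative_linear[OF smooth_bilinear_dd_direction[OF sm c(2)]])
  have l2: "linear (\<lambda>u. dd (\<lambda>z. \<Gamma> c z u w) y v)" "linear (\<lambda>w. dd (\<lambda>z. \<Gamma> c z u w) y v)" for u v w
    by (rule smooth_linear_dd_linear[OF smooth_bilinear_linear(1)[OF sm] c(2)],
        rule smooth_linear_dd_linear[OF smooth_bilinear_linear(2)[OF sm] c(2)])
  have l3: "linear (\<lambda>u. \<Gamma> c y u w)" "linear (\<lambda>w. \<Gamma> c y u w)" for u w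
    using \<Gamma>_bilinear[of c y] by (auto simp: bilinear_def)
  show "linear (\<lambda>u. Rc c y u v w)" "linear (\<lambda>w. Rc c y u v w)"
    unfolding Rc_def
    by (intro linear_compose_add linear_compose_sub l1 l2 l3 linear_compose[OF l3(1) l3(2), unfolded o_def]
       linear_compose[OF l3(2) l3(2), unfolded o_def])+
qed

text \<open>By metric compatibility \<open>\<partial>\<^sub>v \<langle>w, w\<rangle> = 2 \<langle>\<Gamma>(v,w), w\<rangle>\<close> for constant \<open>w\<close>. Differentiating in the direction
  \<open>u\<close> and antisymmetrising gives zero on the left and twice the claim on the right.\<close>

lemma Rc_metric_skew:
  assumes c: "c \<in> A" "y \<in> snd c ` fst c"
  shows "G c y (Rc c y u v w) w = 0"
proof -
  note sm = G_smooth[OF c(1)] and o = chart_open(2)[OF c(1)]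
  have half: "dd (\<lambda>z. dd (\<lambda>z. G c z w w) z v) y u =
      2 * (G c y (\<Gamma> c y u (\<Gamma> c y v w)) w + G c y (\<Gamma> c y v w) (\<Gamma> c y u w) + G c y (dd (\<lambda>z. \<Gamma> c z v w) y u) w)" for u v
  proof -
    have "((\<lambda>z. G c z (\<Gamma> c z v w) w) has_derivative (\<lambda>u. dd (\<lambda>z. G c z (\<Gamma> c y v w) w) y u
        + G c y (dd (\<lambda>z. \<Gamma> c z v w) y u) w + G c y (\<Gamma> c y v w) 0)) (at y)"
      by (rule smooth_bilinear_has_derivative[OF sm has_derivative_ident c(2) _ has_derivative_const UNIV_I])
         (rule smooth_bilinear_dd_direction[OF \<Gamma>_smooth[OF c(1)] c(2)])
    then have "((\<lambda>z. 2 * G c z (\<Gamma> c z v w) w) has_derivative (\<lambda>u. 2 * (DG c y u (\<Gamma> c y v w) w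
        + G c y (dd (\<lambda>z. \<Gamma> c z v w) y u) w + G c y (\<Gamma> c y v w) 0))) (at y)"
      unfolding DG_def by (rule has_derivative_mult_right)
    then have "((\<lambda>z. dd (\<lambda>z. G c z w w) z v) has_derivative (\<lambda>u. 2 * (DG c y u (\<Gamma> c y v w) w
        + G c y (dd (\<lambda>z. \<Gamma> c z v w) y u) w + G c y (\<Gamma> c y v w) 0))) (at y)"
    proof (rule has_derivative_transform_within_open[OF _ o c(2)])
      fix z assume z: "z \<in> snd c ` fst c"
      show "2 * G c z (\<Gamma> c z v w) w = dd (\<lambda>z. G c z w w) z v"
        using metric_compatible[OF c(1) z, of v w w] G_sym[OF c(1) z, of w "\<Gamma> c z v w"] unfolding DG_def by simp
    qed
    from dd_eqI[OF this] show ?thesis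
      using metric_compatible[OF c, of u "\<Gamma> c y v w" w] by (simp add: G_simps)
  qed
  have "dd (\<lambda>z. dd (\<lambda>z. G c z w w) z v) y u = dd (\<lambda>z. dd (\<lambda>z. G c z w w) z u) y v"
    by (rule second_derivative_symmetric_real[OF _ o c(2)]) (use sm in \<open>simp add: smooth_bilinear_def\<close>)
  then show ?thesis
    unfolding half Rc_def by (simp add: G_simps G_sym[OF c, of "\<Gamma> c y v w" "\<Gamma> c y u w"])
qed

end

section \<open>Parallel transport\<close>

context riemannian_manifold
begin

text \<open>Gram-Schmidt in coordinates: as long as fewer than \<open>n\<close> vectors are chosen, some vector lies outside their span.\<close>

lemma orthonormal_basis_exists:
  "\<exists>e :: 'n \<Rightarrow> ('a, 'n) tvec. (\<forall>i. e i \<in> tangent_space A p) \<and> (\<forall>i j. g p (e i) (e j) = (if i = j then 1 else 0))"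
proof -
  obtain c where c: "c \<in> charts_at A p" using ex_chart by blast
  define y where "y = snd c p"
  have y: "c \<in> A" "y \<in> snd c ` fst c" using c by (auto simp: charts_at_def y_def)
  have "\<exists>h :: 'n \<Rightarrow> real^'n. \<forall>i\<in>F. \<forall>j\<in>F. G c y (h i) (h j) = (if i = j then 1 else 0)" if "finite F" for F :: "'n set"
    using that
  proof (induction F rule: finite_induct)
    case (insert k F)
    then obtain h where h: "\<And>i j. i \<in> F \<Longrightarrow> j \<in> F \<Longrightarrow> G c y (h i) (h j) = (if i = j then 1 else 0)" by blast
    have "span (h ` F) \<noteq> UNIV"
    proof
      assume "span (h ` F) = UNIV"
      then have "DIM(real^'n) \<le> card (h ` F)"
        using dim_le_card[of UNIV "h ` F"] insert(1) by simp
      moreover have "card (h ` F) \<le> card F" by (rule card_image_le[OF insert(1)])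
      moreover have "card F < CARD('n)" using insert(2) by (metis UNIV_I finite_code psubsetI psubset_card_mono subset_UNIV)
      ultimately show False by simp
    qed
    then obtain w where w: "w \<notin> span (h ` F)" by blast
    define w' where "w' = w - (\<Sum>i\<in>F. G c y w (h i) *\<^sub>R h i)"
    have "(\<Sum>i\<in>F. G c y w (h i) *\<^sub>R h i) \<in> span (h ` F)"
      by (intro span_sum span_scale span_base imageI)
    then have "w' \<noteq> 0" using w unfolding w'_def by force
    then have pos: "G c y w' w' > 0" by (rule G_pos[OF y])
    have orth: "G c y w' (h j) = 0" if j: "j \<in> F" for j
    proof -
      have lin: "linear (\<lambda>u. G c y u (h j))" using G_bilinear[of c y] by (simp add: bilinear_def)
      have "G c y (\<Sum>i\<in>F. G c y w (h i) *\<^sub>R h i) (h j) = (\<Sum>i\<in>F. G c y w (h i) * G c y (h i) (h j))"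
        by (simp add: linear_sum[OF lin] linear_scale[OF lin])
      also have "\<dots> = (\<Sum>i\<in>F. if i = j then G c y w (h i) else 0)" by (rule sum.cong) (simp_all add: h j)
      finally show ?thesis using j insert(1) by (simp add: w'_def G_simps)
    qed
    define e where "e = (1 / sqrt (G c y w' w')) *\<^sub>R w'"
    have e: "G c y e e = 1" "G c y e (h j) = 0" "G c y (h j) e = 0" if "j \<in> F" for j
      using pos orth[OF that] G_sym[OF y, of "h j" w'] by (simp_all add: e_def G_simps flip: power2_eq_square)
    have ee: "G c y e e = 1" using pos by (simp add: e_def G_simps)
    show ?case
      by (rule exI[of _ "h(k := e)"]) (use insert(2) h e ee in auto)
  qed auto
  from this[of UNIV] obtain h :: "'n \<Rightarrow> real^'n" where h: "\<And>i j. G c y (h i) (h j) = (if i = j then 1 else 0)" by auto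
  show ?thesis
    by (rule exI[of _ "\<lambda>i. tvec_of c p (h i)"])
       (simp add: tvec_of_in[OF c] metric_coord[OF tvec_of_in[OF c] tvec_of_in[OF c] c] tvec_of_self[OF c] h flip: y_def)
qed

end

text \<open>Twice differentiable curves: differentiability of the velocity makes the coefficients of the equation of
  parallel transport continuous.\<close>

locale curve_on_manifold = riemannian_manifold A g
  for A :: "('a::t2_space, 'n::finite) chart set" and g :: "('a, 'n) riem_metric" +
  fixes x :: "real \<Rightarrow> 'a"
  assumes dx: "differentiable_curve A UNIV x" and dv: "differentiable_along A x (velocity A UNIV x)"
begin

abbreviation "vel \<equiv> velocity A UNIV x"

lemma x_continuous: "continuous_on UNIV x"
  using dx by (simp add: differentiable_curve_def)

lemma chart_times_open: "c \<in> A \<Longrightarrow> open {s. x s \<in> fst c}"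
  using open_vimage[OF chart_open(1) x_continuous] by (simp add: vimage_def)

lemma vel_tangent: "vel t \<in> tangent_space A (x t)"
  using dv by (simp add: differentiable_along_def)

lemma coord_has_derivative:
  "c \<in> charts_at A (x t) \<Longrightarrow> ((\<lambda>s. snd c (x s)) has_vector_derivative vel t c) (at t)"
  using dx by (simp add: differentiable_curve_def velocity_def vector_derivative_works)

lemma vel_continuous: "c \<in> A \<Longrightarrow> continuous_on {s. x s \<in> fst c} (\<lambda>s. vel s c)"
  using dv unfolding differentiable_along_def
  by (auto intro!: continuous_at_imp_continuous_on differentiable_imp_continuous_within charts_atI)

lemma coord_continuous: "c \<in> A \<Longrightarrow> continuous_on {s. x s \<in> fst c} (\<lambda>s. snd c (x s))"
  by (rule continuous_on_compose2[OF chart_continuous continuous_on_subset[OF x_continuous]]) auto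

lemma coord_eventually:
  assumes "c \<in> charts_at A (x t)" shows "\<forall>\<^sub>F s in at t within I. c \<in> charts_at A (x s)"
proof -
  have "\<forall>\<^sub>F s in at t within I. s \<in> {s. x s \<in> fst c}"
    using eventually_at_topological chart_times_open charts_atD[OF assms] by blast
  then show ?thesis by eventually_elim (use assms in \<open>auto simp: charts_at_def\<close>)
qed

text \<open>The product rule for the metric along the curve. The arguments on the right-hand side are the components of
  the covariant derivatives of the two fields.\<close>

lemma metric_along_has_derivative:
  assumes c: "c \<in> charts_at A (x t)" and t: "t \<in> I"
    and V: "\<And>s. s \<in> I \<Longrightarrow> V s \<in> tangent_space A (x s)" "((\<lambda>s. V s c) has_vector_derivative V') (at t within I)"
    and W: "\<And>s. s \<in> I \<Longrightarrow> W s \<in> tangent_space A (x s)" "((\<lambda>s. W s c) has_vector_derivative W') (at t within I)"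
  shows "((\<lambda>s. g (x s) (V s) (W s)) has_real_derivative
    (G c (snd c (x t)) (V' + \<Gamma> c (snd c (x t)) (vel t c) (V t c)) (W t c)
     + G c (snd c (x t)) (V t c) (W' + \<Gamma> c (snd c (x t)) (vel t c) (W t c)))) (at t within I)"
proof -
  let ?y = "\<lambda>s. snd c (x s)"
  have cy: "c \<in> A" "?y t \<in> snd c ` fst c" using charts_atD[OF c] by auto
  have lin: "linear (G c (?y t) u)" "linear (\<lambda>u. G c (?y t) u v)" for u v
    using G_bilinear[of c "?y t"] by (auto simp: bilinear_def)
  have "((\<lambda>s. G c (?y s) (V s c) (W s c)) has_derivative
    (\<lambda>r. dd (\<lambda>z. G c z (V t c) (W t c)) (?y t) (r *\<^sub>R vel t c) + G c (?y t) (r *\<^sub>R V') (W t c) + G c (?y t) (V t c) (r *\<^sub>R W'))) (at t within I)"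
    by (rule smooth_bilinear_has_derivative[where Y = ?y and U = "\<lambda>s. V s c" and V = "\<lambda>s. W s c", OF G_smooth[OF cy(1)] _ cy(2) _ _ t])
       (use coord_has_derivative[OF c] V(2) W(2) in \<open>auto simp: has_vector_derivative_def intro: has_derivative_at_withinI\<close>)
  moreover have "dd (\<lambda>z. G c z (V t c) (W t c)) (?y t) (r *\<^sub>R vel t c) = r * DG c (?y t) (vel t c) (V t c) (W t c)" for r
    using linear_scale[OF has_derivative_linear[OF G_has_derivative[OF cy]]] by (simp add: DG_def)
  ultimately have "((\<lambda>s. G c (?y s) (V s c) (W s c)) has_real_derivative
    (DG c (?y t) (vel t c) (V t c) (W t c) + G c (?y t) V' (W t c) + G c (?y t) (V t c) W')) (at t within I)"
    unfolding has_field_derivative_def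
    by (elim has_derivative_eq_rhs) (simp add: fun_eq_iff G_simps algebra_simps)
  then have "((\<lambda>s. g (x s) (V s) (W s)) has_real_derivative
    (DG c (?y t) (vel t c) (V t c) (W t c) + G c (?y t) V' (W t c) + G c (?y t) (V t c) W')) (at t within I)"
    unfolding has_field_derivative_def
  proof (rule has_derivative_transform_eventually[OF _ _ _ t])
    have "\<forall>\<^sub>F s in at t within I. s \<in> I" by (simp add: eventually_at_filter)
    then show "\<forall>\<^sub>F s in at t within I. G c (?y s) (V s c) (W s c) = g (x s) (V s) (W s)"
      using coord_eventually[OF c] by eventually_elim (simp add: metric_coord V(1) W(1))
    show "G c (?y t) (V t c) (W t c) = g (x t) (V t) (W t)" 
      by (rule metric_coord[OF V(1)[OF t] W(1)[OF t] c, symmetric])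
  qed
  then show ?thesis
    unfolding metric_compatible[OF cy] by (simp add: G_simps algebra_simps)
qed

definition parallel_on :: "real set \<Rightarrow> (real \<Rightarrow> ('a, 'n) tvec) \<Rightarrow> bool" where
  "parallel_on I V \<longleftrightarrow> (\<forall>t\<in>I. V t \<in> tangent_space A (x t) \<and> (\<forall>c\<in>charts_at A (x t).
     ((\<lambda>s. V s c) has_vector_derivative - \<Gamma> c (snd c (x t)) (vel t c) (V t c)) (at t within I)))"

lemma parallel_onD:
  "parallel_on I V \<Longrightarrow> t \<in> I \<Longrightarrow> V t \<in> tangent_space A (x t)"
  "parallel_on I V \<Longrightarrow> t \<in> I \<Longrightarrow> c \<in> charts_at A (x t) \<Longrightarrow>
     ((\<lambda>s. V s c) has_vector_derivative - \<Gamma> c (snd c (x t)) (vel t c) (V t c)) (at t within I)"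
  by (auto simp: parallel_on_def)

text \<open>It suffices to verify the equation in one chart at each time, because the transformation rule of the Christoffel
  symbols carries it to every other chart.\<close>

lemma parallel_onI:
  assumes T: "\<And>t. t \<in> I \<Longrightarrow> V t \<in> tangent_space A (x t)"
    and d: "\<And>t. t \<in> I \<Longrightarrow> \<exists>c\<in>charts_at A (x t).
     ((\<lambda>s. V s c) has_vector_derivative - \<Gamma> c (snd c (x t)) (vel t c) (V t c)) (at t within I)"
  shows "parallel_on I V"
  unfolding parallel_on_def
proof (intro ballI conjI T)
  fix t c' assume t: "t \<in> I" and c': "c' \<in> charts_at A (x t)"
  obtain c where c: "c \<in> charts_at A (x t)"
    "((\<lambda>s. V s c) has_vector_derivative - \<Gamma> c (snd c (x t)) (vel t c) (V t c)) (at t within I)" using d[OF t] by blast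
  define \<phi> where "\<phi> = transition c c'"
  let ?y = "\<lambda>s. snd c (x s)"
  have cA: "c \<in> A" "c' \<in> A" using c c' by (auto simp: charts_at_def)
  have o: "open (overlap c c')" and sm: "smooth_on (overlap c c') \<phi>" and y: "?y t \<in> overlap c c'"
    unfolding \<phi>_def using overlap_open transition_smooth overlap_at c c' cA by auto
  have \<phi>y: "\<phi> (?y t) = snd c' (x t)" using transition_chart charts_atD[OF c(1)] by (simp add: \<phi>_def)
  have lin: "linear (dd \<phi> (?y t))" using jacobian_linear[OF cA y] by (simp add: \<phi>_def)
  have lin2: "linear (dd (\<lambda>z. dd \<phi> z (V t c)) (?y t))"
    by (rule has_derivative_linear[OF smooth_on_has_derivative[OF smooth_on_dd[OF sm o] o y]])
  have "((\<lambda>s. dd \<phi> (?y s) (V s c)) has_derivative (\<lambda>r. dd (\<lambda>z. dd \<phi> z (V t c)) (?y t) (r *\<^sub>R vel t c)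
      + dd \<phi> (?y t) (r *\<^sub>R - \<Gamma> c (?y t) (vel t c) (V t c)))) (at t within I)"
    by (rule smooth_linear_has_derivative[where Y = ?y and U = "\<lambda>s. V s c", OF smooth_linear_dd[OF sm o] _ y _ t])
       (use coord_has_derivative[OF c(1)] c(2) in \<open>auto simp: has_vector_derivative_def intro: has_derivative_at_withinI\<close>)
  then have "((\<lambda>s. dd \<phi> (?y s) (V s c)) has_vector_derivative
      (dd (\<lambda>z. dd \<phi> z (V t c)) (?y t) (vel t c) + dd \<phi> (?y t) (- \<Gamma> c (?y t) (vel t c) (V t c)))) (at t within I)"
    unfolding has_vector_derivative_def
    by (elim has_derivative_eq_rhs)
       (simp add: fun_eq_iff linear_scale[OF lin] linear_neg[OF lin] linear_scale[OF lin2] scaleR_add_right scaleR_diff_right)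
  also have "dd (\<lambda>z. dd \<phi> z (V t c)) (?y t) (vel t c) + dd \<phi> (?y t) (- \<Gamma> c (?y t) (vel t c) (V t c))
      = - \<Gamma> c' (\<phi> (?y t)) (dd \<phi> (?y t) (vel t c)) (dd \<phi> (?y t) (V t c))"
    using \<Gamma>_transform[OF cA y, folded \<phi>_def, of "vel t c" "V t c"] by (simp add: linear_neg[OF lin])
  also have "dd \<phi> (?y t) (vel t c) = vel t c'"
    using tangent_space_jacobian[OF vel_tangent c(1) c'] by (simp add: \<phi>_def)
  also have "dd \<phi> (?y t) (V t c) = V t c'"
    using tangent_space_jacobian[OF T[OF t] c(1) c'] by (simp add: \<phi>_def)
  finally have fin: "((\<lambda>s. dd \<phi> (?y s) (V s c)) has_derivative (\<lambda>r. r *\<^sub>R - \<Gamma> c' (snd c' (x t)) (vel t c') (V t c'))) (at t within I)"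
    by (simp only: \<phi>y has_vector_derivative_def)
  show "((\<lambda>s. V s c') has_vector_derivative - \<Gamma> c' (snd c' (x t)) (vel t c') (V t c')) (at t within I)"
    unfolding has_vector_derivative_def
  proof (rule has_derivative_transform_eventually[OF fin _ _ t])
    have "\<forall>\<^sub>F s in at t within I. s \<in> I" by (simp add: eventually_at_filter)
    then show "\<forall>\<^sub>F s in at t within I. dd \<phi> (?y s) (V s c) = V s c'"
      using coord_eventually[OF c(1)] coord_eventually[OF c']
      by eventually_elim (unfold \<phi>_def, rule tangent_space_jacobian[OF T, symmetric])
    show "dd \<phi> (?y t) (V t c) = V t c'"
      unfolding \<phi>_def by (rule tangent_space_jacobian[OF T c(1) c', symmetric]) (rule t)
  qed
qed

lemma parallel_on_subset: "parallel_on I V \<Longrightarrow> J \<subseteq> I \<Longrightarrow> parallel_on J V"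
  unfolding parallel_on_def using has_vector_derivative_within_subset by blast

lemma parallel_inner_constant:
  assumes V: "parallel_on I V" and W: "parallel_on I W" and I: "convex I" "s \<in> I" "t \<in> I"
  shows "g (x s) (V s) (W s) = g (x t) (V t) (W t)"
proof -
  have "((\<lambda>s. g (x s) (V s) (W s)) has_real_derivative 0) (at r within I)" if r: "r \<in> I" for r
  proof -
    obtain c where c: "c \<in> charts_at A (x r)" using ex_chart by blast
    show ?thesis
      using metric_along_has_derivative[OF c r parallel_onD(1)[OF V] parallel_onD(2)[OF V r c] parallel_onD(1)[OF W] parallel_onD(2)[OF W r c]]
      by (simp add: G_simps)
  qed
  then obtain k where "\<And>r. r \<in> I \<Longrightarrow> g (x r) (V r) (W r) = k"
    using has_field_derivative_zero_constant[OF I(1), of "\<lambda>s. g (x s) (V s) (W s)"] by blast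
  then show ?thesis using I by simp
qed

lemma parallel_on_diff:
  assumes V: "parallel_on I V" and W: "parallel_on I W"
  shows "parallel_on I (\<lambda>t c. V t c - W t c)"
  unfolding parallel_on_def
proof (intro ballI conjI)
  fix t assume t: "t \<in> I"
  show "(\<lambda>c. V t c - W t c) \<in> tangent_space A (x t)"
    by (intro tangent_diff parallel_onD(1)[OF V t] parallel_onD(1)[OF W t])
  fix c assume c: "c \<in> charts_at A (x t)"
  have "((\<lambda>s. V s c - W s c) has_vector_derivative - \<Gamma> c (snd c (x t)) (vel t c) (V t c)
      - - \<Gamma> c (snd c (x t)) (vel t c) (W t c)) (at t within I)"
    by (intro has_vector_derivative_diff parallel_onD(2)[OF V t c] parallel_onD(2)[OF W t c])
  then show "((\<lambda>s. V s c - W s c) has_vector_derivative - \<Gamma> c (snd c (x t)) (vel t c) (V t c - W t c)) (at t within I)"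
    by (simp add: bilinear_rsub[OF \<Gamma>_bilinear])
qed

lemma parallel_unique:
  assumes V: "parallel_on I V" and W: "parallel_on I W" and I: "convex I" "s \<in> I" "t \<in> I" and eq: "V s = W s"
  shows "V t = W t"
proof (rule ccontr)
  let ?Z = "\<lambda>t c. V t c - W t c"
  have Z: "parallel_on I ?Z" by (rule parallel_on_diff[OF V W])
  assume "V t \<noteq> W t"
  then have "?Z t \<noteq> (\<lambda>c. 0)" by (auto simp: fun_eq_iff)
  then have "g (x t) (?Z t) (?Z t) > 0" using metric_pos parallel_onD(1)[OF Z I(3)] by blast
  moreover have "?Z s = (\<lambda>c. 0 *\<^sub>R V s c + 0 *\<^sub>R V s c)" using eq by simp
  then have "g (x s) (?Z s) (?Z s) = 0"
    using metric_linear[of "V s" "x s" "V s" "V s" 0 0] metric_linear[OF tangent_zero tangent_zero tangent_zero, of "x s" 0 0] by simp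
  ultimately show False using parallel_inner_constant[OF Z Z I] by simp
qed

text \<open>Inside one chart this is a linear differential equation. Its coefficient is defined on \<open>[a, b]\<close> only and is
  extended to all times by its boundary values, which keeps it continuous and bounded.\<close>

lemma parallel_transport_in_chart:
  assumes ab: "a \<le> b" "\<And>s. s \<in> {a..b} \<Longrightarrow> x s \<in> fst c" and c: "c \<in> A"
    and t1: "t1 \<in> {a..b}" and v: "v \<in> tangent_space A (x t1)"
  shows "\<exists>V. parallel_on {a..b} V \<and> V t1 = v"
proof -
  define cl where "cl t = max a (min b t)" for t
  have cl: "cl t \<in> {a..b}" for t using ab(1) by (auto simp: cl_def)
  have cl_id: "cl t = t" if "t \<in> {a..b}" for t using that by (auto simp: cl_def)
  have clc: "continuous_on UNIV cl" unfolding cl_def[abs_def] by (intro continuous_intros)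
  define L where "L t w = - \<Gamma> c (snd c (x (cl t))) (vel (cl t) c) w" for t w
  have cc: "continuous_on UNIV (\<lambda>t. snd c (x (cl t)))" "continuous_on UNIV (\<lambda>t. vel (cl t) c)"
    by (rule continuous_on_compose2[OF coord_continuous[OF c] clc], use cl ab in force)
       (rule continuous_on_compose2[OF vel_continuous[OF c] clc], use cl ab in force)
  have L1: "linear (L t)" for t
    unfolding L_def using \<Gamma>_bilinear[of c "snd c (x (cl t))"] by (auto simp: bilinear_def intro: linear_compose_neg)
  have L2: "continuous_on UNIV (\<lambda>t. L t (w t))" if "continuous_on UNIV w" for w
    unfolding L_def
    by (intro continuous_intros smooth_bilinear_continuous_on[OF \<Gamma>_smooth[OF c] cc that]) (use cl ab in auto)
  have "\<exists>M. \<forall>t. norm (L t e) \<le> M" for e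
  proof -
    have "compact ((\<lambda>t. L t e) ` {a..b})"
      by (intro compact_continuous_image continuous_on_subset[OF L2]) auto
    then obtain M where M: "\<And>t. t \<in> {a..b} \<Longrightarrow> norm (L t e) \<le> M"
      using compact_imp_bounded bounded_iff by (metis imageI)
    have "L t e = L (cl t) e" for t using cl cl_id by (simp add: L_def)
    then show ?thesis using M cl by metis
  qed
  then obtain M where M: "\<And>t e. norm (L t e) \<le> M e" by metis
  have L3: "norm (L t w) \<le> (\<Sum>e\<in>Basis. M e) * norm w" for t w
  proof -
    have "norm (L t w) = norm (\<Sum>e\<in>Basis. (w \<bullet> e) *\<^sub>R L t e)" using linear_basis_expansion[OF L1, of t w] by simp
    also have "\<dots> \<le> (\<Sum>e\<in>Basis. norm w * M e)"
      by (rule sum_norm_le) (auto intro!: mult_mono M Basis_le_norm)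
    finally show ?thesis by (simp add: sum_distrib_left mult.commute)
  qed
  obtain w where w: "w t1 = v c" "\<And>t. (w has_vector_derivative L t (w t)) (at t)"
    using linear_ode_solvable[OF L1 L3 L2] by blast
  define V where "V t = tvec_of c (x t) (w t)" for t
  have ct: "c \<in> charts_at A (x t)" if "t \<in> {a..b}" for t using c ab(2)[OF that] by (simp add: charts_at_def)
  have "parallel_on {a..b} V"
  proof (rule parallel_onI)
    fix t assume t: "t \<in> {a..b}"
    show "V t \<in> tangent_space A (x t)" unfolding V_def by (rule tvec_of_in[OF ct[OF t]])
    have "(w has_vector_derivative - \<Gamma> c (snd c (x t)) (vel t c) (V t c)) (at t within {a..b})"
      using w(2)[of t] by (simp add: L_def cl_id[OF t] V_def tvec_of_self[OF ct[OF t]] has_vector_derivative_at_within)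
    then have "((\<lambda>s. V s c) has_vector_derivative - \<Gamma> c (snd c (x t)) (vel t c) (V t c)) (at t within {a..b})"
      by (rule has_vector_derivative_transform[OF t, rotated]) (simp add: V_def tvec_of_self[OF ct])
    then show "\<exists>c\<in>charts_at A (x t). ((\<lambda>s. V s c) has_vector_derivative - \<Gamma> c (snd c (x t)) (vel t c) (V t c)) (at t within {a..b})"
      using ct[OF t] by blast
  qed
  moreover have "V t1 = v" using tvec_of_component[OF v ct[OF t1]] by (simp add: V_def w(1))
  ultimately show ?thesis by blast
qed

lemma parallel_on_glue:
  assumes V: "parallel_on {a..b} V" and W: "parallel_on {b..c} W" and "a \<le> b" "b \<le> c" and eq: "V b = W b"
  shows "parallel_on {a..c} (\<lambda>t. if t \<in> {a..b} then V t else W t)"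
  unfolding parallel_on_def
proof (intro ballI conjI)
  fix t assume t: "t \<in> {a..c}"
  then show "(if t \<in> {a..b} then V t else W t) \<in> tangent_space A (x t)"
    using parallel_onD(1)[OF V, of t] parallel_onD(1)[OF W, of t] by auto
  fix d assume d: "d \<in> charts_at A (x t)"
  have u: "{a..b} \<union> {b..c} = {a..c}" "{a..b} \<inter> {b..c} = {b}" using assms by auto
  have tb: "t = b" if "t \<in> {a..b}" "t \<in> {b..c}" using that by auto
  have "((\<lambda>s. if s \<in> {a..b} then V s d else W s d) has_vector_derivative
     (if t \<in> {a..b} then - \<Gamma> d (snd d (x t)) (vel t d) (V t d) else - \<Gamma> d (snd d (x t)) (vel t d) (W t d))) (at t within {a..c})"
    by (rule has_vector_derivative_If_within_closures[where T = "{b..c}"])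
       (use parallel_onD(2)[OF V, of t d] parallel_onD(2)[OF W, of t d] d t u eq tb assms(3,4) in \<open>auto simp: insert_absorb\<close>)
  moreover have "(\<lambda>s. (if s \<in> {a..b} then V s else W s) d) = (\<lambda>s. if s \<in> {a..b} then V s d else W s d)" by auto
  ultimately show "((\<lambda>s. (if s \<in> {a..b} then V s else W s) d) has_vector_derivative
     - \<Gamma> d (snd d (x t)) (vel t d) ((if t \<in> {a..b} then V t else W t) d)) (at t within {a..c})"
    by (simp only: if_distrib[of "\<lambda>V. V d"] if_distrib[of "\<lambda>w. - \<Gamma> d (snd d (x t)) (vel t d) w"])
qed

text \<open>By bisection, since short pieces of the curve lie in one chart. The initial time \<open>t1\<close> is arbitrary in the interval,
  so that pieces can be glued on either side of it.\<close>

lemma parallel_transport_interval: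
  assumes "a \<le> b" "t1 \<in> {a..b}" "v \<in> tangent_space A (x t1)"
  shows "\<exists>V. parallel_on {a..b} V \<and> V t1 = v"
proof -
  have "\<forall>t1\<in>{a..b}. \<forall>v\<in>tangent_space A (x t1). \<exists>V. parallel_on {a..b} V \<and> V t1 = v"
    using assms(1)
  proof (induction rule: Bolzano)
    case (trans a b c)
    show ?case
    proof (intro ballI)
      fix t1 v assume t1: "t1 \<in> {a..c}" and v: "v \<in> tangent_space A (x t1)"
      show "\<exists>V. parallel_on {a..c} V \<and> V t1 = v"
      proof (cases "t1 \<in> {a..b}")
        case True
        then obtain V where V: "parallel_on {a..b} V" "V t1 = v" using trans v by blast
        obtain W where W: "parallel_on {b..c} W" "W b = V b"
          using trans parallel_onD(1)[OF V(1), of b] by fastforce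
        show ?thesis
          by (rule exI, rule conjI[OF parallel_on_glue[OF V(1) W(1) trans(3,4) W(2)[symmetric]]]) (use True V in auto)
      next
        case False
        then have t1': "t1 \<in> {b..c}" using t1 by auto
        then obtain W where W: "parallel_on {b..c} W" "W t1 = v" using trans v by blast
        obtain V where V: "parallel_on {a..b} V" "V b = W b"
          using trans parallel_onD(1)[OF W(1), of b] by fastforce
        show ?thesis
          by (rule exI, rule conjI[OF parallel_on_glue[OF V(1) W(1) trans(3,4) V(2)]]) (use False W in auto)
      qed
    qed
  next
    case (local t)
    obtain c where c: "c \<in> charts_at A (x t)" using ex_chart by blast
    have "open {s. x s \<in> fst c}" "t \<in> {s. x s \<in> fst c}" using chart_times_open charts_atD[OF c] by auto
    then obtain d where d: "d > 0" "\<And>s. \<bar>s - t\<bar> < d \<Longrightarrow> x s \<in> fst c"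
      unfolding open_dist dist_real_def by blast
    show ?case
    proof (intro exI[of _ d] conjI d allI impI ballI)
      fix a b t1 v assume ab: "a \<le> t \<and> t \<le> b \<and> b - a < d" and t1: "t1 \<in> {a..b}" and v: "v \<in> tangent_space A (x t1)"
      show "\<exists>V. parallel_on {a..b} V \<and> V t1 = v"
        by (rule parallel_transport_in_chart[OF _ _ charts_atD(1)[OF c] t1 v]) (use ab d(2) in auto)
    qed
  qed
  then show ?thesis using assms by blast
qed

text \<open>Transports over growing intervals agree where they overlap, because the norm of their difference is
  constant, and it vanishes at time \<open>0\<close>.\<close>

lemma parallel_transport:
  assumes v: "v \<in> tangent_space A (x 0)"
  shows "\<exists>V. parallel_on UNIV V \<and> V 0 = v"
proof -
  have "\<exists>V. parallel_on {- real N..real N} V \<and> V 0 = v" for N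
    using parallel_transport_interval[of "- real N" "real N" 0 v] v by simp
  then obtain V where V: "\<And>N. parallel_on {- real N..real N} (V N)" "\<And>N. V N 0 = v" by metis
  have eq: "V M t = V N t" if "\<bar>t\<bar> \<le> real M" "M \<le> N" for M N t
  proof -
    have "parallel_on {- real M..real M} (V N)" by (rule parallel_on_subset[OF V(1)]) (use that in auto)
    from parallel_unique[OF V(1) this, of 0 t] show ?thesis using that V(2) by (auto simp: abs_le_iff)
  qed
  define n where "n t = nat \<lceil>\<bar>t\<bar>\<rceil> + 1" for t :: real
  have n: "\<bar>t\<bar> < real (n t)" for t unfolding n_def by linarith
  define W where "W t = V (n t) t" for t
  have WV: "W s = V N s" if "\<bar>s\<bar> \<le> real N" for s N
    unfolding W_def
  proof (cases "n s \<le> N")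
    case True
    then show "V (n s) s = V N s" using n[of s] by (intro eq) auto
  next
    case False
    then show "V (n s) s = V N s" using that by (intro eq[symmetric]) auto
  qed
  have "parallel_on UNIV W"
    unfolding parallel_on_def
  proof (intro ballI conjI)
    fix t :: real
    let ?N = "n t"
    have t: "t \<in> {- real ?N..real ?N}" "t \<in> {- real ?N<..<real ?N}" using n[of t] by auto
    show "W t \<in> tangent_space A (x t)" unfolding W_def by (rule parallel_onD(1)[OF V(1) t(1)])
    fix c assume c: "c \<in> charts_at A (x t)"
    have "((\<lambda>s. V ?N s c) has_vector_derivative - \<Gamma> c (snd c (x t)) (vel t c) (W t c)) (at t)"
      using parallel_onD(2)[OF V(1) t(1) c] t(2) by (simp add: at_within_Icc_at W_def)
    then show "((\<lambda>s. W s c) has_vector_derivative - \<Gamma> c (snd c (x t)) (vel t c) (W t c)) (at t)"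
      by (rule has_vector_derivative_transform_within_open[OF _ _ t(2)]) (use WV[of _ ?N] in auto)
  qed
  moreover have "W 0 = v" by (simp add: W_def V)
  ultimately show ?thesis by blast
qed

theorem parallel_frame_exists: "\<exists>E. parallel_orthonormal_frame A g x E"
proof -
  obtain e :: "'n \<Rightarrow> ('a, 'n) tvec" where e: "\<And>i. e i \<in> tangent_space A (x 0)"
    "\<And>i j. g (x 0) (e i) (e j) = (if i = j then 1 else 0)"
    using orthonormal_basis_exists by blast
  obtain V where V: "\<And>i. parallel_on UNIV (V i)" "\<And>i. V i 0 = e i"
    using parallel_transport[OF e(1)] by metis
  have "parallel_orthonormal_frame A g x (\<lambda>t i. V i t)"
    unfolding parallel_orthonormal_frame_def
  proof (intro conjI allI)
    fix i
    show "differentiable_along A x (V i)"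
      unfolding differentiable_along_def
      using parallel_onD(1)[OF V(1) UNIV_I] differentiableI_vector[OF parallel_onD(2)[OF V(1) UNIV_I]] by blast
    fix t
    show "cov_deriv_along A g x (V i) t = (\<lambda>c. 0)"
      unfolding cov_deriv_along_def
      using vector_derivative_at[OF parallel_onD(2)[OF V(1) UNIV_I]] by (auto simp: fun_eq_iff)
    fix j
    show "g (x t) (V i t) (V j t) = (if i = j then 1 else 0)"
      using parallel_inner_constant[OF V(1) V(1) convex_UNIV UNIV_I UNIV_I, of t i j 0] by (simp add: V(2) e(2))
  qed
  then show ?thesis by blast
qed

end

section \<open>Complete length spaces are proper\<close>

context Metric_space
begin

lemma compactin_mcball_mono:
  assumes "compactin mtopology (mcball p r)" "r' \<le> r" shows "compactin mtopology (mcball p r')"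
  by (rule closed_compactin[OF assms(1)]) (use assms(2) mcball_subset_concentric in auto)

text \<open>Hopf-Rinow in the form of Cohn-Vossen. Let \<open>\<rho>\<close> be the supremum of the radii of compact balls around \<open>p\<close>. Every
  point of the ball of radius \<open>\<rho>\<close> is close to a slightly smaller ball, which is compact; hence that ball is totally
  bounded, and by completeness it is compact. Finitely many compact balls then cover a slightly
  larger ball, which contradicts the choice of \<open>\<rho>\<close>.\<close>

theorem complete_length_space_proper:
  assumes complete: mcomplete and p: "p \<in> M"
    and loc: "\<And>x. x \<in> M \<Longrightarrow> \<exists>r>0. compactin mtopology (mcball x r)"
    and length: "\<And>x y s e. x \<in> M \<Longrightarrow> y \<in> M \<Longrightarrow> 0 \<le> s \<Longrightarrow> s \<le> d x y \<Longrightarrow> e > 0 \<Longrightarrow>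
      \<exists>z\<in>M. d x z \<le> s \<and> d z y \<le> d x y - s + e"
  shows "compactin mtopology (mcball p r)"
proof (rule ccontr)
  assume r: "\<not> compactin mtopology (mcball p r)"
  have near: "\<exists>z\<in>M. d p z \<le> s \<and> d z y \<le> t + e" if h: "y \<in> M" "0 \<le> s" "d p y \<le> s + t" "0 \<le> t" "e > 0" for y s t e
  proof (cases "d p y \<le> s")
    case True
    then show ?thesis using h p by (intro bexI[of _ y]) auto
  next
    case False
    then obtain z where "z \<in> M" "d p z \<le> s" "d z y \<le> d p y - s + e"
      using length[OF p h(1,2) _ h(5)] by auto
    then show ?thesis using h(3) by (intro bexI[of _ z]) auto
  qed
  define S where "S = {s. compactin mtopology (mcball p s)}"
  define \<rho> where "\<rho> = Sup S"
  have bdd: "s < r" if "s \<in> S" for s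
    using that r compactin_mcball_mono[of p s r] unfolding S_def by (meson linorder_not_less mem_Collect_eq)
  then have bddS: "bdd_above S" by (meson bdd_aboveI less_imp_le)
  obtain r0 where r0: "r0 > 0" "r0 \<in> S" using loc[OF p] by (auto simp: S_def)
  have \<rho>: "\<rho> > 0" using cSup_upper[OF r0(2) bddS] r0(1) by (simp add: \<rho>_def)
  have below: "compactin mtopology (mcball p s)" if s: "s < \<rho>" for s
  proof -
    obtain s' where "s' \<in> S" "s < s'" using less_cSup_iff[OF _ bddS, of s] s r0(2) unfolding \<rho>_def by blast
    then show ?thesis using compactin_mcball_mono[of p s' s] by (simp add: S_def)
  qed
  have "mtotally_bounded (mcball p \<rho>)"
    unfolding mtotally_bounded_def
  proof (intro allI impI)
    fix \<epsilon> :: real assume \<epsilon>: "\<epsilon> > 0"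
    define s where "s = max 0 (\<rho> - \<epsilon> / 4)"
    have s: "s < \<rho>" "0 \<le> s" "\<rho> \<le> s + \<epsilon> / 4" using \<rho> \<epsilon> by (auto simp: s_def)
    have "mtotally_bounded (mcball p s)" by (rule compactin_imp_mtotally_bounded[OF below[OF s(1)]])
    then obtain K where K: "finite K" "K \<subseteq> mcball p s" "mcball p s \<subseteq> (\<Union>x\<in>K. mball x (\<epsilon> / 2))"
      using \<epsilon> unfolding mtotally_bounded_def by (meson half_gt_zero)
    show "\<exists>K. finite K \<and> K \<subseteq> mcball p \<rho> \<and> mcball p \<rho> \<subseteq> (\<Union>x\<in>K. mball x \<epsilon>)"
    proof (intro exI[of _ K] conjI subsetI)
      show "finite K" by (rule K(1))
      show "y \<in> mcball p \<rho>" if "y \<in> K" for y using that K(2) s(1) by auto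
      fix y assume "y \<in> mcball p \<rho>"
      then have y: "y \<in> M" "d p y \<le> s + \<epsilon> / 4" using s by auto
      obtain z where z: "z \<in> M" "d p z \<le> s" "d z y \<le> \<epsilon> / 4 + \<epsilon> / 8"
        using near[OF y(1) s(2) y(2), of "\<epsilon> / 8"] \<epsilon> by auto
      then obtain k where k: "k \<in> K" "z \<in> mball k (\<epsilon> / 2)" using K(3) p by force
      have "d k y \<le> d k z + d z y" using k z y by (intro triangle) auto
      then show "y \<in> (\<Union>x\<in>K. mball x \<epsilon>)" using k z y \<epsilon> by force
    qed
  qed
  then have C: "compactin mtopology (mcball p \<rho>)"
    using mtotally_bounded_eq_compact_closure_of[OF complete] closure_of_closedin[OF closedin_mcball] by metis
  obtain R where R: "\<And>x. x \<in> M \<Longrightarrow> R x > 0 \<and> compactin mtopology (mcball x (R x))" using loc by metis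
  let ?\<U> = "(\<lambda>x. mball x (R x / 2)) ` mcball p \<rho>"
  have "mcball p \<rho> \<subseteq> \<Union>?\<U>"
  proof
    fix x assume x: "x \<in> mcball p \<rho>"
    then have "x \<in> mball x (R x / 2)" using R[of x] by simp
    then show "x \<in> \<Union>?\<U>" using x by blast
  qed
  then obtain F where F: "finite F" "F \<subseteq> ?\<U>" "mcball p \<rho> \<subseteq> \<Union>F"
    using C[unfolded compactin_def, THEN conjunct2, rule_format, of ?\<U>] by auto
  obtain K where K: "K \<subseteq> mcball p \<rho>" "finite K" "F = (\<lambda>x. mball x (R x / 2)) ` K"
    using finite_subset_image[OF F(1,2)] by blast
  define \<delta> where "\<delta> = Min (insert 1 (R ` K)) / 4"
  have \<delta>: "\<delta> > 0" "\<And>x. x \<in> K \<Longrightarrow> \<delta> \<le> R x / 4"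
    using K R by (auto simp: \<delta>_def intro!: Min_le)
  have sub: "mcball p (\<rho> + \<delta>) \<subseteq> \<Union>((\<lambda>x. mcball x (R x)) ` K)"
  proof
    fix y assume "y \<in> mcball p (\<rho> + \<delta>)"
    then obtain z where z: "y \<in> M" "z \<in> M" "d p z \<le> \<rho>" "d z y \<le> \<delta> + \<delta>"
      using near[of y \<rho> \<delta> \<delta>] \<rho> \<delta>(1) by auto
    then obtain x where x: "x \<in> K" "z \<in> mball x (R x / 2)" using F(3) K(3) p by force
    have "d x y \<le> d x z + d z y" using x z by (intro triangle) auto
    also have "\<dots> \<le> R x" using x z \<delta>(2)[OF x(1)] by auto
    finally show "y \<in> \<Union>((\<lambda>x. mcball x (R x)) ` K)" using x z by auto
  qed
  have "compactin mtopology (\<Union>((\<lambda>x. mcball x (R x)) ` K))"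
    using K R by (intro compactin_Union) auto
  then have "compactin mtopology (mcball p (\<rho> + \<delta>))"
    by (rule closed_compactin[OF _ sub closedin_mcball])
  then have "\<rho> + \<delta> \<le> \<rho>" unfolding \<rho>_def by (intro cSup_upper bddS) (simp add: S_def)
  then show False using \<delta>(1) by simp
qed

end

context riemannian_manifold
begin

text \<open>The continuous function \<open>G c y h h\<close> is positive on the compact product of a ball and the unit sphere.\<close>

lemma chart_ball_comparison:
  assumes c: "c \<in> A" "y0 \<in> snd c ` fst c"
  shows "\<exists>r>0. \<exists>\<kappa>>0. \<exists>C>0. cball y0 r \<subseteq> snd c ` fst c \<and>
    (\<forall>y\<in>cball y0 r. \<forall>h. \<kappa> * norm h \<le> sqrt (G c y h h) \<and> sqrt (G c y h h) \<le> C * norm h)"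
proof -
  obtain r where r: "r > 0" "cball y0 r \<subseteq> snd c ` fst c"
    using chart_open(2)[OF c(1)] c(2) open_contains_cball by meson
  let ?K = "cball y0 r \<times> sphere (0::real^'n) 1"
  let ?f = "\<lambda>z. G c (fst z) (snd z) (snd z)"
  have K: "compact ?K" by (intro compact_Times compact_cball compact_sphere)
  have "axis undefined 1 \<in> sphere (0::real^'n) 1" by simp
  then have ne: "?K \<noteq> {}" using r(1) by (metis SigmaI centre_in_cball empty_iff less_imp_le)
  have cont: "continuous_on ?K ?f"
    by (rule smooth_bilinear_continuous_on[OF G_smooth[OF c(1)]]) (use r(2) in \<open>auto intro!: continuous_intros\<close>)
  obtain z1 where z1: "z1 \<in> ?K" "\<And>z. z \<in> ?K \<Longrightarrow> ?f z1 \<le> ?f z" using continuous_attains_inf[OF K ne cont] by blast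
  obtain z2 where z2: "z2 \<in> ?K" "\<And>z. z \<in> ?K \<Longrightarrow> ?f z \<le> ?f z2" using continuous_attains_sup[OF K ne cont] by blast
  have pos: "?f z > 0" if "z \<in> ?K" for z
    by (rule G_pos[OF c(1)]) (use that r(2) in auto)
  have "sqrt (?f z1) * norm h \<le> sqrt (G c y h h) \<and> sqrt (G c y h h) \<le> sqrt (?f z2) * norm h" if y: "y \<in> cball y0 r" for y h
  proof (cases "h = 0")
    case True
    then show ?thesis by (simp add: G_simps)
  next
    case False
    define u where "u = (1 / norm h) *\<^sub>R h"
    have h: "h = norm h *\<^sub>R u" and u: "(y, u) \<in> ?K" using False y by (auto simp: u_def)
    have "G c y h h = (norm h)\<^sup>2 * G c y u u" by (subst (1 2) h) (simp add: G_simps power2_eq_square)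
    then have "sqrt (G c y h h) = sqrt (G c y u u) * norm h" by (simp add: real_sqrt_mult mult.commute)
    moreover have "?f z1 \<le> G c y u u" "G c y u u \<le> ?f z2" using z1(2)[OF u] z2(2)[OF u] by auto
    ultimately show ?thesis by (auto intro!: mult_right_mono)
  qed
  then show ?thesis using r pos[OF z1(1)] pos[OF z2(1)]
    by (intro exI[of _ r] conjI exI[of _ "sqrt (?f z1)"] exI[of _ "sqrt (?f z2)"]) auto
qed

section \<open>Lengths of curves\<close>

abbreviation "I01 \<equiv> {0..1::real}"

lemma vector_derivative_01:
  fixes f :: "real \<Rightarrow> 'b::real_normed_vector"
  assumes "t \<in> I01" "(f has_vector_derivative f') (at t within I01)"
  shows "vector_derivative f (at t within I01) = f'"
  using vector_derivative_within_cbox[of 0 1 t f f'] assms by simp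

definition speed :: "(real \<Rightarrow> 'a) \<Rightarrow> real \<Rightarrow> real" where
  "speed x t = tnorm g (x t) (velocity A I01 x t)"

lemma C1_continuous: "C1_curve A x \<Longrightarrow> continuous_on I01 x"
  by (simp add: C1_curve_def differentiable_curve_def)

lemma C1_has_derivative:
  "C1_curve A x \<Longrightarrow> t \<in> I01 \<Longrightarrow> c \<in> charts_at A (x t) \<Longrightarrow>
    ((\<lambda>s. snd c (x s)) has_vector_derivative velocity A I01 x t c) (at t within I01)"
  unfolding C1_curve_def differentiable_curve_def velocity_def by (simp add: vector_derivative_works)

lemma C1_velocity_continuous:
  "C1_curve A x \<Longrightarrow> t \<in> I01 \<Longrightarrow> c \<in> charts_at A (x t) \<Longrightarrow>
    continuous (at t within I01) (\<lambda>s. velocity A I01 x s c)"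
  unfolding C1_curve_def by blast

lemma C1_eventually_chart:
  assumes "continuous_on I01 x" "t \<in> I01" "c \<in> charts_at A (x t)"
  shows "\<forall>\<^sub>F s in at t within I01. c \<in> charts_at A (x s)"
proof -
  have "(x \<longlongrightarrow> x t) (at t within I01)" using assms by (simp add: continuous_on_def)
  then have "\<forall>\<^sub>F s in at t within I01. x s \<in> fst c"
    using topological_tendstoD chart_open(1) charts_atD assms(3) by metis
  then show ?thesis by eventually_elim (use assms(3) in \<open>auto simp: charts_at_def\<close>)
qed

lemma velocity_tangent:
  assumes "differentiable_curve A I01 x" and t: "t \<in> I01"
  shows "velocity A I01 x t \<in> tangent_space A (x t)"
proof -
  have xc: "continuous_on I01 x" using assms(1) by (simp add: differentiable_curve_def)
  have d: "((\<lambda>s. snd c (x s)) has_vector_derivative velocity A I01 x t c) (at t within I01)" if "c \<in> charts_at A (x t)" for c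
    using assms that unfolding differentiable_curve_def velocity_def by (simp add: vector_derivative_works)
  obtain c where c: "c \<in> charts_at A (x t)" using ex_chart by blast
  show ?thesis
  proof (rule tangent_spaceI[OF c])
    fix c' assume c': "c' \<in> charts_at A (x t)"
    have tr: "(transition c c' has_derivative dd (transition c c') (snd c (x t))) (at (snd c (x t)))"
      using transition_has_derivative overlap_at[OF c c'] charts_atD c c' by blast
    have d1: "((\<lambda>s. transition c c' (snd c (x s))) has_derivative
       (\<lambda>r. dd (transition c c') (snd c (x t)) (r *\<^sub>R velocity A I01 x t c))) (at t within I01)"
      by (rule has_derivative_compose[OF d[OF c, unfolded has_vector_derivative_def] tr])
    have d2: "((\<lambda>s. snd c' (x s)) has_derivative
       (\<lambda>r. dd (transition c c') (snd c (x t)) (r *\<^sub>R velocity A I01 x t c))) (at t within I01)"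
    proof (rule has_derivative_transform_eventually[OF d1 _ _ t])
      show "\<forall>\<^sub>F s in at t within I01. transition c c' (snd c (x s)) = snd c' (x s)"
        using C1_eventually_chart[OF xc t c] by eventually_elim (rule transition_chart, auto simp: charts_at_def)
      show "transition c c' (snd c (x t)) = snd c' (x t)" using c by (intro transition_chart) (auto simp: charts_at_def)
    qed
    have lin: "linear (dd (transition c c') (snd c (x t)))" by (rule has_derivative_linear[OF tr])
    have "((\<lambda>s. snd c' (x s)) has_vector_derivative dd (transition c c') (snd c (x t)) (velocity A I01 x t c)) (at t within I01)"
      using d2 by (simp add: has_vector_derivative_def linear_scale[OF lin])
    then show "velocity A I01 x t c' = dd (transition c c') (snd c (x t)) (velocity A I01 x t c)"
      using vector_derivative_01[OF t d[OF c']] vector_derivative_01[OF t] by metis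
  qed (simp add: velocity_def)
qed

lemma C1_tangent: "C1_curve A x \<Longrightarrow> t \<in> I01 \<Longrightarrow> velocity A I01 x t \<in> tangent_space A (x t)"
  by (rule velocity_tangent) (simp_all add: C1_curve_def)

lemma speed_coord:
  "C1_curve A x \<Longrightarrow> t \<in> I01 \<Longrightarrow> c \<in> charts_at A (x t) \<Longrightarrow>
    speed x t = sqrt (G c (snd c (x t)) (velocity A I01 x t c) (velocity A I01 x t c))"
  by (simp add: speed_def tnorm_def metric_coord[OF C1_tangent C1_tangent])

lemma metric_nonneg: "u \<in> tangent_space A p \<Longrightarrow> g p u u \<ge> 0"
  using metric_pos[of u p] metric_linear[of u p u u 0 0] by (cases "u = (\<lambda>c. 0)") (auto simp: less_imp_le)

lemma speed_nonneg: "C1_curve A x \<Longrightarrow> t \<in> I01 \<Longrightarrow> speed x t \<ge> 0"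
  by (simp add: speed_def tnorm_def metric_nonneg C1_tangent)

lemma speed_continuous: assumes x: "C1_curve A x" shows "continuous_on I01 (speed x)"
  unfolding continuous_on_eq_continuous_within
proof
  fix t assume t: "t \<in> I01"
  obtain c where c: "c \<in> charts_at A (x t)" using ex_chart by blast
  note cA = charts_atD(1)[OF c]
  obtain T where T: "open T" "T \<inter> I01 = x -` fst c \<inter> I01"
    using C1_continuous[OF x] chart_open(1)[OF cA] unfolding continuous_on_open_invariant by metis
  define N where "N = T \<inter> I01"
  have N: "c \<in> charts_at A (x s)" "s \<in> I01" if "s \<in> N" for s
    using that T(2) unfolding N_def by (blast intro: charts_atI cA)+
  have tN: "t \<in> N" "t \<in> T" using T(2) t charts_atD(2)[OF c] unfolding N_def by blast+
  have "continuous_on N (\<lambda>s. velocity A I01 x s c)"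
    unfolding continuous_on_eq_continuous_within
  proof
    fix s assume s: "s \<in> N"
    show "continuous (at s within N) (\<lambda>s. velocity A I01 x s c)"
      by (rule continuous_within_subset[OF C1_velocity_continuous[OF x N(2,1)[OF s]]]) (simp add: N_def)
  qed
  moreover have "continuous_on N (\<lambda>s. snd c (x s))"
    by (rule continuous_on_compose2[OF chart_continuous[OF cA] continuous_on_subset[OF C1_continuous[OF x]]])
       (use charts_atD(2)[OF N(1)] in \<open>auto simp: N_def\<close>)
  ultimately have "continuous_on N (\<lambda>s. sqrt (G c (snd c (x s)) (velocity A I01 x s c) (velocity A I01 x s c)))"
    by (intro continuous_intros smooth_bilinear_continuous_on[OF G_smooth[OF cA]]) (use charts_atD(3)[OF N(1)] in auto)
  then have "continuous_on N (speed x)"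
    by (rule continuous_on_eq) (use speed_coord[OF x N(2) N(1)] in auto)
  then have "continuous (at t within N) (speed x)" using tN by (simp add: continuous_on_eq_continuous_within)
  moreover have "at t within N = at t within I01"
    by (rule at_within_nhd[OF tN(2) T(1)]) (auto simp: N_def)
  ultimately show "continuous (at t within I01) (speed x)" by simp
qed

definition arclength :: "(real \<Rightarrow> 'a) \<Rightarrow> real \<Rightarrow> real" where
  "arclength x u = integral {0..u} (speed x)"

lemma joined_by_arclength: "C1_curve A x \<Longrightarrow> joined_by A g (x 0) (x 1) (arclength x 1)"
  unfolding arclength_def speed_def by (rule joined_by.piece)

lemma arclength_has_derivative:
  "C1_curve A x \<Longrightarrow> t \<in> I01 \<Longrightarrow> (arclength x has_vector_derivative speed x t) (at t within I01)"
  unfolding arclength_def using integral_has_vector_derivative[OF speed_continuous] by blast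

lemma arclength_mono:
  assumes "C1_curve A x" "0 \<le> s" "s \<le> t" "t \<le> 1" shows "arclength x s \<le> arclength x t"
  unfolding arclength_def
  by (rule integral_subset_le)
     (use assms speed_nonneg in \<open>auto intro!: integrable_continuous_real continuous_on_subset[OF speed_continuous]\<close>)

lemma arclength_zero: "arclength x 0 = 0" by (simp add: arclength_def)

lemma affine_has_vector_derivative: "((\<lambda>t. a + k * t) has_vector_derivative (k::real)) (at t within X)"
  unfolding has_real_derivative_iff_has_vector_derivative[symmetric] by (auto intro!: derivative_eq_intros)

lemma C1_affine:
  assumes x: "C1_curve A x" and \<sigma>: "\<And>t. t \<in> I01 \<Longrightarrow> a + k * t \<in> I01"
  shows "C1_curve A (\<lambda>t. x (a + k * t))"
    and "t \<in> I01 \<Longrightarrow> velocity A I01 (\<lambda>t. x (a + k * t)) t = (\<lambda>c. k *\<^sub>R velocity A I01 x (a + k * t) c)"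
proof -
  let ?\<sigma> = "\<lambda>t. a + k * t"
  have img: "?\<sigma> ` I01 \<subseteq> I01" by (rule image_subsetI) (rule \<sigma>)
  have xc: "continuous_on I01 (\<lambda>t. x (?\<sigma> t))"
    by (rule continuous_on_compose2[OF C1_continuous[OF x] _ img]) (intro continuous_intros)
  have \<sigma>d: "(?\<sigma> has_vector_derivative k) (at t within I01)" for t
    by (rule affine_has_vector_derivative)
  have d: "((\<lambda>t. snd c (x (?\<sigma> t))) has_vector_derivative k *\<^sub>R velocity A I01 x (?\<sigma> t) c) (at t within I01)"
    if "t \<in> I01" "c \<in> charts_at A (x (?\<sigma> t))" for t c
  proof -
    have "((\<lambda>s. snd c (x s)) has_vector_derivative velocity A I01 x (?\<sigma> t) c) (at (?\<sigma> t) within ?\<sigma> ` I01)"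
      using C1_has_derivative[OF x \<sigma>[OF that(1)] that(2)] by (rule has_vector_derivative_within_subset[OF _ img])
    from vector_diff_chain_within[OF \<sigma>d this] show ?thesis by (simp add: o_def)
  qed
  show vel: "velocity A I01 (\<lambda>t. x (?\<sigma> t)) t = (\<lambda>c. k *\<^sub>R velocity A I01 x (?\<sigma> t) c)" if "t \<in> I01" for t
  proof
    fix c show "velocity A I01 (\<lambda>t. x (?\<sigma> t)) t c = k *\<^sub>R velocity A I01 x (?\<sigma> t) c"
    proof (cases "c \<in> charts_at A (x (?\<sigma> t))")
      case True
      then show ?thesis using vector_derivative_01[OF that d[OF that True]] by (simp add: velocity_def)
    qed (simp add: velocity_def)
  qed
  have vc: "continuous (at t within I01) (\<lambda>s. velocity A I01 (\<lambda>t. x (?\<sigma> t)) s c)"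
    if t: "t \<in> I01" and c: "c \<in> charts_at A (x (?\<sigma> t))" for t c
  proof -
    have "continuous (at (?\<sigma> t) within ?\<sigma> ` I01) (\<lambda>s. velocity A I01 x s c)"
      by (rule continuous_within_subset[OF C1_velocity_continuous[OF x \<sigma>[OF t] c] img])
    moreover have "continuous (at t within I01) ?\<sigma>" by (intro continuous_intros)
    ultimately have "continuous (at t within I01) (\<lambda>s. velocity A I01 x (?\<sigma> s) c)"
      by (rule continuous_within_compose2[rotated])
    then have "continuous (at t within I01) (\<lambda>s. k *\<^sub>R velocity A I01 x (?\<sigma> s) c)" by (intro continuous_intros)
    then show ?thesis
      by (rule continuous_transform_within[OF _ zero_less_one t]) (simp add: vel)
  qed
  show "C1_curve A (\<lambda>t. x (?\<sigma> t))"
    unfolding C1_curve_def differentiable_curve_def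
    by (intro conjI ballI xc differentiableI_vector[OF d] vc)
qed

text \<open>The curve between the parameters \<open>a\<close> and \<open>b\<close>, in either order, reparametrised affinely over the unit
  interval. It provides the reversal of a curve as well as its restrictions.\<close>

lemma subcurve_joined:
  assumes x: "C1_curve A x" and ab: "a \<in> I01" "b \<in> I01"
  shows "joined_by A g (x a) (x b) \<bar>arclength x b - arclength x a\<bar>"
proof -
  define k where "k = b - a"
  have \<sigma>: "a + k * t \<in> I01" if "t \<in> I01" for t
  proof -
    have "a + k * t = (1 - t) *\<^sub>R a + t *\<^sub>R b" by (simp add: k_def algebra_simps)
    also have "\<dots> \<in> I01" using convexD_alt[OF convex_real_interval(5)[of 0 1] ab, of t] that by simp
    finally show ?thesis .
  qed
  let ?z = "\<lambda>t. x (a + k * t)"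
  have z: "C1_curve A ?z" "\<And>t. t \<in> I01 \<Longrightarrow> velocity A I01 ?z t = (\<lambda>c. k *\<^sub>R velocity A I01 x (a + k * t) c)"
    by (rule C1_affine(1)[OF x], use \<sigma> in blast) (rule C1_affine(2)[OF x], use \<sigma> in blast)
  have sp: "speed ?z t = \<bar>k\<bar> * speed x (a + k * t)" if t: "t \<in> I01" for t
  proof -
    note T = C1_tangent[OF x \<sigma>[OF t]]
    obtain c where c: "c \<in> charts_at A (x (a + k * t))" using ex_chart by blast
    have "g (x (a + k * t)) (\<lambda>c. k *\<^sub>R velocity A I01 x (a + k * t) c) (\<lambda>c. k *\<^sub>R velocity A I01 x (a + k * t) c)
      = k\<^sup>2 * g (x (a + k * t)) (velocity A I01 x (a + k * t)) (velocity A I01 x (a + k * t))"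
      by (simp add: metric_coord[OF tangent_scaleR[OF T] tangent_scaleR[OF T] c] metric_coord[OF T T c] G_simps power2_eq_square)
    then show ?thesis unfolding speed_def tnorm_def z(2)[OF t] by (simp add: real_sqrt_mult)
  qed
  have "((\<lambda>t. k * speed x (a + k * t)) has_integral arclength x (a + k * 1) - arclength x (a + k * 0)) I01"
  proof (rule fundamental_theorem_of_calculus)
    fix t assume t: "t \<in> I01"
    have "(arclength x has_vector_derivative speed x (a + k * t)) (at (a + k * t) within (\<lambda>t. a + k * t) ` I01)"
      using arclength_has_derivative[OF x \<sigma>[OF t]]
      by (rule has_vector_derivative_within_subset) (rule image_subsetI, rule \<sigma>)
    from vector_diff_chain_within[OF affine_has_vector_derivative this]
    show "((\<lambda>t. arclength x (a + k * t)) has_vector_derivative k * speed x (a + k * t)) (at t within I01)"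
      by (simp add: o_def)
  qed simp
  then have 1: "((\<lambda>t. k * speed x (a + k * t)) has_integral arclength x b - arclength x a) I01" by (simp add: k_def)
  have "((\<lambda>t. \<bar>k\<bar> * speed x (a + k * t)) has_integral \<bar>arclength x b - arclength x a\<bar>) I01"
  proof (cases "k \<ge> 0")
    case True
    then have "arclength x a \<le> arclength x b" using arclength_mono[OF x, of a b] ab by (simp add: k_def)
    then show ?thesis using 1 True by simp
  next
    case False
    then have "arclength x b \<le> arclength x a" using arclength_mono[OF x, of b a] ab by (simp add: k_def)
    then show ?thesis using has_integral_neg[OF 1] False by simp
  qed
  then have "(speed ?z has_integral \<bar>arclength x b - arclength x a\<bar>) I01"
    by (rule has_integral_eq[rotated]) (simp add: sp)
  then have "arclength ?z 1 = \<bar>arclength x b - arclength x a\<bar>" unfolding arclength_def by (rule integral_unique)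
  then show ?thesis using joined_by_arclength[OF z(1)] by (simp add: k_def)
qed

lemma joined_by_nonneg: "joined_by A g p q L \<Longrightarrow> L \<ge> 0"
proof (induction rule: joined_by.induct)
  case (piece x)
  then show ?case using arclength_mono[OF piece, of 0 1] by (simp add: arclength_def speed_def[abs_def])
qed auto

lemma joined_by_sym: "joined_by A g p q L \<Longrightarrow> joined_by A g q p L"
proof (induction rule: joined_by.induct)
  case (piece x)
  then show ?case using subcurve_joined[OF piece, of 1 0] arclength_mono[OF piece, of 0 1]
    by (simp add: arclength_def speed_def[abs_def])
next
  case (concat p q L r L')
  then show ?case using joined_by.concat by (metis add.commute)
qed

text \<open>Curves can be cut at any prescribed length, by the intermediate value theorem for the arc length. This is what
  makes the Riemannian distance a length metric.\<close>

lemma joined_by_split: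
  "joined_by A g p q L \<Longrightarrow> 0 \<le> s \<Longrightarrow> s \<le> L \<Longrightarrow> \<exists>z. joined_by A g p z s \<and> joined_by A g z q (L - s)"
proof (induction arbitrary: s rule: joined_by.induct)
  case (piece x)
  have L: "integral I01 (\<lambda>t. tnorm g (x t) (velocity A I01 x t)) = arclength x 1"
    by (simp add: arclength_def speed_def[abs_def])
  have "continuous_on I01 (arclength x)"
    by (rule continuous_on_vector_derivative) (rule arclength_has_derivative[OF piece(1)])
  then obtain u where u: "u \<in> I01" "arclength x u = s"
    using IVT'[of "arclength x" 0 s 1] piece(2,3) L by (auto simp: arclength_zero)
  show ?case
    using subcurve_joined[OF piece(1), of 0 u] subcurve_joined[OF piece(1), of u 1] u piece(2,3) L
    by (intro exI[of _ "x u"]) (simp add: arclength_zero)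
next
  case (concat p q L r L')
  show ?case
  proof (cases "s \<le> L")
    case True
    then obtain z where "joined_by A g p z s" "joined_by A g z q (L - s)" using concat by blast
    then show ?thesis using joined_by.concat[OF _ concat(2), of z "L - s"] by (auto simp: algebra_simps)
  next
    case False
    then obtain z where "joined_by A g q z (s - L)" "joined_by A g z r (L' - (s - L))"
      using concat(4)[of "s - L"] concat.prems by auto
    then show ?thesis using joined_by.concat[OF concat(1), of z "s - L"] by (intro exI[of _ z]) (auto simp: algebra_simps)
  qed
qed

end

context riemannian_manifold
begin

text \<open>The image of a straight segment is short: distances in the chart dominate the Riemannian distance.\<close>

lemma chart_segment_joined:
  assumes c: "c \<in> A" and B: "cball y0 r \<subseteq> snd c ` fst c" "y1 \<in> cball y0 r" "y2 \<in> cball y0 r"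
    and C: "\<And>y h. y \<in> cball y0 r \<Longrightarrow> sqrt (G c y h h) \<le> C * norm h"
  shows "\<exists>L. joined_by A g (chart_inv c y1) (chart_inv c y2) L \<and> L \<le> C * dist y1 y2"
proof -
  define w where "w = y2 - y1"
  define l where "l t = y1 + t *\<^sub>R w" for t
  define x where "x t = chart_inv c (l t)" for t
  have l: "l t \<in> cball y0 r" if "t \<in> I01" for t
  proof -
    have "l t = (1 - t) *\<^sub>R y1 + t *\<^sub>R y2" by (simp add: l_def w_def algebra_simps)
    then show ?thesis using convexD_alt[OF convex_cball B(2,3)] that by simp
  qed
  have lS: "l t \<in> snd c ` fst c" if "t \<in> I01" for t using l[OF that] B(1) by blast
  have lcU: "continuous_on UNIV l" and lc: "continuous_on I01 l"
    unfolding l_def[abs_def] by (intro continuous_intros)+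
  have ld: "(l has_derivative (\<lambda>r. r *\<^sub>R w)) (at t within X)" for t X
    unfolding l_def[abs_def] by (auto intro!: derivative_eq_intros)
  have xc: "continuous_on I01 x"
    unfolding x_def[abs_def] by (rule continuous_on_compose2[OF chart_inv_continuous[OF c] lc]) (use lS in blast)
  have cx: "c \<in> charts_at A (x t)" "snd c (x t) = l t" if "t \<in> I01" for t
    using lS[OF that] by (simp_all add: x_def chart_chart_inv[OF c] charts_atI[OF c chart_inv_in[OF c]])
  have d: "((\<lambda>s. snd c' (x s)) has_vector_derivative dd (transition c c') (l t) w) (at t within I01)"
    if t: "t \<in> I01" and c': "c' \<in> charts_at A (x t)" for t c'
  proof -
    have lo: "l t \<in> overlap c c'" using overlap_at[OF cx(1)[OF t] c'] cx(2)[OF t] by simp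
    have tr: "(transition c c' has_derivative dd (transition c c') (l t)) (at (l t))"
      by (rule transition_has_derivative[OF c charts_atD(1)[OF c'] lo])
    have "((\<lambda>s. transition c c' (l s)) has_derivative (\<lambda>r. dd (transition c c') (l t) (r *\<^sub>R w))) (at t within I01)"
      by (rule has_derivative_compose[OF ld tr])
    moreover have "transition c c' (l s) = snd c' (x s)" for s by (simp add: transition_def x_def)
    ultimately show ?thesis
      by (simp add: has_vector_derivative_def linear_scale[OF has_derivative_linear[OF tr]])
  qed
  have vel: "velocity A I01 x t c' = dd (transition c c') (l t) w" if "t \<in> I01" "c' \<in> charts_at A (x t)" for t c'
    using vector_derivative_01[OF that(1) d[OF that]] that(2) by (simp add: velocity_def)
  have "continuous (at t within I01) (\<lambda>s. velocity A I01 x s c')"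
    if t: "t \<in> I01" and c': "c' \<in> charts_at A (x t)" for t c'
  proof -
    note c'A = charts_atD(1)[OF c']
    define T where "T = l -` overlap c c'"
    have T: "open T" unfolding T_def by (rule open_vimage[OF overlap_open[OF c c'A] lcU])
    have tT: "t \<in> T" using overlap_at[OF cx(1)[OF t] c'] unfolding T_def cx(2)[OF t] by simp
    have N: "l s \<in> overlap c c'" "s \<in> I01" if "s \<in> T \<inter> I01" for s using that by (simp_all add: T_def)
    have N2: "c' \<in> charts_at A (x s)" if "s \<in> T \<inter> I01" for s
      using N(1)[OF that] overlap_iff[OF c] charts_atI[OF c'A] by (simp add: x_def)
    have "continuous_on (T \<inter> I01) (\<lambda>s. dd (transition c c') (l s) w)"
      by (rule continuous_on_dd[OF transition_smooth[OF c c'A] overlap_open[OF c c'A] _ continuous_on_const])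
         (rule continuous_on_subset[OF lc], simp, rule N(1))
    then have "continuous_on (T \<inter> I01) (\<lambda>s. velocity A I01 x s c')"
      by (rule continuous_on_eq) (rule vel[OF N(2) N2, symmetric])
    then have "continuous (at t within T \<inter> I01) (\<lambda>s. velocity A I01 x s c')"
      using t tT by (simp add: continuous_on_eq_continuous_within)
    moreover have "at t within T \<inter> I01 = at t within I01"
      by (rule at_within_nhd[OF tT T]) auto
    ultimately show ?thesis by simp
  qed
  then have C1: "C1_curve A x"
    unfolding C1_curve_def differentiable_curve_def
    by (intro conjI ballI xc differentiableI_vector[OF d]) blast+
  have sp: "speed x t \<le> C * norm w" if t: "t \<in> I01" for t
  proof -
    have "speed x t = sqrt (G c (l t) w w)"
      using speed_coord[OF C1 t cx(1)[OF t]] vel[OF t cx(1)[OF t]] jacobian_id[OF c lS[OF t]] cx(2)[OF t] by simp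
    then show ?thesis using C[OF l[OF t]] by simp
  qed
  have "arclength x 1 \<le> integral I01 (\<lambda>t. C * norm w)"
    unfolding arclength_def by (rule integral_le[OF integrable_continuous_real[OF speed_continuous[OF C1]]]) (use sp in auto)
  then have "arclength x 1 \<le> C * dist y1 y2" by (simp add: w_def dist_norm norm_minus_commute)
  then show ?thesis using joined_by_arclength[OF C1] by (auto simp: x_def l_def w_def)
qed

lemma chart_ball_iff:
  assumes c: "c \<in> A" and B: "ball y0 r \<subseteq> snd c ` fst c"
  shows "q \<in> chart_inv c ` ball y0 r \<longleftrightarrow> q \<in> fst c \<and> dist y0 (snd c q) < r"
proof
  assume "q \<in> chart_inv c ` ball y0 r"
  then obtain y where y: "y \<in> ball y0 r" "q = chart_inv c y" by blast
  then have "y \<in> snd c ` fst c" using B by blast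
  from chart_inv_in[OF c this] chart_chart_inv[OF c this] y
  show "q \<in> fst c \<and> dist y0 (snd c q) < r" by simp
next
  assume q: "q \<in> fst c \<and> dist y0 (snd c q) < r"
  then show "q \<in> chart_inv c ` ball y0 r" using chart_inv_inv[OF c, of q] by (metis image_eqI mem_ball)
qed

lemma chart_ball_open:
  assumes c: "c \<in> A" and B: "ball y0 r \<subseteq> snd c ` fst c"
  shows "open (chart_inv c ` ball y0 r)"
proof -
  have "chart_inv c ` ball y0 r = fst c \<inter> snd c -` ball y0 r"
    by (rule set_eqI) (simp only: chart_ball_iff[OF c B] Int_iff vimage_eq mem_ball)
  then show ?thesis
    using continuous_open_preimage[OF chart_continuous[OF c] chart_open(1)[OF c] open_ball] by simp
qed

text \<open>A short curve does not leave the chart ball, and its length dominates the distance of its end points in the chart.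
  At the first exit time the curve would still lie in a smaller compact ball, which is impossible.\<close>

lemma joined_by_stays_in_chart:
  assumes j: "joined_by A g p q L" and c: "c \<in> A" and B: "cball y0 r \<subseteq> snd c ` fst c" and \<kappa>: "\<kappa> > 0"
    and G: "\<And>y h. y \<in> cball y0 r \<Longrightarrow> \<kappa> * norm h \<le> sqrt (G c y h h)"
    and p: "p \<in> fst c" "dist y0 (snd c p) + L / \<kappa> < r"
  shows "q \<in> fst c \<and> dist (snd c p) (snd c q) \<le> L / \<kappa>"
  using j p
proof (induction rule: joined_by.induct)
  case (concat p q L r' L')
  have LL: "L \<ge> 0" "L' \<ge> 0" using concat(1,2) joined_by_nonneg by auto
  have "dist y0 (snd c p) + L / \<kappa> < r"
    using concat.prems(2) LL \<kappa> by (simp add: add_divide_distrib) (smt (verit) divide_nonneg_pos)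
  then have 1: "q \<in> fst c" "dist (snd c p) (snd c q) \<le> L / \<kappa>" using concat(3)[OF concat.prems(1)] by auto
  have "dist y0 (snd c q) + L' / \<kappa> < r"
    using 1 concat.prems(2) dist_triangle[of y0 "snd c q" "snd c p"] by (simp add: add_divide_distrib)
  then have 2: "r' \<in> fst c" "dist (snd c q) (snd c r') \<le> L' / \<kappa>" using concat(4)[OF 1(1)] by auto
  then show ?case
    using 1 dist_triangle[of "snd c p" "snd c r'" "snd c q"] by (simp add: add_divide_distrib)
next
  case (piece x)
  define F where "F t = arclength x t / \<kappa>" for t
  have L: "integral I01 (\<lambda>t. tnorm g (x t) (velocity A I01 x t)) / \<kappa> = F 1"
    by (simp add: arclength_def speed_def[abs_def] F_def)
  define \<rho> where "\<rho> = dist y0 (snd c (x 0)) + F 1"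
  have \<rho>: "\<rho> < r" using piece.prems(2) L by (simp add: \<rho>_def)
  have xc: "continuous_on I01 x" by (rule C1_continuous[OF piece(1)])
  have ballS: "ball y0 r \<subseteq> snd c ` fst c" using B by auto
  define Bp where "Bp = chart_inv c ` ball y0 r"
  have Bp_iff: "q \<in> Bp \<longleftrightarrow> q \<in> fst c \<and> dist y0 (snd c q) < r" for q
    unfolding Bp_def by (rule chart_ball_iff[OF c ballS])
  have Bp: "open Bp" unfolding Bp_def by (rule chart_ball_open[OF c ballS])
  define K where "K = chart_inv c ` cball y0 \<rho>"
  have "cball y0 \<rho> \<subseteq> ball y0 r" using \<rho> by auto
  then have KB: "cball y0 \<rho> \<subseteq> snd c ` fst c" "K \<subseteq> Bp"
    using ballS unfolding K_def Bp_def by (blast, blast)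
  have "compact K" unfolding K_def
    by (intro compact_continuous_image continuous_on_subset[OF chart_inv_continuous[OF c] KB(1)] compact_cball)
  then have K: "closed K" by (rule compact_imp_closed)
  have est: "dist (snd c (x 0)) (snd c (x t)) \<le> F t" if t: "t \<in> I01" "\<And>s. 0 \<le> s \<Longrightarrow> s < t \<Longrightarrow> x s \<in> Bp" "x t \<in> Bp" for t
  proof (cases "t = 0")
    case True
    then show ?thesis by (simp add: F_def arclength_zero)
  next
    case False
    then have t0: "0 < t" using t(1) by auto
    have inB: "x s \<in> Bp" if "s \<in> {0..t}" for s using t that by (cases "s = t") auto
    have cs: "c \<in> charts_at A (x s)" "s \<in> I01" if "s \<in> {0..t}" for s
      using inB[OF that] that t(1) Bp_iff charts_atI[OF c] by auto
    have "norm (snd c (x t) - snd c (x 0)) \<le> F t - F 0"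
    proof (rule differentiable_bound_general[OF t0])
      show "continuous_on {0..t} (\<lambda>s. snd c (x s))"
        by (rule continuous_on_compose2[OF chart_continuous[OF c] continuous_on_subset[OF xc]])
           (use cs charts_atD(2)[OF cs(1)] in auto)
      have "continuous_on I01 (arclength x)"
        by (rule continuous_on_vector_derivative) (rule arclength_has_derivative[OF piece(1)])
      then show "continuous_on {0..t} F"
        unfolding F_def[abs_def] using t(1) \<kappa> by (intro continuous_intros) (auto elim: continuous_on_subset)
      fix s assume s: "0 < s" "s < t"
      then have s': "s \<in> {0..t}" "s \<in> I01" "s \<in> {0<..<1}" using t(1) by auto
      have at: "at s within I01 = at s" using s'(3) by (simp add: at_within_Icc_at)
      show "((\<lambda>s. snd c (x s)) has_vector_derivative velocity A I01 x s c) (at s)"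
        using C1_has_derivative[OF piece(1) s'(2) cs(1)[OF s'(1)]] at by simp
      have "(arclength x has_real_derivative speed x s) (at s)"
        using arclength_has_derivative[OF piece(1) s'(2)] at by (simp add: has_real_derivative_iff_has_vector_derivative)
      then have "(F has_real_derivative speed x s / \<kappa>) (at s)"
        unfolding F_def[abs_def] by (rule DERIV_cdivide)
      then show "(F has_vector_derivative speed x s / \<kappa>) (at s)"
        by (simp add: has_real_derivative_iff_has_vector_derivative)
      have "snd c (x s) \<in> cball y0 r" using inB[OF s'(1)] Bp_iff by auto
      then have "\<kappa> * norm (velocity A I01 x s c) \<le> speed x s"
        using G speed_coord[OF piece(1) s'(2) cs(1)[OF s'(1)]] by simp
      then show "norm (velocity A I01 x s c) \<le> speed x s / \<kappa>" using \<kappa> by (simp add: field_simps)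
    qed
    then show ?thesis by (simp add: F_def arclength_zero dist_norm norm_minus_commute)
  qed
  have F_mono: "F s \<le> F t" if "0 \<le> s" "s \<le> t" "t \<le> 1" for s t
    using arclength_mono[OF piece(1) that] \<kappa> by (simp add: F_def divide_right_mono)
  have inK: "x t \<in> K" if t: "t \<in> I01" "\<And>s. 0 \<le> s \<Longrightarrow> s < t \<Longrightarrow> x s \<in> Bp" "x t \<in> Bp" for t
  proof -
    have "dist y0 (snd c (x t)) \<le> \<rho>"
      using est[OF t] F_mono[of t 1] t(1) dist_triangle[of y0 "snd c (x t)" "snd c (x 0)"] unfolding \<rho>_def by simp
    then show ?thesis
      unfolding K_def using chart_inv_inv[OF c, of "x t"] t(3) Bp_iff by (metis image_eqI mem_cball)
  qed
  have F1: "F 1 \<ge> 0" using F_mono[of 0 1] by (simp add: F_def arclength_zero)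
  have x0: "x 0 \<in> Bp" using piece.prems \<rho> F1 Bp_iff by (simp add: \<rho>_def)
  have all: "x t \<in> Bp" if "t \<in> I01" for t
  proof (rule ccontr)
    assume nt: "x t \<notin> Bp"
    define E where "E = I01 \<inter> x -` (- Bp)"
    have "closed E" unfolding E_def
      by (rule continuous_closed_preimage[OF xc]) (use Bp in \<open>auto simp: closed_Compl\<close>)
    then have "compact E" unfolding E_def
      by (metis Int_lower1 bounded_closed_interval bounded_subset compact_eq_bounded_closed)
    moreover have "E \<noteq> {}" using nt that by (auto simp: E_def)
    ultimately obtain t0 where t0: "t0 \<in> E" "\<And>s. s \<in> E \<Longrightarrow> t0 \<le> s" using compact_attains_inf[of E] by blast
    have t0': "t0 \<in> I01" "x t0 \<notin> Bp" using t0(1) by (auto simp: E_def)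
    have "t0 \<noteq> 0" using x0 t0'(2) by metis
    then have t00: "0 < t0" using t0'(1) by auto
    have before: "x s \<in> Bp" if "0 \<le> s" "s < t0" for s
      using t0(2)[of s] that t0'(1) by (fastforce simp: E_def)
    have "{0..<t0} \<subseteq> I01 \<inter> x -` K"
      using inK before t0'(1) by auto
    moreover have "closed (I01 \<inter> x -` K)" by (rule continuous_closed_preimage[OF xc _ K]) simp
    ultimately have "closure {0..<t0} \<subseteq> I01 \<inter> x -` K" by (rule closure_minimal)
    moreover have "t0 \<in> closure {0..<t0}" using t00 by simp
    ultimately have "x t0 \<in> K" by blast
    then show False using KB(2) t0'(2) by blast
  qed
  have "dist (snd c (x 0)) (snd c (x 1)) \<le> F 1" by (rule est) (simp_all add: all)
  moreover have "x 1 \<in> fst c" using all[of 1] Bp_iff[of "x 1"] by simp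
  ultimately show ?case unfolding L by blast
qed

section \<open>The Riemannian distance\<close>

abbreviation "rdist \<equiv> riem_dist A g"

lemma joined_by_refl: "joined_by A g p p 0"
proof -
  obtain c where c: "c \<in> charts_at A p" using ex_chart by blast
  obtain r C where r: "r > 0" "cball (snd c p) r \<subseteq> snd c ` fst c"
    "\<And>y h. y \<in> cball (snd c p) r \<Longrightarrow> sqrt (G c y h h) \<le> C * norm h"
    using chart_ball_comparison[OF charts_atD(1,3)[OF c]] by metis
  obtain L where L: "joined_by A g (chart_inv c (snd c p)) (chart_inv c (snd c p)) L" "L \<le> C * dist (snd c p) (snd c p)"
    using chart_segment_joined[OF charts_atD(1)[OF c] r(2) _ _ r(3), of "snd c p" "snd c p"] r(1) by auto
  then show ?thesis using joined_by_nonneg[OF L(1)] chart_inv_inv[OF charts_atD(1,2)[OF c]] by simp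
qed

lemma joined_near:
  "\<exists>C>0. \<exists>r>0. \<exists>c\<in>charts_at A p. cball (snd c p) r \<subseteq> snd c ` fst c \<and>
     (\<forall>y\<in>cball (snd c p) r. \<exists>L. joined_by A g p (chart_inv c y) L \<and> L \<le> C * dist (snd c p) y)"
proof -
  obtain c where c: "c \<in> charts_at A p" using ex_chart by blast
  obtain r C where r: "r > 0" "cball (snd c p) r \<subseteq> snd c ` fst c" "C > 0"
    "\<And>y h. y \<in> cball (snd c p) r \<Longrightarrow> sqrt (G c y h h) \<le> C * norm h"
    using chart_ball_comparison[OF charts_atD(1,3)[OF c]] by metis
  have "\<exists>L. joined_by A g p (chart_inv c y) L \<and> L \<le> C * dist (snd c p) y" if "y \<in> cball (snd c p) r" for y
    using chart_segment_joined[OF charts_atD(1)[OF c] r(2) _ that r(4), of "snd c p"] r(1) chart_inv_inv[OF charts_atD(1,2)[OF c]] by simp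
  then show ?thesis using r c by blast
qed

text \<open>The points that can be joined to \<open>p\<close> form an open and closed set.\<close>

lemma connected_joined:
  assumes "connected (UNIV :: 'a set)" shows "\<exists>L. joined_by A g p q L"
proof -
  define J where "J = {q. \<exists>L. joined_by A g p q L}"
  have nb: "\<exists>T. open T \<and> q \<in> T \<and> (\<forall>q'\<in>T. \<exists>L. joined_by A g q q' L)" for q
  proof -
    obtain r c where c: "r > 0" "c \<in> charts_at A q" "cball (snd c q) r \<subseteq> snd c ` fst c"
      "\<And>y. y \<in> cball (snd c q) r \<Longrightarrow> \<exists>L. joined_by A g q (chart_inv c y) L"
      using joined_near[of q] by blast
    have "ball (snd c q) r \<subseteq> snd c ` fst c" using c(3) by auto
    then have "open (chart_inv c ` ball (snd c q) r)" by (rule chart_ball_open[OF charts_atD(1)[OF c(2)]])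
    moreover have "q \<in> chart_inv c ` ball (snd c q) r"
      using chart_inv_inv[OF charts_atD(1,2)[OF c(2)]] c(1) by (metis centre_in_ball image_eqI)
    ultimately show ?thesis using c(4) by (intro exI[of _ "chart_inv c ` ball (snd c q) r"]) auto
  qed
  have J_iff: "q \<in> J \<longleftrightarrow> q' \<in> J" if "joined_by A g q q' L" for q q' L
    using joined_by.concat[OF _ that] joined_by.concat[OF _ joined_by_sym[OF that]] unfolding J_def mem_Collect_eq by metis
  have JO: "\<exists>T. open T \<and> q \<in> T \<and> (\<forall>q'\<in>T. q' \<in> J \<longleftrightarrow> q \<in> J)" for q
  proof -
    obtain T where T: "open T" "q \<in> T" "\<forall>q'\<in>T. \<exists>L. joined_by A g q q' L" using nb by blast
    have "q' \<in> J \<longleftrightarrow> q \<in> J" if "q' \<in> T" for q'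
    proof -
      obtain L where "joined_by A g q q' L" using T(3) \<open>q' \<in> T\<close> by blast
      then show ?thesis using J_iff by blast
    qed
    then show ?thesis using T(1,2) by blast
  qed
  have "open J" unfolding open_subopen[of J]
  proof
    fix q assume "q \<in> J"
    then show "\<exists>T. open T \<and> q \<in> T \<and> T \<subseteq> J" using JO[of q] by blast
  qed
  moreover have "open (- J)" unfolding open_subopen[of "- J"]
  proof
    fix q assume "q \<in> - J"
    then show "\<exists>T. open T \<and> q \<in> T \<and> T \<subseteq> - J" using JO[of q] by blast
  qed
  moreover have "p \<in> J" using joined_by_refl J_def by blast
  ultimately have "J = UNIV"
    using connectedD[OF assms, of J "- J"] by blast
  then show ?thesis by (auto simp: J_def)
qed

lemma dist_le: "joined_by A g p q L \<Longrightarrow> rdist p q \<le> L"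
  unfolding riem_dist_def by (rule cInf_lower) (auto intro!: bdd_belowI[of _ 0] dest: joined_by_nonneg)

lemma dist_lessD:
  assumes "connected (UNIV :: 'a set)" "rdist p q < e" shows "\<exists>L<e. joined_by A g p q L"
  using cInf_lessD[of "{L. joined_by A g p q L}" e] connected_joined[OF assms(1)] assms(2)
  unfolding riem_dist_def by auto

text \<open>The counterpart of the estimate for segments: near \<open>p\<close> the Riemannian distance dominates distances in the chart.\<close>

lemma dist_near:
  assumes "connected (UNIV :: 'a set)"
  shows "\<exists>r>0. \<exists>\<kappa>>0. \<exists>c\<in>charts_at A p. cball (snd c p) r \<subseteq> snd c ` fst c \<and>
    (\<forall>q. rdist p q < \<kappa> * r \<longrightarrow> q \<in> fst c \<and> \<kappa> * dist (snd c p) (snd c q) \<le> rdist p q)"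
proof -
  obtain c where c: "c \<in> charts_at A p" using ex_chart by blast
  obtain r \<kappa> where r: "r > 0" "cball (snd c p) r \<subseteq> snd c ` fst c" "\<kappa> > 0"
    "\<And>y h. y \<in> cball (snd c p) r \<Longrightarrow> \<kappa> * norm h \<le> sqrt (G c y h h)"
    using chart_ball_comparison[OF charts_atD(1,3)[OF c]] by metis
  have est: "q \<in> fst c \<and> \<kappa> * dist (snd c p) (snd c q) \<le> L" if "joined_by A g p q L" "L < \<kappa> * r" for q L
    using joined_by_stays_in_chart[OF that(1) charts_atD(1)[OF c] r(2,3,4) charts_atD(2)[OF c]] that(2) r(3)
    by (simp add: field_simps)
  have "q \<in> fst c \<and> \<kappa> * dist (snd c p) (snd c q) \<le> rdist p q" if "rdist p q < \<kappa> * r" for q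
  proof -
    obtain L where L: "L < \<kappa> * r" "joined_by A g p q L" using dist_lessD[OF assms \<open>rdist p q < \<kappa> * r\<close>] by blast
    have "\<kappa> * dist (snd c p) (snd c q) \<le> L'" if "joined_by A g p q L'" for L'
      using est[OF L(2,1)] est[OF that] L(1) by (cases "L' < \<kappa> * r") (auto intro: order_trans[OF conjunct2[OF est[OF L(2,1)]]])
    then have "\<kappa> * dist (snd c p) (snd c q) \<le> rdist p q"
      unfolding riem_dist_def using L(2) by (intro cInf_greatest) auto
    then show ?thesis using est[OF L(2,1)] by blast
  qed
  then show ?thesis using r c by blast
qed

lemma riem_dist_metric:
  assumes conn: "connected (UNIV :: 'a set)"
  shows "Metric_space UNIV rdist"
proof
  have ne: "{L. joined_by A g p q L} \<noteq> {}" for p q using connected_joined[OF conn] by blast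
  show nn: "0 \<le> rdist p q" for p q
    unfolding riem_dist_def by (rule cInf_greatest[OF ne]) (auto dest: joined_by_nonneg)
  have "{L. joined_by A g p q L} = {L. joined_by A g q p L}" for p q using joined_by_sym by blast
  then show "rdist p q = rdist q p" for p q by (simp add: riem_dist_def)
  show "rdist p q \<le> rdist p z + rdist z q" for p q z
  proof (rule field_le_epsilon)
    fix e :: real assume "e > 0"
    then obtain L L' where "L < rdist p z + e / 2" "joined_by A g p z L" "L' < rdist z q + e / 2" "joined_by A g z q L'"
      using dist_lessD[OF conn, of p z "rdist p z + e / 2"] dist_lessD[OF conn, of z q "rdist z q + e / 2"] by auto
    then show "rdist p q \<le> rdist p z + rdist z q + e" using dist_le[OF joined_by.concat, of p z L q L'] by simp
  qed
  show "rdist p q = 0 \<longleftrightarrow> p = q" for p q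
  proof
    assume 0: "rdist p q = 0"
    obtain r \<kappa> c where c: "r > 0" "\<kappa> > 0" "c \<in> charts_at A p"
      "rdist p q < \<kappa> * r \<longrightarrow> q \<in> fst c \<and> \<kappa> * dist (snd c p) (snd c q) \<le> rdist p q"
      using dist_near[OF conn, of p] by metis
    then have q: "q \<in> fst c" "\<kappa> * dist (snd c p) (snd c q) \<le> 0" using 0 by auto
    then have "snd c p = snd c q" using c(2) by (simp add: mult_le_0_iff)
    then show "p = q" using chart_inv_inv[OF charts_atD(1)[OF c(3)]] charts_atD(2)[OF c(3)] q(1) by metis
  next
    assume "p = q"
    moreover have "rdist p p = 0" by (rule order_antisym[OF dist_le[OF joined_by_refl] nn])
    ultimately show "rdist p q = 0" by simp
  qed
qed

text \<open>The two comparisons with chart distances show that the Riemannian distance induces the topology of the manifold and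
  is locally compact, so that the metric theorem of Hopf and Rinow applies.\<close>

theorem bounded_closure_compact:
  assumes conn: "connected (UNIV :: 'a set)" and complete: "Metric_space.mcomplete UNIV rdist"
    and D: "Metric_space.mbounded UNIV rdist D"
  shows "compact (closure D)"
proof -
  interpret M: Metric_space UNIV rdist by (rule riem_dist_metric[OF conn])
  have top: "openin M.mtopology U \<longleftrightarrow> open U" for U
  proof
    assume U: "openin M.mtopology U"
    show "open U" unfolding open_subopen[of U]
    proof
      fix q assume "q \<in> U"
      then obtain e where e: "e > 0" "M.mball q e \<subseteq> U" using U unfolding M.openin_mtopology by blast
      obtain C r c where c: "C > 0" "r > 0" "c \<in> charts_at A q" "cball (snd c q) r \<subseteq> snd c ` fst c"
        "\<And>y. y \<in> cball (snd c q) r \<Longrightarrow> \<exists>L. joined_by A g q (chart_inv c y) L \<and> L \<le> C * dist (snd c q) y"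
        using joined_near[of q] by blast
      define s where "s = min r (e / C)"
      have s: "s > 0" "s \<le> r" "C * s \<le> e" using c e by (auto simp: s_def min_def field_simps)
      have "chart_inv c ` ball (snd c q) s \<subseteq> U"
      proof
        fix z assume "z \<in> chart_inv c ` ball (snd c q) s"
        then obtain y where y: "dist (snd c q) y < s" "z = chart_inv c y" by auto
        then obtain L where L: "joined_by A g q z L" "L \<le> C * dist (snd c q) y" using c(5)[of y] s(2) by auto
        have "C * dist (snd c q) y < C * s" using y(1) c(1) by simp
        then have "rdist q z < e" using dist_le[OF L(1)] L(2) s(3) by linarith
        then show "z \<in> U" using e(2) by auto
      qed
      moreover have "open (chart_inv c ` ball (snd c q) s)"
        by (rule chart_ball_open[OF charts_atD(1)[OF c(3)]]) (use c(4) s(2) in force)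
      moreover have "q \<in> chart_inv c ` ball (snd c q) s"
        using chart_inv_inv[OF charts_atD(1,2)[OF c(3)]] s(1) by (metis centre_in_ball image_eqI)
      ultimately show "\<exists>T. open T \<and> q \<in> T \<and> T \<subseteq> U" by blast
    qed
  next
    assume U: "open U"
    show "openin M.mtopology U"
      unfolding M.openin_mtopology
    proof (intro conjI allI impI)
      fix p assume p: "p \<in> U"
      obtain r \<kappa> c where c: "r > 0" "\<kappa> > 0" "c \<in> charts_at A p" "cball (snd c p) r \<subseteq> snd c ` fst c"
        "\<And>q. rdist p q < \<kappa> * r \<Longrightarrow> q \<in> fst c \<and> \<kappa> * dist (snd c p) (snd c q) \<le> rdist p q"
        using dist_near[OF conn, of p] by metis
      note cA = charts_atD(1)[OF c(3)]
      have "open (snd c ` fst c \<inter> chart_inv c -` U)"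
        by (rule continuous_open_preimage[OF chart_inv_continuous[OF cA] chart_open(2)[OF cA] U])
      moreover have "snd c p \<in> snd c ` fst c \<inter> chart_inv c -` U"
        using p charts_atD(3)[OF c(3)] chart_inv_inv[OF charts_atD(1,2)[OF c(3)]] by simp
      ultimately obtain s where s: "s > 0" "ball (snd c p) s \<subseteq> snd c ` fst c \<inter> chart_inv c -` U"
        using open_contains_ball by meson
      define e where "e = \<kappa> * min r s"
      have e: "e > 0" "e \<le> \<kappa> * r" "e \<le> \<kappa> * s" using c s by (auto simp: e_def)
      have "M.mball p e \<subseteq> U"
      proof
        fix q assume "q \<in> M.mball p e"
        then have q: "rdist p q < e" by simp
        then have q': "q \<in> fst c" "\<kappa> * dist (snd c p) (snd c q) \<le> rdist p q" using c(5)[of q] e(2) by auto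
        then have "\<kappa> * dist (snd c p) (snd c q) < \<kappa> * s" using q e(3) by linarith
        then have "snd c q \<in> ball (snd c p) s" using c(2) by simp
        then show "q \<in> U" using s(2) chart_inv_inv[OF cA q'(1)] by auto
      qed
      then show "\<exists>r>0. M.mball p r \<subseteq> U" using e(1) by blast
    qed simp
  qed
  then have top_eq: "M.mtopology = euclidean" by (simp add: topology_eq open_openin[symmetric])
  have cpt: "compactin M.mtopology K \<longleftrightarrow> compact K" for K by (simp add: top_eq)
  have loc: "\<exists>r>0. compactin M.mtopology (M.mcball p r)" for p
  proof -
    obtain r \<kappa> c where c: "r > 0" "\<kappa> > 0" "c \<in> charts_at A p" "cball (snd c p) r \<subseteq> snd c ` fst c"
      "\<And>q. rdist p q < \<kappa> * r \<Longrightarrow> q \<in> fst c \<and> \<kappa> * dist (snd c p) (snd c q) \<le> rdist p q"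
      using dist_near[OF conn, of p] by metis
    note cA = charts_atD(1)[OF c(3)]
    have "compact (chart_inv c ` cball (snd c p) r)"
      by (intro compact_continuous_image continuous_on_subset[OF chart_inv_continuous[OF cA] c(4)] compact_cball)
    moreover have "M.mcball p (\<kappa> * r / 2) \<subseteq> chart_inv c ` cball (snd c p) r"
    proof
      fix q assume "q \<in> M.mcball p (\<kappa> * r / 2)"
      then have q: "rdist p q \<le> \<kappa> * r / 2" by simp
      have "\<kappa> * r > 0" using c(1,2) by simp
      then have "rdist p q < \<kappa> * r" using q by linarith
      then have q': "q \<in> fst c" "\<kappa> * dist (snd c p) (snd c q) \<le> rdist p q" using c(5)[of q] by auto
      then have "\<kappa> * dist (snd c p) (snd c q) \<le> \<kappa> * r" using \<open>rdist p q < \<kappa> * r\<close> by linarith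
      then have "snd c q \<in> cball (snd c p) r" using c(2) by simp
      then show "q \<in> chart_inv c ` cball (snd c p) r" using chart_inv_inv[OF cA q'(1)] by (metis image_eqI)
    qed
    ultimately have "compactin M.mtopology (M.mcball p (\<kappa> * r / 2))"
      using closed_compactin[OF _ _ M.closedin_mcball] cpt by metis
    then show ?thesis using c by (intro exI[of _ "\<kappa> * r / 2"]) auto
  qed
  have len: "\<exists>z\<in>UNIV. rdist p z \<le> s \<and> rdist z q \<le> rdist p q - s + e" if h: "0 \<le> s" "s \<le> rdist p q" "e > 0" for p q s e
  proof -
    obtain L where L: "L < rdist p q + e" "joined_by A g p q L" using dist_lessD[OF conn, of p q "rdist p q + e"] h(3) by auto
    then obtain z where "joined_by A g p z s" "joined_by A g z q (L - s)"
      using joined_by_split[OF L(2) h(1)] dist_le[OF L(2)] h(2) by auto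
    then show ?thesis using dist_le[of p z s] dist_le[of z q "L - s"] L(1) by auto
  qed
  obtain p R where "D \<subseteq> M.mcball p R" using D unfolding M.mbounded_def by blast
  moreover have K: "compact (M.mcball p R)"
    using M.complete_length_space_proper[OF complete UNIV_I loc len] cpt by blast
  ultimately have "closure D \<subseteq> M.mcball p R" using closure_minimal compact_imp_closed by blast
  then show ?thesis using compact_Int_closed[OF K closed_closure, of D] by (simp add: Int_absorb1)
qed

end

section \<open>Norms of tangent vectors\<close>

context riemannian_manifold
begin

lemma tnorm_coord: "v \<in> tangent_space A p \<Longrightarrow> c \<in> charts_at A p \<Longrightarrow> (tnorm g p v)\<^sup>2 = G c (snd c p) (v c) (v c)"
  using metric_coord[of v p v c] metric_nonneg[of v p] by (simp add: tnorm_def)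

lemma tnorm_nonneg: "v \<in> tangent_space A p \<Longrightarrow> tnorm g p v \<ge> 0"
  by (simp add: tnorm_def metric_nonneg)

lemma tnorm_scaleR: "v \<in> tangent_space A p \<Longrightarrow> tnorm g p (\<lambda>c. r *\<^sub>R v c) = \<bar>r\<bar> * tnorm g p v"
proof -
  assume v: "v \<in> tangent_space A p"
  obtain c where c: "c \<in> charts_at A p" using ex_chart by blast
  have "g p (\<lambda>c. r *\<^sub>R v c) (\<lambda>c. r *\<^sub>R v c) = r\<^sup>2 * g p v v"
    by (simp add: metric_coord[OF tangent_scaleR[OF v] tangent_scaleR[OF v] c] metric_coord[OF v v c] G_simps power2_eq_square)
  then show ?thesis by (simp add: tnorm_def real_sqrt_mult)
qed

lemma tnorm_pos:
  assumes "v \<in> tangent_space A p" "v \<noteq> (\<lambda>c. 0)" shows "tnorm g p v > 0"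
  using metric_pos[OF assms] by (simp add: tnorm_def)

lemma normalized_tangent:
  assumes v: "v \<in> tangent_space A p" "tnorm g p v > 0"
  shows "(\<lambda>c. (1 / tnorm g p v) *\<^sub>R v c) \<in> tangent_space A p" "tnorm g p (\<lambda>c. (1 / tnorm g p v) *\<^sub>R v c) = 1"
  using tangent_scaleR[OF v(1)] v by (simp_all add: tnorm_scaleR[OF v(1)])

text \<open>Functions of the components are bounded on the compact unit sphere of one tangent space. This is needed wherever
  an infimum or supremum over unit vectors has to be a bound of the values.\<close>

lemma unit_vectors_bounded:
  assumes c: "c \<in> charts_at A p" and \<Psi>: "continuous_on UNIV (\<lambda>z. \<Psi> (fst z) (snd z) :: real)"
  shows "\<exists>C\<ge>0. \<forall>u\<in>tangent_space A p. \<forall>v\<in>tangent_space A p. tnorm g p u = 1 \<longrightarrow> tnorm g p v = 1 \<longrightarrow>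
    \<bar>\<Psi> (u c) (v c)\<bar> \<le> C"
proof -
  obtain r \<kappa> where r: "r > 0" "\<kappa> > 0" "\<And>y h. y \<in> cball (snd c p) r \<Longrightarrow> \<kappa> * norm h \<le> sqrt (G c y h h)"
    using chart_ball_comparison[OF charts_atD(1,3)[OF c]] by metis
  have "compact ((\<lambda>z. \<Psi> (fst z) (snd z)) ` (cball 0 (1/\<kappa>) \<times> cball 0 (1/\<kappa>)))"
    by (intro compact_continuous_image compact_Times compact_cball continuous_on_subset[OF \<Psi>]) simp
  from compact_imp_bounded[OF this, unfolded bounded_iff] obtain C where C0: "\<forall>s\<in>(\<lambda>z. \<Psi> (fst z) (snd z)) ` (cball 0 (1/\<kappa>) \<times> cball 0 (1/\<kappa>)). norm s \<le> C" ..
  have C: "\<bar>\<Psi> h k\<bar> \<le> C" if "h \<in> cball 0 (1/\<kappa>)" "k \<in> cball 0 (1/\<kappa>)" for h k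
    using bspec[OF C0 imageI[OF SigmaI[OF that]]] by simp
  have b: "u c \<in> cball 0 (1/\<kappa>)" if "u \<in> tangent_space A p" "tnorm g p u = 1" for u
  proof -
    have "sqrt (G c (snd c p) (u c) (u c)) = 1" using tnorm_coord[OF that(1) c] that(2) by simp
    then show ?thesis using r(3)[of "snd c p" "u c"] r(1,2) by (simp add: field_simps)
  qed
  have "0 \<le> 1 / \<kappa>" using r(2) by simp
  then have "C \<ge> 0" using C[of 0 0] by fastforce
  then show ?thesis using C b by blast
qed

section \<open>Sectional curvature\<close>

lemma Rc_continuous_on:
  assumes c: "c \<in> A" and "continuous_on X Y" "continuous_on X U" "continuous_on X V" "continuous_on X W"
    and S: "\<And>x. x \<in> X \<Longrightarrow> Y x \<in> snd c ` fst c"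
  shows "continuous_on X (\<lambda>x. Rc c (Y x) (U x) (V x) (W x))"
  unfolding Rc_def
  by (intro continuous_on_diff continuous_on_add smooth_bilinear_continuous_on[OF \<Gamma>_smooth[OF c]]
      smooth_bilinear_dd_continuous_on[OF \<Gamma>_smooth[OF c]] assms)

text \<open>Both sides are unchanged when a multiple of \<open>k\<close> is added to \<open>h\<close>: the curvature term because of its two skew
  symmetries. So \<open>h\<close> and \<open>k\<close> may be assumed orthogonal, and by homogeneity of unit length, where compactness
  gives the bound.\<close>

lemma sectional_form_bound:
  assumes c: "c \<in> charts_at A p"
  defines "y \<equiv> snd c p"
  shows "\<exists>C\<ge>0. \<forall>h k. G c y (Rc c y h k k) h \<le> C * (G c y h h * G c y k k - (G c y h k)\<^sup>2)
    \<and> 0 \<le> G c y h h * G c y k k - (G c y h k)\<^sup>2"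
proof -
  have cy: "c \<in> A" "y \<in> snd c ` fst c" using charts_atD[OF c] by (auto simp: y_def)
  define N where "N h k = G c y (Rc c y h k k) h" for h k
  define Q where "Q h k = G c y h h * G c y k k - (G c y h k)\<^sup>2" for h k
  note lin = Rc_linear[OF cy]
  have Rlin1: "Rc c y (a + b) v w = Rc c y a v w + Rc c y b v w" for a b v w
    by (rule linear_add[OF lin(1)])
  have Rlin2: "Rc c y (r *\<^sub>R a) v w = r *\<^sub>R Rc c y a v w" for r a v w
    by (rule linear_scale[OF lin(1)])
  have Rlin3: "Rc c y u v (r *\<^sub>R w) = r *\<^sub>R Rc c y u v w" for r u v w
    by (rule linear_scale[OF lin(2)])
  have Rlin4: "Rc c y u (r *\<^sub>R v) w = r *\<^sub>R Rc c y u v w" for r u v w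
    using Rc_antisym[of c y u "r *\<^sub>R v" w] Rc_antisym[of c y u v w] by (simp add: Rlin2)
  note Rlin = Rlin1 Rlin2 Rlin3 Rlin4
  have "Rc c y k k w = - Rc c y k k w" for k w by (rule Rc_antisym)
  then have R0: "Rc c y k k w = 0" for k w by (metis (no_types) add.inverse_neutral eq_neg_iff_add_eq_0 scaleR_2 scaleR_eq_0_iff zero_neq_numeral)
  have Nshift: "N (h + r *\<^sub>R k) k = N h k" for h k r
    by (simp add: N_def Rlin R0 G_simps Rc_metric_skew[OF cy])
  have Nscale: "N (a *\<^sub>R h) (b *\<^sub>R k) = a\<^sup>2 * b\<^sup>2 * N h k" for a b h k
    by (simp add: N_def Rlin G_simps power2_eq_square)
  have sym: "G c y h k = G c y k h" for h k by (rule G_sym[OF cy])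
  have Qshift: "Q (h + r *\<^sub>R k) k = Q h k" for h k r
    by (simp add: Q_def G_simps sym[of k h] power2_eq_square algebra_simps)
  have cont: "continuous_on UNIV (\<lambda>z. N (fst z) (snd z))"
    unfolding N_def
    by (intro smooth_bilinear_continuous_on[OF G_smooth[OF cy(1)]] Rc_continuous_on[OF cy(1)] continuous_intros cy(2))
  obtain C where C: "C \<ge> 0" "\<And>u v. u \<in> tangent_space A p \<Longrightarrow> v \<in> tangent_space A p \<Longrightarrow> tnorm g p u = 1 \<Longrightarrow> tnorm g p v = 1 \<Longrightarrow>
    \<bar>N (u c) (v c)\<bar> \<le> C" using unit_vectors_bounded[OF c cont] by metis
  have unit: "N h k \<le> C" if "G c y h h = 1" "G c y k k = 1" for h k
  proof -
    have "tnorm g p (tvec_of c p h) = 1" if "G c y h h = 1" for h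
      using metric_coord[OF tvec_of_in[OF c] tvec_of_in[OF c] c, of h h] that by (simp add: tnorm_def tvec_of_self[OF c] y_def)
    then show ?thesis using C(2)[OF tvec_of_in[OF c] tvec_of_in[OF c], of h k] that by (simp add: tvec_of_self[OF c] abs_le_iff)
  qed
  have orth: "N h k \<le> C * Q h k \<and> 0 \<le> Q h k" if hk: "G c y h k = 0" for h k
  proof (cases "h = 0 \<or> k = 0")
    case True
    moreover have "N 0 k = 0" "N h 0 = 0" using Nscale[of 0 h 1 k] Nscale[of 1 h 0 k] by auto
    ultimately show ?thesis by (auto simp: Q_def G_simps)
  next
    case False
    then have pos: "G c y h h > 0" "G c y k k > 0" using G_pos[OF cy] by auto
    define a where "a = 1 / sqrt (G c y h h)"
    define b where "b = 1 / sqrt (G c y k k)"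
    have ab: "a\<^sup>2 * G c y h h = 1" "b\<^sup>2 * G c y k k = 1" using pos by (simp_all add: a_def b_def power_divide)
    have "G c y (a *\<^sub>R h) (a *\<^sub>R h) = 1" "G c y (b *\<^sub>R k) (b *\<^sub>R k) = 1"
      using ab by (simp_all add: G_simps power2_eq_square mult.assoc)
    then have le: "a\<^sup>2 * b\<^sup>2 * N h k \<le> C" using unit Nscale by metis
    have "N h k = (a\<^sup>2 * G c y h h) * (b\<^sup>2 * G c y k k) * N h k" by (simp add: ab)
    also have "\<dots> = (G c y h h * G c y k k) * (a\<^sup>2 * b\<^sup>2 * N h k)" by (simp add: mult_ac)
    also have "\<dots> \<le> (G c y h h * G c y k k) * C" by (intro mult_left_mono le) (use pos in simp)
    finally show ?thesis using hk pos by (simp add: Q_def mult_ac)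
  qed
  have "N h k \<le> C * Q h k \<and> 0 \<le> Q h k" for h k
  proof (cases "k = 0")
    case True
    then show ?thesis using orth[of h k] by (simp add: G_simps)
  next
    case False
    then have kk: "G c y k k > 0" by (rule G_pos[OF cy])
    define r where "r = - (G c y h k / G c y k k)"
    have "G c y (h + r *\<^sub>R k) k = 0" using kk by (simp add: G_simps r_def)
    from orth[OF this] show ?thesis by (simp add: Nshift Qshift)
  qed
  then show ?thesis using C(1) unfolding N_def Q_def by blast
qed

text \<open>The set whose supremum defines \<open>K_max\<close> is bounded by the preceding lemma. For dependent vectors the curvature
  term is not positive, as the Gram determinant vanishes.\<close>

lemma sectional_curvature_le_K_max:
  assumes "\<eta> \<in> tangent_space A p" "\<tau> \<in> tangent_space A p"
  shows "g p (curvature A g p \<eta> \<tau> \<tau>) \<eta> \<le> K_max A g p * (tnorm g p \<eta>)\<^sup>2 * (tnorm g p \<tau>)\<^sup>2"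
proof -
  obtain c where c: "c \<in> charts_at A p" using ex_chart by blast
  define y where "y = snd c p"
  have cy: "c \<in> A" "y \<in> snd c ` fst c" using charts_atD[OF c] by (auto simp: y_def)
  define Q where "Q u v = G c y (u c) (u c) * G c y (v c) (v c) - (G c y (u c) (v c))\<^sup>2" for u v :: "('a, 'n) tvec"
  define N where "N u v = g p (curvature A g p u v v) u" for u v
  have Nc: "N u v = G c y (Rc c y (u c) (v c) (v c)) (u c)" if "u \<in> tangent_space A p" "v \<in> tangent_space A p" for u v
    unfolding N_def by (simp add: metric_coord[OF curvature_tangent[OF that that(2)] that(1) c] curvature_coord[OF c] y_def)
  have Qc: "Q u v = (tnorm g p u)\<^sup>2 * (tnorm g p v)\<^sup>2 - (g p u v)\<^sup>2" if "u \<in> tangent_space A p" "v \<in> tangent_space A p" for u v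
    by (simp add: Q_def y_def tnorm_coord[OF that(1) c] tnorm_coord[OF that(2) c] metric_coord[OF that c])
  obtain C where C: "C \<ge> 0" "\<And>u v. u \<in> tangent_space A p \<Longrightarrow> v \<in> tangent_space A p \<Longrightarrow> N u v \<le> C * Q u v \<and> 0 \<le> Q u v"
    using sectional_form_bound[OF c, folded y_def] Nc unfolding Q_def by metis
  let ?ind = "\<lambda>\<xi> \<eta>. \<forall>a b. (\<lambda>c. a *\<^sub>R \<xi> c + b *\<^sub>R \<eta> c) = (\<lambda>c. 0) \<longrightarrow> a = 0 \<and> b = (0::real)"
  let ?S = "insert 0 {sectional_curvature A g p \<xi> \<eta> |\<xi> \<eta>. \<xi> \<in> tangent_space A p \<and> \<eta> \<in> tangent_space A p \<and> ?ind \<xi> \<eta>}"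
  have sec: "sectional_curvature A g p u v = N u v / Q u v" if "u \<in> tangent_space A p" "v \<in> tangent_space A p" for u v
    by (simp add: sectional_curvature_def N_def Qc[OF that])
  have bdd: "bdd_above ?S"
  proof (rule bdd_aboveI[of _ C])
    fix s assume "s \<in> ?S"
    then consider "s = 0" | u v where "u \<in> tangent_space A p" "v \<in> tangent_space A p" "s = sectional_curvature A g p u v" by blast
    then show "s \<le> C"
    proof cases
      case 2
      then have "N u v \<le> C * Q u v" "0 \<le> Q u v" using C(2) by auto
      then show ?thesis using C(1) 2 sec by (cases "Q u v = 0") (auto simp: divide_le_eq)
    qed (use C(1) in simp)
  qed
  have K0: "0 \<le> K_max A g p" unfolding K_max_def by (rule cSup_upper[OF _ bdd]) simp
  have NQ: "N \<eta> \<tau> \<le> K_max A g p * Q \<eta> \<tau>"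
  proof (cases "Q \<eta> \<tau> = 0")
    case True
    then show ?thesis using C(2)[OF assms] by simp
  next
    case False
    then have Q: "Q \<eta> \<tau> > 0" using C(2)[OF assms] by simp
    have "?ind \<eta> \<tau>"
    proof (intro allI impI)
      fix a b assume "(\<lambda>c. a *\<^sub>R \<eta> c + b *\<^sub>R \<tau> c) = (\<lambda>c. 0)"
      then have e: "a *\<^sub>R \<eta> c + b *\<^sub>R \<tau> c = 0" by (rule fun_cong)
      have \<tau>0: "\<tau> c \<noteq> 0" using Q by (auto simp: Q_def G_simps)
      have "a = 0"
      proof (rule ccontr)
        assume "a \<noteq> 0"
        have "a *\<^sub>R \<eta> c = - (b *\<^sub>R \<tau> c)" using e by (simp add: eq_neg_iff_add_eq_0)
        then have "(1 / a) *\<^sub>R (a *\<^sub>R \<eta> c) = (1 / a) *\<^sub>R (- (b *\<^sub>R \<tau> c))" by simp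
        then have "\<eta> c = (- b / a) *\<^sub>R \<tau> c" using \<open>a \<noteq> 0\<close> by simp
        then have "Q \<eta> \<tau> = 0" by (simp add: Q_def G_simps power2_eq_square)
        then show False using Q by simp
      qed
      then show "a = 0 \<and> b = 0" using e \<tau>0 by simp
    qed
    then have "sectional_curvature A g p \<eta> \<tau> \<le> K_max A g p"
      unfolding K_max_def by (intro cSup_upper[OF _ bdd]) (use assms in blast)
    then show ?thesis using Q sec[OF assms] by (simp add: divide_le_eq)
  qed
  have "Q \<eta> \<tau> \<le> (tnorm g p \<eta>)\<^sup>2 * (tnorm g p \<tau>)\<^sup>2" by (simp add: Qc[OF assms])
  then have "K_max A g p * Q \<eta> \<tau> \<le> K_max A g p * ((tnorm g p \<eta>)\<^sup>2 * (tnorm g p \<tau>)\<^sup>2)" by (rule mult_left_mono[OF _ K0])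
  then show ?thesis using NQ by (simp add: N_def mult.assoc)
qed

section \<open>Gradient and Hessian\<close>

text \<open>The components of the gradient: the differential of \<open>U\<close> with its index raised.\<close>

definition grad_coord :: "('a \<Rightarrow> real) \<Rightarrow> ('a, 'n) chart \<Rightarrow> real^'n \<Rightarrow> real^'n" where
  "grad_coord U c y = matrix_inv (gram A g c y) *v (\<chi> i. dd (\<lambda>y. U (chart_inv c y)) y (axis i 1))"

context
  fixes U :: "'a \<Rightarrow> real" assumes U: "smooth_function A U"
begin

lemma U_smooth: "c \<in> A \<Longrightarrow> smooth_on (snd c ` fst c) (\<lambda>y. U (chart_inv c y))"
  using U unfolding smooth_function_def by blast

lemma U_has_derivative:
  "c \<in> A \<Longrightarrow> y \<in> snd c ` fst c \<Longrightarrow> ((\<lambda>y. U (chart_inv c y)) has_derivative dd (\<lambda>y. U (chart_inv c y)) y) (at y)"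
  by (rule smooth_on_has_derivative[OF U_smooth chart_open(2)])

lemma grad_coord_smooth: assumes c: "c \<in> A" shows "smooth_on (snd c ` fst c) (grad_coord U c)"
proof (rule smooth_on_vec[OF _ chart_open(2)[OF c]])
  fix k
  have "smooth_on (snd c ` fst c) (\<lambda>y. \<Sum>l\<in>UNIV. matrix_inv (gram A g c y) $ k $ l * dd (\<lambda>y. U (chart_inv c y)) y (axis l 1))"
    by (intro smooth_on_sum smooth_on_mult smooth_on_matrix_inv[OF gram_smooth[OF c] gram_invertible[OF c]] chart_open(2)[OF c]
        smooth_on_dd U_smooth c)
  then show "smooth_on (snd c ` fst c) (\<lambda>y. grad_coord U c y $ k)"
    by (simp add: grad_coord_def matrix_vector_mult_def)
qed

lemma grad_coord_inner:
  assumes c: "c \<in> A" "y \<in> snd c ` fst c"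
  shows "G c y (grad_coord U c y) h = dd (\<lambda>y. U (chart_inv c y)) y h"
proof -
  note lin = has_derivative_linear[OF U_has_derivative[OF c]]
  have "G c y (grad_coord U c y) h = G c y h (grad_coord U c y)" by (rule G_sym[OF c])
  also have "\<dots> = h \<bullet> (\<chi> i. dd (\<lambda>y. U (chart_inv c y)) y (axis i 1))"
    by (simp add: G_def grad_coord_def matrix_vector_mul_assoc matrix_inv_works[OF gram_invertible[OF c]])
  also have "\<dots> = dd (\<lambda>y. U (chart_inv c y)) y (\<Sum>i\<in>UNIV. h $ i *\<^sub>R axis i 1)"
    by (simp add: linear_sum[OF lin] linear_scale[OF lin] inner_vec_def)
  finally show ?thesis by (simp add: vec_axis_sum)
qed

text \<open>The description of the gradient quantifies over all charts, so its existence needs that they give the same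
  differential.\<close>

lemma dU_chart_independent:
  assumes c: "c \<in> charts_at A p" "c' \<in> charts_at A p" and \<xi>: "\<xi> \<in> tangent_space A p"
  shows "dd (\<lambda>y. U (chart_inv c y)) (snd c p) (\<xi> c) = dd (\<lambda>y. U (chart_inv c' y)) (snd c' p) (\<xi> c')"
proof -
  let ?\<phi> = "transition c c'"
  note cA = charts_atD(1)[OF c(1)] charts_atD(1)[OF c(2)]
  note o = overlap_open[OF cA] overlap_at[OF c]
  have tr: "?\<phi> (snd c p) = snd c' p" by (rule transition_chart[OF charts_atD(1,2)[OF c(1)]])
  have d': "((\<lambda>y. U (chart_inv c' y)) has_derivative dd (\<lambda>y. U (chart_inv c' y)) (snd c' p)) (at (?\<phi> (snd c p)))"
    unfolding tr by (rule U_has_derivative[OF cA(2) charts_atD(3)[OF c(2)]])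
  have "((\<lambda>y. U (chart_inv c' (?\<phi> y))) has_derivative
    (\<lambda>h. dd (\<lambda>y. U (chart_inv c' y)) (snd c' p) (dd ?\<phi> (snd c p) h))) (at (snd c p))"
    by (rule has_derivative_compose[OF transition_has_derivative[OF cA o(2)] d'])
  then have "((\<lambda>y. U (chart_inv c y)) has_derivative
    (\<lambda>h. dd (\<lambda>y. U (chart_inv c' y)) (snd c' p) (dd ?\<phi> (snd c p) h))) (at (snd c p))"
  proof (rule has_derivative_transform_within_open[OF _ o])
    fix y assume "y \<in> overlap c c'"
    then have "chart_inv c y \<in> fst c'" using overlap_iff[OF cA(1)] by blast
    then show "U (chart_inv c' (?\<phi> y)) = U (chart_inv c y)" by (simp add: transition_def chart_inv_inv[OF cA(2)])
  qed
  from dd_eqI[OF this] show ?thesis by (simp only: tangent_space_jacobian[OF \<xi> c])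
qed

lemma gradient_eq:
  assumes c: "c \<in> charts_at A p"
  shows "gradient A g U p = tvec_of c p (grad_coord U c (snd c p))"
  unfolding gradient_def
proof (rule the_equality)
  let ?v = "tvec_of c p (grad_coord U c (snd c p))"
  note cA = charts_atD(1,3)[OF c]
  have v: "g p ?v \<xi> = dd (\<lambda>y. U (chart_inv c y)) (snd c p) (\<xi> c)" if "\<xi> \<in> tangent_space A p" for \<xi>
    by (simp add: metric_coord[OF tvec_of_in[OF c] that c] tvec_of_self[OF c] grad_coord_inner[OF cA])
  show "?v \<in> tangent_space A p \<and> (\<forall>\<xi>\<in>tangent_space A p. \<forall>c\<in>charts_at A p.
        g p ?v \<xi> = dd (\<lambda>y. U (chart_inv c y)) (snd c p) (\<xi> c))"
  proof (intro conjI ballI)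
    show "?v \<in> tangent_space A p" by (rule tvec_of_in[OF c])
    fix \<xi> c' assume \<xi>: "\<xi> \<in> tangent_space A p" and c': "c' \<in> charts_at A p"
    show "g p ?v \<xi> = dd (\<lambda>y. U (chart_inv c' y)) (snd c' p) (\<xi> c')"
      by (rule trans[OF v[OF \<xi>] dU_chart_independent[OF c c' \<xi>]])
  qed
  fix w assume w: "w \<in> tangent_space A p \<and> (\<forall>\<xi>\<in>tangent_space A p. \<forall>c\<in>charts_at A p.
        g p w \<xi> = dd (\<lambda>y. U (chart_inv c y)) (snd c p) (\<xi> c))"
  show "w = ?v"
  proof (rule tangent_eqI[OF _ tvec_of_in[OF c] c])
    show wT: "w \<in> tangent_space A p" using w by blast
    show "w c = ?v c"
    proof (rule G_nondegenerate[OF cA])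
      fix h
      have "g p w (tvec_of c p h) = g p ?v (tvec_of c p h)" using w v[OF tvec_of_in[OF c]] tvec_of_in[OF c] c by metis
      then show "G c (snd c p) (w c) h = G c (snd c p) (?v c) h"
        using metric_coord[OF wT tvec_of_in[OF c] c] metric_coord[OF tvec_of_in[OF c] tvec_of_in[OF c] c] tvec_of_self[OF c] by metis
    qed
  qed
qed

lemma gradient_tangent: "gradient A g U p \<in> tangent_space A p"
  using gradient_eq tvec_of_in ex_chart by metis

lemma gradient_coord: "c \<in> charts_at A p \<Longrightarrow> gradient A g U p c = grad_coord U c (snd c p)"
  using gradient_eq tvec_of_self by metis

lemma gradient_chart:
  assumes "c \<in> A" "y \<in> snd c ` fst c" shows "gradient A g U (chart_inv c y) c = grad_coord U c y"
  using gradient_coord[OF charts_atI[OF assms(1) chart_inv_in[OF assms]]] chart_chart_inv[OF assms] by simp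

lemma gradient_has_derivative:
  assumes c: "c \<in> A" "y \<in> snd c ` fst c"
  shows "((\<lambda>y. gradient A g U (chart_inv c y) c) has_derivative dd (grad_coord U c) y) (at y)"
  by (rule has_derivative_transform_within_open[OF smooth_on_has_derivative[OF grad_coord_smooth[OF c(1)] chart_open(2)[OF c(1)] c(2)]
        chart_open(2)[OF c(1)] c(2)]) (rule gradient_chart[OF c(1), symmetric])

lemma hessian_tangent: "\<xi> \<in> tangent_space A p \<Longrightarrow> hessian A g U p \<xi> \<in> tangent_space A p"
  unfolding hessian_def
  by (rule cov_deriv_tangent[OF gradient_tangent])
     (auto simp: differentiable_def simp del: split_paired_all intro: gradient_has_derivative charts_atD)

lemma hessian_coord:
  assumes c: "c \<in> charts_at A p"
  shows "hessian A g U p \<xi> c = dd (grad_coord U c) (snd c p) (\<xi> c) + \<Gamma> c (snd c p) (\<xi> c) (grad_coord U c (snd c p))"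
  using dd_eqI[OF gradient_has_derivative[OF charts_atD(1,3)[OF c]]]
  by (simp add: hessian_def cov_deriv_def c gradient_coord[OF c])

text \<open>By homogeneity it suffices to consider unit vectors, where the infimum is a lower bound by compactness.\<close>

lemma mu_min_le:
  assumes \<tau>: "\<tau> \<in> tangent_space A p"
  shows "mu_min A g U p * (tnorm g p \<tau>)\<^sup>2 \<le> g p (hessian A g U p \<tau>) \<tau> - (1/2) * (g p (gradient A g U p) \<tau>)\<^sup>2"
proof -
  obtain c where c: "c \<in> charts_at A p" using ex_chart by blast
  define y where "y = snd c p"
  have cy: "c \<in> A" "y \<in> snd c ` fst c" using charts_atD[OF c] by (auto simp: y_def)
  define q where "q \<eta> = g p (hessian A g U p \<eta>) \<eta> - (1/2) * (g p (gradient A g U p) \<eta>)\<^sup>2" for \<eta>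
  define \<Psi> where "\<Psi> h = G c y (dd (grad_coord U c) y h + \<Gamma> c y h (grad_coord U c y)) h - (1/2) * (G c y (grad_coord U c y) h)\<^sup>2" for h
  have q: "q \<eta> = \<Psi> (\<eta> c)" if "\<eta> \<in> tangent_space A p" for \<eta>
    by (simp add: q_def \<Psi>_def y_def metric_coord[OF hessian_tangent[OF that] that c] metric_coord[OF gradient_tangent that c]
        hessian_coord[OF c] gradient_coord[OF c])
  have cont: "continuous_on UNIV (\<lambda>z. \<Psi> (fst z))"
    unfolding \<Psi>_def
    by (intro continuous_intros smooth_bilinear_continuous_on[OF G_smooth[OF cy(1)]] smooth_bilinear_continuous_on[OF \<Gamma>_smooth[OF cy(1)]]
        continuous_on_dd[OF grad_coord_smooth[OF cy(1)] chart_open(2)[OF cy(1)]] cy(2))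
  obtain C where C: "\<And>u v. u \<in> tangent_space A p \<Longrightarrow> v \<in> tangent_space A p \<Longrightarrow> tnorm g p u = 1 \<Longrightarrow> tnorm g p v = 1 \<Longrightarrow> \<bar>\<Psi> (u c)\<bar> \<le> C"
    using unit_vectors_bounded[OF c cont] by metis
  have bdd: "bdd_below {q \<eta> |\<eta>. \<eta> \<in> tangent_space A p \<and> tnorm g p \<eta> = 1}"
  proof (rule bdd_belowI[of _ "- C"])
    fix s assume "s \<in> {q \<eta> |\<eta>. \<eta> \<in> tangent_space A p \<and> tnorm g p \<eta> = 1}"
    then obtain \<eta> where "s = q \<eta>" "\<eta> \<in> tangent_space A p" "tnorm g p \<eta> = 1" by blast
    then show "- C \<le> s" using C[of \<eta> \<eta>] q by (simp add: abs_le_iff)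
  qed
  have unit: "mu_min A g U p \<le> q \<eta>" if "\<eta> \<in> tangent_space A p" "tnorm g p \<eta> = 1" for \<eta>
    unfolding mu_min_def q_def[symmetric] by (rule cInf_lower[OF _ bdd]) (use that in blast)
  have scale: "\<Psi> (r *\<^sub>R h) = r\<^sup>2 * \<Psi> h" for r h
  proof -
    have "linear (dd (grad_coord U c) y)"
      by (rule has_derivative_linear[OF smooth_on_has_derivative[OF grad_coord_smooth[OF cy(1)] chart_open(2)[OF cy(1)] cy(2)]])
    from linear_scale[OF this, of r h] show ?thesis
      by (simp add: \<Psi>_def G_simps bilinear_lmul[OF \<Gamma>_bilinear] power2_eq_square algebra_simps)
  qed
  have "mu_min A g U p * (tnorm g p \<tau>)\<^sup>2 \<le> q \<tau>"
  proof (cases "\<tau> = (\<lambda>c. 0)")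
    case True
    have "\<Psi> 0 = 0" using scale[of 0 0] by simp
    then have "q \<tau> = 0" using q[OF \<tau>] True by simp
    moreover have "tnorm g p \<tau> = 0" using tnorm_scaleR[OF \<tau>, of 0] True by simp
    ultimately show ?thesis by simp
  next
    case False
    let ?n = "tnorm g p \<tau>"
    have n: "?n > 0" by (rule tnorm_pos[OF \<tau> False])
    note u = normalized_tangent[OF \<tau> n]
    have "mu_min A g U p \<le> (1 / ?n)\<^sup>2 * q \<tau>" using unit[OF u] q[OF u(1)] q[OF \<tau>] scale by simp
    then show ?thesis using n by (simp add: power_divide field_simps)
  qed
  then show ?thesis by (simp add: q_def)
qed

end

end

section \<open>Uniform bounds over a compact set\<close>

text \<open>A bound is an upper bound for a monotone family of properties. This covers upper bounds of functions as well as positive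
  lower bounds \<open>1 / C\<close>.\<close>

lemma compact_uniform_bound:
  fixes P :: "'p::topological_space \<Rightarrow> real \<Rightarrow> bool"
  assumes K: "compact K" and loc: "\<And>p. p \<in> K \<Longrightarrow> \<exists>T C. open T \<and> p \<in> T \<and> (\<forall>q\<in>T \<inter> K. P q C)"
    and mono: "\<And>q C C'. P q C \<Longrightarrow> C \<le> C' \<Longrightarrow> P q C'"
  shows "\<exists>C. \<forall>q\<in>K. P q C"
proof -
  obtain T C where TC: "\<And>p. p \<in> K \<Longrightarrow> open (T p) \<and> p \<in> T p \<and> (\<forall>q\<in>T p \<inter> K. P q (C p))"
    using loc by metis
  have "K \<subseteq> (\<Union>p\<in>K. T p)" using TC by blast
  then obtain F where F: "F \<subseteq> K" "finite F" "K \<subseteq> (\<Union>p\<in>F. T p)"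
    using compactE_image[OF K, of K T] TC by blast
  have "P q (\<Sum>p\<in>F. \<bar>C p\<bar>)" if q: "q \<in> K" for q
  proof -
    obtain p where p: "p \<in> F" "q \<in> T p" using F(3) q by blast
    have "C p \<le> \<bar>C p\<bar>" by simp
    also have "\<dots> \<le> (\<Sum>p\<in>F. \<bar>C p\<bar>)" using member_le_sum[OF p(1), of "\<lambda>p. \<bar>C p\<bar>"] F(2) by simp
    finally show ?thesis using mono TC p q F(1) by blast
  qed
  then show ?thesis by blast
qed

text \<open>The torus is compact: shifting each coordinate by a multiple of the period moves every point into a cube.\<close>

lemma torus_representative:
  fixes f :: "real ^ 'k::finite \<Rightarrow> 'b"
  assumes per: "\<And>\<phi> i. f (\<phi> + axis i (2 * pi)) = f \<phi>"
  shows "\<exists>\<phi>'\<in>cbox 0 (\<chi> i. 2 * pi). f \<phi>' = f \<phi>"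
proof -
  have nat: "f (\<phi> + axis i (2 * pi * real n)) = f \<phi>" for \<phi> i n
  proof (induction n)
    case 0
    have "\<phi> + axis i (2 * pi * real 0) = \<phi>" by (simp add: axis_def vec_eq_iff)
    then show ?case by (simp only:)
  next
    case (Suc n)
    have e: "\<phi> + axis i (2 * pi * real (Suc n)) = (\<phi> + axis i (2 * pi * real n)) + axis i (2 * pi)"
      by (simp add: axis_def vec_eq_iff algebra_simps)
    show ?case unfolding e per by (rule Suc)
  qed
  have int: "f (\<phi> + axis i (2 * pi * of_int n)) = f \<phi>" for \<phi> i n
  proof (cases "n \<ge> 0")
    case True
    then show ?thesis using nat[of \<phi> i "nat n"] by simp
  next
    case False
    have e: "(\<phi> + axis i (2 * pi * of_int n)) + axis i (2 * pi * real (nat (- n))) = \<phi>"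
      using False by (simp add: axis_def vec_eq_iff)
    show ?thesis using nat[of "\<phi> + axis i (2 * pi * of_int n)" i "nat (-n)"] unfolding e by (rule sym)
  qed
  have sum: "f (\<phi> + (\<Sum>i\<in>F. axis i (2 * pi * of_int (n i)))) = f \<phi>" if "finite F" for F n
    using that
  proof (induction F rule: finite_induct)
    case (insert i F)
    have e: "\<phi> + (\<Sum>i\<in>insert i F. axis i (2 * pi * of_int (n i))) = (\<phi> + (\<Sum>i\<in>F. axis i (2 * pi * of_int (n i)))) + axis i (2 * pi * of_int (n i))"
      using insert by (simp add: algebra_simps)
    show ?case unfolding e int by (rule insert.IH)
  qed simp
  define n where "n i = - \<lfloor>\<phi> $ i / (2 * pi)\<rfloor>" for i
  let ?\<phi> = "\<phi> + (\<Sum>i\<in>UNIV. axis i (2 * pi * of_int (n i)))"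
  have comp: "?\<phi> $ i = \<phi> $ i + 2 * pi * of_int (n i)" for i
    by (simp add: sum_component axis_def if_distrib cong: if_cong)
  have "0 \<le> ?\<phi> $ i \<and> ?\<phi> $ i \<le> 2 * pi" for i
  proof -
    define q where "q = \<phi> $ i / (2 * pi)"
    have "\<phi> $ i = 2 * pi * q" by (simp add: q_def)
    then have "?\<phi> $ i = 2 * pi * (q - of_int \<lfloor>q\<rfloor>)" unfolding comp by (simp add: n_def algebra_simps flip: q_def)
    moreover have "0 \<le> q - of_int \<lfloor>q\<rfloor>" "q - of_int \<lfloor>q\<rfloor> \<le> 1" by linarith+
    ultimately show ?thesis by (auto intro: mult_left_le)
  qed
  then have "?\<phi> \<in> cbox 0 (\<chi> i. 2 * pi)" by (simp add: mem_box_cart)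
  then show ?thesis using sum[of UNIV n] by (intro bexI[of _ ?\<phi>]) auto
qed

locale torus_system = riemannian_manifold A g
  for A :: "('a::t2_space, 'n::finite) chart set" and g :: "('a, 'n) riem_metric" +
  fixes f :: "real ^ 'k::finite \<Rightarrow> 'a \<Rightarrow> ('a, 'n) tvec"
  assumes f: "smooth_torus_family A f"
begin

lemma f_tangent: "f \<phi> p \<in> tangent_space A p"
  and f_periodic: "f (\<phi> + axis i (2 * pi)) = f \<phi>"
  and f_smooth: "c \<in> A \<Longrightarrow> smooth_on (UNIV \<times> snd c ` fst c) (\<lambda>z. f (fst z) (chart_inv c (snd z)) c)"
  using f unfolding smooth_torus_family_def case_prod_unfold by blast+

text \<open>The family \<open>f\<close> in a chart, as one function on an open subset of a Euclidean space, so that its derivative in the point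
  is a partial derivative and is continuous also in the parameter.\<close>

definition Fc :: "('a, 'n) chart \<Rightarrow> (real^'k) \<times> (real^'n) \<Rightarrow> real^'n" where
  "Fc c z = f (fst z) (chart_inv c (snd z)) c"

text \<open>The components of \<open>\<nabla>\<^sub>h f(\<phi>, \<cdot>)\<close>.\<close>

definition DF :: "('a, 'n) chart \<Rightarrow> real^'k \<Rightarrow> real^'n \<Rightarrow> real^'n \<Rightarrow> real^'n" where
  "DF c \<phi> y h = dd (Fc c) (\<phi>, y) (0, h) + \<Gamma> c y h (Fc c (\<phi>, y))"

lemma Fc_domain_open: "c \<in> A \<Longrightarrow> open ((UNIV :: (real^'k) set) \<times> snd c ` fst c)"
  by (intro open_Times chart_open) simp_all

lemma Fc_smooth: "c \<in> A \<Longrightarrow> smooth_on (UNIV \<times> snd c ` fst c) (Fc c)"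
  using f_smooth unfolding Fc_def[abs_def] .

lemma Fc_partial:
  assumes c: "c \<in> A" "y \<in> snd c ` fst c"
  shows "((\<lambda>y. f \<phi> (chart_inv c y) c) has_derivative (\<lambda>h. dd (Fc c) (\<phi>, y) (0, h))) (at y)"
proof -
  have "(Fc c has_derivative dd (Fc c) (\<phi>, y)) (at (\<phi>, y))"
    by (rule smooth_on_has_derivative[OF Fc_smooth[OF c(1)] Fc_domain_open[OF c(1)]]) (use c in simp)
  moreover have "((\<lambda>y. (\<phi>, y)) has_derivative (\<lambda>h. (0, h))) (at y)" by (intro has_derivative_Pair has_derivative_const has_derivative_ident)
  ultimately show ?thesis using has_derivative_compose[of "\<lambda>y. (\<phi>, y)" "\<lambda>h. (0, h)" y UNIV "Fc c"] by (simp add: Fc_def)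
qed

lemma f_coord: "c \<in> charts_at A p \<Longrightarrow> f \<phi> p c = Fc c (\<phi>, snd c p)"
  by (simp add: Fc_def chart_inv_inv[OF charts_atD(1,2)])

lemma cov_deriv_f_tangent: "\<xi> \<in> tangent_space A p \<Longrightarrow> cov_deriv A g (f \<phi>) p \<xi> \<in> tangent_space A p"
  by (rule cov_deriv_tangent[OF f_tangent])
     (simp_all add: differentiable_def, rule exI, rule Fc_partial[OF charts_atD(1,3)], assumption+)

lemma cov_deriv_f_coord:
  "c \<in> charts_at A p \<Longrightarrow> cov_deriv A g (f \<phi>) p \<xi> c = DF c \<phi> (snd c p) (\<xi> c)"
  using dd_eqI[OF Fc_partial[OF charts_atD(1,3)]] by (simp add: cov_deriv_def DF_def f_coord)

lemma DF_linear: assumes c: "c \<in> A" "y \<in> snd c ` fst c" shows "linear (DF c \<phi> y)"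
proof -
  have "linear (\<lambda>h. dd (Fc c) (\<phi>, y) (0, h))" by (rule has_derivative_linear[OF Fc_partial[OF c]])
  moreover have "linear (\<lambda>h. \<Gamma> c y h (Fc c (\<phi>, y)))" using \<Gamma>_bilinear[of c y] by (simp add: bilinear_def)
  ultimately show ?thesis unfolding DF_def[abs_def] by (rule linear_compose_add)
qed

lemma Fc_continuous_on:
  assumes c: "c \<in> A" and "continuous_on X \<Phi>" "continuous_on X Y" and S: "\<And>x. x \<in> X \<Longrightarrow> Y x \<in> snd c ` fst c"
  shows "continuous_on X (\<lambda>x. Fc c (\<Phi> x, Y x))"
  by (rule continuous_on_compose2[OF smooth_on_continuous[OF Fc_smooth[OF c]] continuous_on_Pair[OF assms(2,3)]]) (use S in blast)

lemma DF_continuous_on: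
  assumes c: "c \<in> A" and "continuous_on X \<Phi>" "continuous_on X Y" "continuous_on X H" and S: "\<And>x. x \<in> X \<Longrightarrow> Y x \<in> snd c ` fst c"
  shows "continuous_on X (\<lambda>x. DF c (\<Phi> x) (Y x) (H x))"
  unfolding DF_def
  by (intro continuous_on_add smooth_bilinear_continuous_on[OF \<Gamma>_smooth[OF c]] Fc_continuous_on[OF c]
      continuous_on_dd[OF Fc_smooth[OF c] Fc_domain_open[OF c]] continuous_on_Pair continuous_on_const assms)
     (use S in auto)

text \<open>Near each point, tangent vectors of bounded norm have their components in a fixed compact set. Continuous
  coordinate expressions are therefore bounded locally.\<close>

lemma chart_compact_region:
  fixes p :: 'a and R :: real
  assumes R: "R \<ge> 0"
  shows "\<exists>T c r \<kappa>. open T \<and> p \<in> T \<and> c \<in> A \<and> r > 0 \<and> \<kappa> > 0 \<and> cball (snd c p) r \<subseteq> snd c ` fst c \<and>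
    (\<forall>q\<in>T. c \<in> charts_at A q \<and> snd c q \<in> cball (snd c p) r \<and>
      (\<forall>v\<in>tangent_space A q. tnorm g q v \<le> R \<longrightarrow> v c \<in> cball 0 (R / \<kappa>)))"
proof -
  obtain c where c: "c \<in> charts_at A p" using ex_chart by blast
  note cA = charts_atD(1)[OF c]
  obtain r \<kappa> where r: "r > 0" "\<kappa> > 0" "cball (snd c p) r \<subseteq> snd c ` fst c"
    "\<And>y h. y \<in> cball (snd c p) r \<Longrightarrow> \<kappa> * norm h \<le> sqrt (G c y h h)"
    using chart_ball_comparison[OF charts_atD(1,3)[OF c]] by metis
  have B: "ball (snd c p) r \<subseteq> snd c ` fst c" using r(3) ball_subset_cball by blast
  define T where "T = chart_inv c ` ball (snd c p) r"
  have T: "open T" unfolding T_def by (rule chart_ball_open[OF cA B])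
  have T_iff: "q \<in> T \<longleftrightarrow> q \<in> fst c \<and> dist (snd c p) (snd c q) < r" for q
    unfolding T_def by (rule chart_ball_iff[OF cA B])
  have "p \<in> T" using T_iff charts_atD(2)[OF c] r(1) by simp
  moreover have "c \<in> charts_at A q \<and> snd c q \<in> cball (snd c p) r \<and>
      (\<forall>v\<in>tangent_space A q. tnorm g q v \<le> R \<longrightarrow> v c \<in> cball 0 (R / \<kappa>))" if q: "q \<in> T" for q
  proof (intro conjI ballI impI)
    show cq: "c \<in> charts_at A q" using q T_iff charts_atI[OF cA] by blast
    show yq: "snd c q \<in> cball (snd c p) r" using q T_iff by (simp add: less_imp_le)
    fix v assume v: "v \<in> tangent_space A q" "tnorm g q v \<le> R"
    have "sqrt (G c (snd c q) (v c) (v c)) = tnorm g q v"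
      using tnorm_coord[OF v(1) cq] tnorm_nonneg[OF v(1)] by (metis real_sqrt_unique)
    then have "\<kappa> * norm (v c) \<le> R" using r(4)[OF yq, of "v c"] v(2) by simp
    then show "v c \<in> cball 0 (R / \<kappa>)" using r(2) by (simp add: field_simps)
  qed
  ultimately show ?thesis using T r cA by blast
qed

text \<open>The expression \<open>\<Psi>\<close> may depend on the chart. The chart is therefore chosen for each point, among the finitely many
  that cover \<open>K\<close>.\<close>

lemma uniform_upper_bound:
  fixes \<Psi> :: "('a, 'n) chart \<Rightarrow> real^'k \<Rightarrow> real^'n \<Rightarrow> real^'n \<Rightarrow> real^'n \<Rightarrow> real^'n \<Rightarrow> real"
  assumes K: "compact K" and R: "R \<ge> 0"
    and \<Psi>: "\<And>c X. c \<in> A \<Longrightarrow> (\<And>x. x \<in> X \<Longrightarrow> fst (snd x) \<in> snd c ` fst c) \<Longrightarrow>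
      continuous_on X (\<lambda>x. \<Psi> c (fst x) (fst (snd x)) (fst (snd (snd x))) (fst (snd (snd (snd x)))) (snd (snd (snd (snd x)))))"
  shows "\<exists>C. \<forall>q\<in>K. \<exists>c\<in>charts_at A q. \<forall>\<phi>\<in>cbox 0 (\<chi> i. 2 * pi). \<forall>u\<in>tangent_space A q. \<forall>v\<in>tangent_space A q. \<forall>w\<in>tangent_space A q.
    tnorm g q u \<le> R \<longrightarrow> tnorm g q v \<le> R \<longrightarrow> tnorm g q w \<le> R \<longrightarrow> \<bar>\<Psi> c \<phi> (snd c q) (u c) (v c) (w c)\<bar> \<le> C"
proof (rule compact_uniform_bound[OF K])
  fix p assume "p \<in> K"
  obtain T c r \<kappa> where T: "open T" "p \<in> T" and c: "c \<in> A" and r: "r > 0" "\<kappa> > 0" "cball (snd c p) r \<subseteq> snd c ` fst c"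
    and q: "\<And>q. q \<in> T \<Longrightarrow> c \<in> charts_at A q \<and> snd c q \<in> cball (snd c p) r \<and>
      (\<forall>v\<in>tangent_space A q. tnorm g q v \<le> R \<longrightarrow> v c \<in> cball 0 (R / \<kappa>))"
    using chart_compact_region[OF R, of p] by blast
  let ?B = "cball 0 (R / \<kappa>) :: (real^'n) set"
  let ?X = "cbox 0 (\<chi> i. 2 * pi) \<times> cball (snd c p) r \<times> ?B \<times> ?B \<times> ?B :: ((real^'k) \<times> _) set"
  let ?h = "\<lambda>x. \<Psi> c (fst x) (fst (snd x)) (fst (snd (snd x))) (fst (snd (snd (snd x)))) (snd (snd (snd (snd x))))"
  have "compact (?h ` ?X)"
    by (intro compact_continuous_image compact_Times compact_cbox compact_cball \<Psi>[OF c]) (use r(3) in auto)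
  from compact_imp_bounded[OF this, unfolded bounded_iff] obtain C where C: "\<forall>s\<in>?h ` ?X. norm s \<le> C" ..
  show "\<exists>T C. open T \<and> p \<in> T \<and> (\<forall>q\<in>T \<inter> K. \<exists>c\<in>charts_at A q. \<forall>\<phi>\<in>cbox 0 (\<chi> i. 2 * pi). \<forall>u\<in>tangent_space A q. \<forall>v\<in>tangent_space A q. \<forall>w\<in>tangent_space A q.
    tnorm g q u \<le> R \<longrightarrow> tnorm g q v \<le> R \<longrightarrow> tnorm g q w \<le> R \<longrightarrow> \<bar>\<Psi> c \<phi> (snd c q) (u c) (v c) (w c)\<bar> \<le> C)"
  proof (intro exI[of _ T] exI[of _ C] conjI T ballI)
    fix z assume "z \<in> T \<inter> K"
    then have z: "z \<in> T" by blast
    show "\<exists>c\<in>charts_at A z. \<forall>\<phi>\<in>cbox 0 (\<chi> i. 2 * pi). \<forall>u\<in>tangent_space A z. \<forall>v\<in>tangent_space A z. \<forall>w\<in>tangent_space A z.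
      tnorm g z u \<le> R \<longrightarrow> tnorm g z v \<le> R \<longrightarrow> tnorm g z w \<le> R \<longrightarrow> \<bar>\<Psi> c \<phi> (snd c z) (u c) (v c) (w c)\<bar> \<le> C"
    proof (intro bexI[of _ c] ballI impI)
      show "c \<in> charts_at A z" using q[OF z] by blast
      fix \<phi> :: "real^'k" and u v w assume h: "\<phi> \<in> cbox 0 (\<chi> i. 2 * pi)" "u \<in> tangent_space A z" "v \<in> tangent_space A z" "w \<in> tangent_space A z"
        "tnorm g z u \<le> R" "tnorm g z v \<le> R" "tnorm g z w \<le> R"
      have "(\<phi>, snd c z, u c, v c, w c) \<in> ?X" using h q[OF z] by blast
      from bspec[OF C imageI[OF this]] show "\<bar>\<Psi> c \<phi> (snd c z) (u c) (v c) (w c)\<bar> \<le> C" by simp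
    qed
  qed
next
  fix q C C'
  assume "\<exists>c\<in>charts_at A q. \<forall>\<phi>\<in>cbox 0 (\<chi> i. 2 * pi). \<forall>u\<in>tangent_space A q. \<forall>v\<in>tangent_space A q. \<forall>w\<in>tangent_space A q.
    tnorm g q u \<le> R \<longrightarrow> tnorm g q v \<le> R \<longrightarrow> tnorm g q w \<le> R \<longrightarrow> \<bar>\<Psi> c \<phi> (snd c q) (u c) (v c) (w c)\<bar> \<le> C" "C \<le> C'"
  then show "\<exists>c\<in>charts_at A q. \<forall>\<phi>\<in>cbox 0 (\<chi> i. 2 * pi). \<forall>u\<in>tangent_space A q. \<forall>v\<in>tangent_space A q. \<forall>w\<in>tangent_space A q.
    tnorm g q u \<le> R \<longrightarrow> tnorm g q v \<le> R \<longrightarrow> tnorm g q w \<le> R \<longrightarrow> \<bar>\<Psi> c \<phi> (snd c q) (u c) (v c) (w c)\<bar> \<le> C'"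
    by (meson order_trans)
qed

text \<open>The infimum is a lower bound, by compactness of the unit sphere.\<close>

lemma lambda_min_le:
  assumes "\<eta> \<in> tangent_space A p" "tnorm g p \<eta> = 1"
  shows "lambda_min A g f \<phi> p \<le> g p (cov_deriv A g (f \<phi>) p \<eta>) \<eta>"
proof -
  obtain c where c: "c \<in> charts_at A p" using ex_chart by blast
  have cA: "c \<in> A" "snd c p \<in> snd c ` fst c" using charts_atD[OF c] by auto
  have cont: "continuous_on UNIV (\<lambda>z. G c (snd c p) (DF c \<phi> (snd c p) (fst z)) (fst z))"
    by (intro smooth_bilinear_continuous_on[OF G_smooth[OF cA(1)]] DF_continuous_on[OF cA(1)] continuous_intros cA(2))
  have eq: "g p (cov_deriv A g (f \<phi>) p u) u = G c (snd c p) (DF c \<phi> (snd c p) (u c)) (u c)" if "u \<in> tangent_space A p" for u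
    by (simp add: metric_coord[OF cov_deriv_f_tangent[OF that] that c] cov_deriv_f_coord[OF c])
  obtain C where C: "\<And>u v. u \<in> tangent_space A p \<Longrightarrow> v \<in> tangent_space A p \<Longrightarrow> tnorm g p u = 1 \<Longrightarrow> tnorm g p v = 1 \<Longrightarrow>
    \<bar>G c (snd c p) (DF c \<phi> (snd c p) (u c)) (u c)\<bar> \<le> C"
    using unit_vectors_bounded[OF c cont] by metis
  show ?thesis
    unfolding lambda_min_def
  proof (rule cInf_lower)
    show "bdd_below {g p (cov_deriv A g (f \<phi>) p \<eta>) \<eta> |\<eta>. \<eta> \<in> tangent_space A p \<and> tnorm g p \<eta> = 1}"
    proof (rule bdd_belowI[of _ "- C"])
      fix s assume "s \<in> {g p (cov_deriv A g (f \<phi>) p \<eta>) \<eta> |\<eta>. \<eta> \<in> tangent_space A p \<and> tnorm g p \<eta> = 1}"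
      then obtain \<eta> where "s = g p (cov_deriv A g (f \<phi>) p \<eta>) \<eta>" "\<eta> \<in> tangent_space A p" "tnorm g p \<eta> = 1" by blast
      then show "- C \<le> s" using C[of \<eta> \<eta>] eq by (simp add: abs_le_iff)
    qed
  qed (use assms in blast)
qed

text \<open>A positive continuous function on a compact set has a positive minimum. It is taken over the unit vectors with
  base point in \<open>K\<close>: the function need not be positive at other points of the chart.\<close>

lemma uniform_monotonicity:
  assumes K: "compact K" and U: "smooth_function A U"
    and pos: "\<And>\<phi> p. p \<in> K \<Longrightarrow> lambda_min A g f \<phi> p + (1/2) * g p (gradient A g U p) (f \<phi> p) > 0"
  shows "\<exists>\<delta>>0. \<forall>q\<in>K. \<forall>\<phi>. \<forall>\<eta>\<in>tangent_space A q. tnorm g q \<eta> = 1 \<longrightarrow>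
    \<delta> \<le> g q (cov_deriv A g (f \<phi>) q \<eta>) \<eta> + (1/2) * g q (gradient A g U q) (f \<phi> q)"
proof -
  define H where "H q \<phi> \<eta> = g q (cov_deriv A g (f \<phi>) q \<eta>) \<eta> + (1/2) * g q (gradient A g U q) (f \<phi> q)" for q \<phi> \<eta>
  have Hpos: "H q \<phi> \<eta> > 0" if "q \<in> K" "\<eta> \<in> tangent_space A q" "tnorm g q \<eta> = 1" for q \<phi> \<eta>
    using pos[OF that(1), of \<phi>] lambda_min_le[OF that(2,3), of \<phi>] unfolding H_def by linarith
  define P where "P q C \<longleftrightarrow> C > 0 \<and> (\<forall>\<phi>. \<forall>\<eta>\<in>tangent_space A q. tnorm g q \<eta> = 1 \<longrightarrow> 1 / C \<le> H q \<phi> \<eta>)" for q C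
  have Kcl: "closed K" using K by (rule compact_imp_closed)
  have "\<exists>C. \<forall>q\<in>K. P q C"
  proof (rule compact_uniform_bound[OF K])
    fix p assume "p \<in> K"
    obtain T c r \<kappa> where T: "open T" "p \<in> T" and c: "c \<in> A" and r: "r > 0" "\<kappa> > 0" "cball (snd c p) r \<subseteq> snd c ` fst c"
      and q: "\<And>q. q \<in> T \<Longrightarrow> c \<in> charts_at A q \<and> snd c q \<in> cball (snd c p) r \<and>
        (\<forall>v\<in>tangent_space A q. tnorm g q v \<le> 1 \<longrightarrow> v c \<in> cball 0 (1 / \<kappa>))"
      using chart_compact_region[of 1 p] by auto
    let ?W = "cbox 0 (\<chi> i. 2 * pi) \<times> cball (snd c p) r \<times> cball 0 (1 / \<kappa>) :: ((real^'k) \<times> (real^'n) \<times> (real^'n)) set"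
    have W: "compact ?W" by (intro compact_Times compact_cbox compact_cball)
    have WS: "fst (snd x) \<in> snd c ` fst c" if "x \<in> ?W" for x using that r(3) by auto
    \<comment> \<open>Components of unit vectors over the chart ball; \<open>Z\<close> below keeps those based in \<open>K\<close>.\<close>
    define Z1 where "Z1 = ?W \<inter> (\<lambda>x. G c (fst (snd x)) (snd (snd x)) (snd (snd x))) -` {1}"
    define Z where "Z = Z1 \<inter> (\<lambda>x. chart_inv c (fst (snd x))) -` K"
    have clW: "closed ?W" by (rule compact_imp_closed[OF W])
    have Z1: "closed Z1" unfolding Z1_def
      by (rule continuous_closed_preimage[OF smooth_bilinear_continuous_on[OF G_smooth[OF c]] clW])
         (use WS in \<open>auto intro!: continuous_intros simp del: split_paired_all\<close>)
    have Z1W: "Z1 \<subseteq> ?W" by (simp add: Z1_def)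
    have "closed Z" unfolding Z_def
      by (rule continuous_closed_preimage[OF continuous_on_compose2[OF chart_inv_continuous[OF c]] Z1 Kcl])
         (use WS Z1W in \<open>auto intro!: continuous_intros simp del: split_paired_all\<close>)
    moreover have "Z \<subseteq> ?W" using Z1W by (auto simp: Z_def)
    ultimately have Zc: "compact Z" using W compact_Int_closed by (metis inf.absorb_iff2)
    have ZS: "fst (snd x) \<in> snd c ` fst c" if "x \<in> Z" for x using WS \<open>Z \<subseteq> ?W\<close> that by blast
    define h where "h x = G c (fst (snd x)) (DF c (fst x) (fst (snd x)) (snd (snd x))) (snd (snd x))
      + (1/2) * G c (fst (snd x)) (grad_coord U c (fst (snd x))) (Fc c (fst x, fst (snd x)))" for x
    have hc: "continuous_on Z h"
      unfolding h_def
      by (intro continuous_on_add continuous_on_mult continuous_on_const smooth_bilinear_continuous_on[OF G_smooth[OF c]] DF_continuous_on[OF c] Fc_continuous_on[OF c]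
          continuous_on_compose2[OF smooth_on_continuous[OF grad_coord_smooth[OF U c]]] continuous_on_fst continuous_on_snd continuous_on_id ZS image_subsetI)
    have hH: "h (\<phi>, snd c z, \<eta> c) = H z \<phi> \<eta>" if "c \<in> charts_at A z" "\<eta> \<in> tangent_space A z" for z \<phi> \<eta>
      by (simp add: h_def H_def metric_coord[OF cov_deriv_f_tangent[OF that(2)] that(2,1)] metric_coord[OF gradient_tangent[OF U] f_tangent that(1)]
          cov_deriv_f_coord[OF that(1)] gradient_coord[OF U that(1)] f_coord[OF that(1)])
    have hpos: "h x > 0" if x: "x \<in> Z" for x
    proof -
      obtain \<phi> y k where xe: "x = (\<phi>, y, k)" by (cases x) auto
      define z where "z = chart_inv c y"
      have y: "y \<in> snd c ` fst c" "G c y k k = 1" "z \<in> K" using x ZS[OF x] by (auto simp: xe Z_def Z1_def z_def)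
      have cz: "c \<in> charts_at A z" "snd c z = y" using y c by (auto simp: z_def chart_chart_inv intro: charts_atI chart_inv_in)
      have u: "tvec_of c z k \<in> tangent_space A z" "tvec_of c z k c = k" by (rule tvec_of_in[OF cz(1)], rule tvec_of_self[OF cz(1)])
      have "tnorm g z (tvec_of c z k) = 1"
        using metric_coord[OF u(1,1) cz(1)] by (simp add: tnorm_def u(2) cz(2) y(2))
      from Hpos[OF y(3) u(1) this, of \<phi>] hH[OF cz(1) u(1), of \<phi>] show ?thesis by (simp add: xe u(2) cz(2))
    qed
    obtain m where m: "m > 0" "\<And>x. x \<in> Z \<Longrightarrow> m \<le> h x"
    proof (cases "Z = {}")
      case False
      obtain x0 where "x0 \<in> Z" "\<And>x. x \<in> Z \<Longrightarrow> h x0 \<le> h x" using continuous_attains_inf[OF Zc False hc] by blast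
      then show ?thesis using hpos that by blast
    qed (use that[of 1] in auto)
    have "P z (1 / m)" if z: "z \<in> T \<inter> K" for z
      unfolding P_def
    proof (intro conjI allI ballI impI)
      fix \<phi> \<eta> assume \<eta>: "\<eta> \<in> tangent_space A z" "tnorm g z \<eta> = 1"
      obtain \<phi>' where \<phi>': "\<phi>' \<in> cbox 0 (\<chi> i. 2 * pi)" "f \<phi>' = f \<phi>" using torus_representative[of f \<phi>] f_periodic by metis
      have cz: "c \<in> charts_at A z" using q z by blast
      have "(\<phi>', snd c z, \<eta> c) \<in> ?W" using \<phi>'(1) q[of z] z \<eta> by auto
      moreover have "G c (snd c z) (\<eta> c) (\<eta> c) = 1" using tnorm_coord[OF \<eta>(1) cz] \<eta>(2) by simp
      moreover have "chart_inv c (snd c z) \<in> K" using z chart_inv_inv[OF charts_atD(1,2)[OF cz]] by simp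
      ultimately have "(\<phi>', snd c z, \<eta> c) \<in> Z" by (simp add: Z_def Z1_def)
      then have "m \<le> H z \<phi>' \<eta>" using m(2) hH[OF cz \<eta>(1)] by metis
      moreover have "H z \<phi>' \<eta> = H z \<phi> \<eta>" by (simp add: H_def \<phi>'(2))
      ultimately show "1 / (1 / m) \<le> H z \<phi> \<eta>" by simp
    qed (use m(1) in simp)
    then show "\<exists>T C. open T \<and> p \<in> T \<and> (\<forall>q\<in>T \<inter> K. P q C)" using T by blast
  next
    fix q C C' assume P: "P q C" and C: "C \<le> C'"
    then have "1 / C' \<le> 1 / C" "C' > 0" by (auto simp: P_def frac_le)
    then show "P q C'" using P unfolding P_def by (meson order_trans)
  qed
  then obtain C where C: "\<And>q. q \<in> K \<Longrightarrow> P q C" by blast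
  show ?thesis
  proof (cases "K = {}")
    case False
    then have "C > 0" using C unfolding P_def by blast
    then show ?thesis using C unfolding P_def H_def by (intro exI[of _ "1 / C"]) simp
  qed (auto intro: exI[of _ 1])
qed

end

section \<open>Dichotomy of the variational system\<close>

text \<open>The dynamical hypotheses that remain once the bounded domain is replaced by its compact closure.\<close>

locale compact_solution = torus_system A g f + curve_on_manifold A g x
  for A :: "('a::t2_space, 'n::finite) chart set" and g :: "('a, 'n) riem_metric"
    and f :: "real ^ 'k::finite \<Rightarrow> 'a \<Rightarrow> ('a, 'n) tvec" and x :: "real \<Rightarrow> 'a" +
  fixes \<omega> :: "real ^ 'k" and K :: "'a set" and S :: real
  assumes newton: "cov_deriv_along A g x vel t = f (t *\<^sub>R \<omega>) (x t)"
    and compact_K: "compact K" and x_in_K: "x t \<in> K" and vel_bounded: "tnorm g (x t) (vel t) \<le> S"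
begin

abbreviation "rhs \<equiv> variational_rhs A g f \<omega> x"

lemma rhs_tangent: "\<eta> \<in> tangent_space A (x t) \<Longrightarrow> rhs t \<eta> \<in> tangent_space A (x t)"
  unfolding variational_rhs_def by (intro tangent_diff cov_deriv_f_tangent curvature_tangent vel_tangent)

lemma rhs_coord:
  "c \<in> charts_at A (x t) \<Longrightarrow> rhs t \<eta> c = DF c (t *\<^sub>R \<omega>) (snd c (x t)) (\<eta> c) - Rc c (snd c (x t)) (\<eta> c) (vel t c) (vel t c)"
  by (simp add: variational_rhs_def cov_deriv_f_coord curvature_coord)

lemma rhs_lincomb:
  assumes E: "\<And>i. E i \<in> tangent_space A (x t)"
  shows "rhs t (\<lambda>c. \<Sum>i\<in>UNIV. a i *\<^sub>R E i c) = (\<lambda>c. \<Sum>i\<in>UNIV. a i *\<^sub>R rhs t (E i) c)"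
proof -
  obtain c where c: "c \<in> charts_at A (x t)" using ex_chart by blast
  note cA = charts_atD(1,3)[OF c]
  have lin: "linear (\<lambda>h. DF c (t *\<^sub>R \<omega>) (snd c (x t)) h - Rc c (snd c (x t)) h (vel t c) (vel t c))"
    by (intro linear_compose_sub DF_linear[OF cA] Rc_linear(1)[OF cA])
  show ?thesis
    by (rule tangent_eqI[OF rhs_tangent[OF tangent_lincomb[OF E]] tangent_lincomb[OF rhs_tangent[OF E]] c])
       (simp add: rhs_coord[OF c] linear_sum[OF lin] linear_scale[OF lin])
qed

context
  fixes E :: "real \<Rightarrow> 'n \<Rightarrow> ('a, 'n) tvec"
  assumes E: "parallel_orthonormal_frame A g x E"
begin

abbreviation "Mx \<equiv> variational_matrix A g f \<omega> x E"

lemma frame_tangent: "E t i \<in> tangent_space A (x t)"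
  and frame_orthonormal: "g (x t) (E t i) (E t j) = (if i = j then 1 else 0)"
  and frame_differentiable: "c \<in> charts_at A (x t) \<Longrightarrow> (\<lambda>s. E s i c) differentiable (at t)"
  using E unfolding parallel_orthonormal_frame_def differentiable_along_def by blast+

lemma frame_unit: "tnorm g (x t) (E t i) = 1"
  by (simp add: tnorm_def frame_orthonormal)

lemma matrix_coord:
  "c \<in> charts_at A (x t) \<Longrightarrow> Mx t $ i $ j = G c (snd c (x t))
    (DF c (t *\<^sub>R \<omega>) (snd c (x t)) (E t j c) - Rc c (snd c (x t)) (E t j c) (vel t c) (vel t c)) (E t i c)"
  by (simp add: variational_matrix_def metric_coord[OF rhs_tangent[OF frame_tangent] frame_tangent] rhs_coord)

text \<open>Near each time this is a composition of continuous coordinate expressions in one chart.\<close>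

lemma matrix_continuous: "continuous_on UNIV (\<lambda>t. Mx t $ i $ j)"
proof (rule continuous_at_imp_continuous_on, rule ballI)
  fix t :: real
  obtain c where c: "c \<in> charts_at A (x t)" using ex_chart by blast
  note cA = charts_atD(1)[OF c]
  let ?N = "{s. x s \<in> fst c}"
  have N: "c \<in> charts_at A (x s)" if "s \<in> ?N" for s using that cA by (simp add: charts_at_def)
  have Ec: "continuous_on ?N (\<lambda>s. E s i c)" for i
    by (rule continuous_at_imp_continuous_on) (blast intro: differentiable_imp_continuous_within frame_differentiable N)
  have yS: "snd c (x s) \<in> snd c ` fst c" if "s \<in> ?N" for s using charts_atD(3)[OF N[OF that]] .
  have "continuous_on ?N (\<lambda>s. G c (snd c (x s))
    (DF c (s *\<^sub>R \<omega>) (snd c (x s)) (E s j c) - Rc c (snd c (x s)) (E s j c) (vel s c) (vel s c)) (E s i c))"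
    by (intro smooth_bilinear_continuous_on[OF G_smooth[OF cA]] continuous_on_diff DF_continuous_on[OF cA] Rc_continuous_on[OF cA]
        coord_continuous[OF cA] vel_continuous[OF cA] Ec yS continuous_on_scaleR continuous_on_id continuous_on_const)
  then have "continuous_on ?N (\<lambda>s. Mx s $ i $ j)"
    by (rule continuous_on_eq) (simp add: matrix_coord[OF N])
  then show "isCont (\<lambda>t. Mx t $ i $ j) t"
    using continuous_on_eq_continuous_at[OF chart_times_open[OF cA]] charts_atD(2)[OF c] by blast
qed

text \<open>The entries are one coordinate expression, evaluated at unit frame vectors and at the bounded velocity, over a compact
  set of base points; the unbounded phase \<open>t \<omega>\<close> is replaced by its representative in the cube.\<close>

lemma matrix_bounded: "\<exists>C. \<forall>t i j. \<bar>Mx t $ i $ j\<bar> \<le> C"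
proof -
  define R where "R = max 1 S"
  define \<Psi> where "\<Psi> c \<phi> y u v w = G c y (DF c \<phi> y u - Rc c y u w w) v" for c \<phi> y u v w
  have \<Psi>c: "continuous_on X (\<lambda>x. \<Psi> c (fst x) (fst (snd x)) (fst (snd (snd x))) (fst (snd (snd (snd x)))) (snd (snd (snd (snd x)))))"
    if c: "c \<in> A" and X: "\<And>x. x \<in> X \<Longrightarrow> fst (snd x) \<in> snd c ` fst c" for c X
    unfolding \<Psi>_def
    by (intro smooth_bilinear_continuous_on[OF G_smooth[OF c]] continuous_on_diff DF_continuous_on[OF c] Rc_continuous_on[OF c]
        continuous_on_fst continuous_on_snd continuous_on_id X)
  have R0: "R \<ge> 0" by (simp add: R_def)
  obtain C where C: "\<And>q. q \<in> K \<Longrightarrow> \<exists>c\<in>charts_at A q. \<forall>\<phi>\<in>cbox 0 (\<chi> i. 2 * pi). \<forall>u\<in>tangent_space A q. \<forall>v\<in>tangent_space A q. \<forall>w\<in>tangent_space A q.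
    tnorm g q u \<le> R \<longrightarrow> tnorm g q v \<le> R \<longrightarrow> tnorm g q w \<le> R \<longrightarrow> \<bar>\<Psi> c \<phi> (snd c q) (u c) (v c) (w c)\<bar> \<le> C"
    using uniform_upper_bound[OF compact_K R0, of \<Psi>, OF \<Psi>c] by blast
  have "\<bar>Mx t $ i $ j\<bar> \<le> C" for t i j
  proof -
    obtain c where c: "c \<in> charts_at A (x t)" "\<And>\<phi> u v w. \<phi> \<in> cbox 0 (\<chi> i. 2 * pi) \<Longrightarrow> u \<in> tangent_space A (x t) \<Longrightarrow>
       v \<in> tangent_space A (x t) \<Longrightarrow> w \<in> tangent_space A (x t) \<Longrightarrow>
       tnorm g (x t) u \<le> R \<Longrightarrow> tnorm g (x t) v \<le> R \<Longrightarrow> tnorm g (x t) w \<le> R \<Longrightarrow> \<bar>\<Psi> c \<phi> (snd c (x t)) (u c) (v c) (w c)\<bar> \<le> C"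
      using C[OF x_in_K[of t]] by blast
    obtain \<phi> where \<phi>: "\<phi> \<in> cbox 0 (\<chi> i. 2 * pi)" "f \<phi> = f (t *\<^sub>R \<omega>)" using torus_representative[of f] f_periodic by metis
    have "DF c \<phi> (snd c (x t)) (E t j c) = DF c (t *\<^sub>R \<omega>) (snd c (x t)) (E t j c)"
      unfolding cov_deriv_f_coord[OF c(1), symmetric] \<phi>(2) ..
    then have "Mx t $ i $ j = \<Psi> c \<phi> (snd c (x t)) (E t j c) (E t i c) (vel t c)"
      by (simp add: matrix_coord[OF c(1)] \<Psi>_def)
    moreover have "tnorm g (x t) (vel t) \<le> R" using vel_bounded[of t] by (simp add: R_def)
    ultimately show ?thesis
      using c(2)[OF \<phi>(1) frame_tangent frame_tangent vel_tangent, of j i] frame_unit by (simp add: R_def)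
  qed
  then show ?thesis by blast
qed

text \<open>In an orthonormal frame, coefficients turn into tangent vectors isometrically.\<close>

lemma matrix_quadratic_form:
  fixes a :: "real^'n" and t :: real
  defines "\<eta> \<equiv> (\<lambda>c. \<Sum>i\<in>UNIV. a $ i *\<^sub>R E t i c)"
  shows "a \<bullet> (Mx t *v a) = g (x t) (rhs t \<eta>) \<eta>" and "\<eta> \<in> tangent_space A (x t)" and "tnorm g (x t) \<eta> = norm a"
proof -
  note T = frame_tangent[of t]
  show \<eta>: "\<eta> \<in> tangent_space A (x t)" unfolding \<eta>_def by (rule tangent_lincomb[OF T])
  have r: "g (x t) v \<eta> = (\<Sum>i\<in>UNIV. a $ i * g (x t) v (E t i))" if v: "v \<in> tangent_space A (x t)" for v
  proof -
    have "g (x t) v \<eta> = g (x t) \<eta> v" by (rule metric_sym[OF v \<eta>])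
    also have "\<dots> = (\<Sum>i\<in>UNIV. a $ i * g (x t) (E t i) v)" unfolding \<eta>_def by (rule metric_lincomb) (simp_all add: T v)
    finally show ?thesis by (simp add: metric_sym[OF v T])
  qed
  have "g (x t) (rhs t \<eta>) (E t i) = (\<Sum>j\<in>UNIV. a $ j * Mx t $ i $ j)" for i
    unfolding \<eta>_def rhs_lincomb[OF T]
    by (subst metric_lincomb) (simp_all add: T rhs_tangent variational_matrix_def)
  then show "a \<bullet> (Mx t *v a) = g (x t) (rhs t \<eta>) \<eta>"
    unfolding r[OF rhs_tangent[OF \<eta>]] by (simp add: inner_vec_def matrix_vector_mult_def mult.commute)
  have "g (x t) \<eta> (E t i) = a $ i" for i
  proof -
    have "g (x t) \<eta> (E t i) = (\<Sum>j\<in>UNIV. a $ j * (if j = i then 1 else 0))"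
      unfolding \<eta>_def by (subst metric_lincomb) (simp_all add: T frame_orthonormal)
    then show ?thesis by (simp add: if_distrib cong: if_cong)
  qed
  then have "g (x t) \<eta> \<eta> = a \<bullet> a" unfolding r[OF \<eta>] by (simp add: inner_vec_def)
  then show "tnorm g (x t) \<eta> = norm a" by (simp add: tnorm_def norm_eq_sqrt_inner)
qed

text \<open>The second derivative of \<open>U(x(t))\<close>; the covariant derivative of the velocity is given by the equation of motion.\<close>

lemma potential_derivative_along:
  assumes U: "smooth_function A U"
  shows "((\<lambda>t. g (x t) (gradient A g U (x t)) (vel t)) has_real_derivative
    g (x t) (hessian A g U (x t) (vel t)) (vel t) + g (x t) (gradient A g U (x t)) (f (t *\<^sub>R \<omega>) (x t))) (at t)"
proof -
  obtain c where c: "c \<in> charts_at A (x t)" using ex_chart by blast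
  note cA = charts_atD(1,3)[OF c]
  let ?y = "snd c (x t)"
  have gd: "(grad_coord U c has_derivative dd (grad_coord U c) ?y) (at ?y)"
    by (rule smooth_on_has_derivative[OF grad_coord_smooth[OF U cA(1)] chart_open(2)[OF cA(1)] cA(2)])
  have "((\<lambda>s. grad_coord U c (snd c (x s))) has_derivative (\<lambda>r. dd (grad_coord U c) ?y (r *\<^sub>R vel t c))) (at t)"
    by (rule has_derivative_compose[OF coord_has_derivative[OF c, unfolded has_vector_derivative_def] gd])
  then have "((\<lambda>s. grad_coord U c (snd c (x s))) has_vector_derivative dd (grad_coord U c) ?y (vel t c)) (at t)"
    by (simp add: has_vector_derivative_def linear_scale[OF has_derivative_linear[OF gd]])
  then have V: "((\<lambda>s. gradient A g U (x s) c) has_vector_derivative dd (grad_coord U c) ?y (vel t c)) (at t)"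
    by (rule has_vector_derivative_transform_within_open[OF _ chart_times_open[OF cA(1)]])
       (simp_all add: charts_atD(2)[OF c] gradient_coord[OF U charts_atI[OF cA(1)]])
  have W: "((\<lambda>s. vel s c) has_vector_derivative vector_derivative (\<lambda>s. vel s c) (at t)) (at t)"
    using dv c unfolding differentiable_along_def vector_derivative_works[symmetric] by blast
  have H: "dd (grad_coord U c) ?y (vel t c) + \<Gamma> c ?y (vel t c) (gradient A g U (x t) c) = hessian A g U (x t) (vel t) c"
    by (simp add: hessian_coord[OF U c] gradient_coord[OF U c])
  have F: "vector_derivative (\<lambda>s. vel s c) (at t) + \<Gamma> c ?y (vel t c) (vel t c) = f (t *\<^sub>R \<omega>) (x t) c"
    using fun_cong[OF newton[of t], of c] c by (simp add: cov_deriv_along_def)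
  show ?thesis
    using metric_along_has_derivative[OF c UNIV_I gradient_tangent[OF U] V vel_tangent W]
    unfolding H F
    by (simp add: metric_coord[OF hessian_tangent[OF U vel_tangent] vel_tangent c] metric_coord[OF gradient_tangent[OF U] f_tangent c])
qed

lemma potential_derivative_bounded:
  assumes U: "smooth_function A U"
  shows "\<exists>C. \<forall>t. \<bar>g (x t) (gradient A g U (x t)) (vel t)\<bar> \<le> C"
proof -
  define R where "R = max 1 S"
  define \<Psi> where "\<Psi> c \<phi> y u v w = G c y (grad_coord U c y) u" for c and \<phi> :: "real^'k" and y u and v w :: "real^'n"
  have \<Psi>c: "continuous_on X (\<lambda>x. \<Psi> c (fst x) (fst (snd x)) (fst (snd (snd x))) (fst (snd (snd (snd x)))) (snd (snd (snd (snd x)))))"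
    if c: "c \<in> A" and X: "\<And>x. x \<in> X \<Longrightarrow> fst (snd x) \<in> snd c ` fst c" for c X
    unfolding \<Psi>_def
    by (intro smooth_bilinear_continuous_on[OF G_smooth[OF c]] continuous_on_compose2[OF smooth_on_continuous[OF grad_coord_smooth[OF U c]]]
        continuous_on_fst continuous_on_snd continuous_on_id X image_subsetI)
  have R0: "R \<ge> 0" by (simp add: R_def)
  obtain C where C: "\<And>q. q \<in> K \<Longrightarrow> \<exists>c\<in>charts_at A q. \<forall>\<phi>\<in>cbox 0 (\<chi> i. 2 * pi). \<forall>u\<in>tangent_space A q. \<forall>v\<in>tangent_space A q. \<forall>w\<in>tangent_space A q.
    tnorm g q u \<le> R \<longrightarrow> tnorm g q v \<le> R \<longrightarrow> tnorm g q w \<le> R \<longrightarrow> \<bar>\<Psi> c \<phi> (snd c q) (u c) (v c) (w c)\<bar> \<le> C"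
    using uniform_upper_bound[OF compact_K R0, of \<Psi>, OF \<Psi>c] by blast
  have "\<bar>g (x t) (gradient A g U (x t)) (vel t)\<bar> \<le> C" for t
  proof -
    have v: "tnorm g (x t) (vel t) \<le> R" using vel_bounded[of t] by (simp add: R_def)
    have 0: "(0::real^'k) \<in> cbox 0 (\<chi> i. 2 * pi)" by (simp add: mem_box_cart)
    obtain c where c: "c \<in> charts_at A (x t)" "\<bar>\<Psi> c 0 (snd c (x t)) (vel t c) (vel t c) (vel t c)\<bar> \<le> C"
      using C[OF x_in_K[of t]] 0 vel_tangent[of t] v by blast
    then show ?thesis by (simp add: \<Psi>_def metric_coord[OF gradient_tangent[OF U] vel_tangent c(1)] gradient_coord[OF U c(1)])
  qed
  then show ?thesis by blast
qed

text \<open>With \<open>s = h / 2\<close> the curvature term, at most \<open>K \<bar>\<tau>\<bar>\<^sup>2\<close> for unit vectors, is absorbed by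
  \<open>(H\<^sub>U - h\<^sup>2 / 2) / 2 \<ge> \<mu>\<^sub>U \<bar>\<tau>\<bar>\<^sup>2 / 2 \<ge> K \<bar>\<tau>\<bar>\<^sup>2\<close>, where \<open>H\<^sub>U\<close> is taken at \<open>\<tau>\<close>. The force term
  \<open>\<langle>\<nabla>U, f\<rangle> / 2\<close> that comes with \<open>s'\<close> is just what the monotonicity of \<open>f\<close> asks for.\<close>

lemma monotone_estimate:
  fixes a :: "real^'n" and t :: real
  assumes U: "smooth_function A U"
    and mono: "\<And>\<eta>. \<eta> \<in> tangent_space A (x t) \<Longrightarrow> tnorm g (x t) \<eta> = 1 \<Longrightarrow>
      \<epsilon> \<le> g (x t) (cov_deriv A g (f (t *\<^sub>R \<omega>)) (x t) \<eta>) \<eta> + (1/2) * g (x t) (gradient A g U (x t)) (f (t *\<^sub>R \<omega>) (x t))"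
    and mu: "2 * K_max A g (x t) \<le> mu_min A g U (x t)"
  defines "h \<equiv> g (x t) (gradient A g U (x t)) (vel t)"
    and "h' \<equiv> g (x t) (hessian A g U (x t) (vel t)) (vel t) + g (x t) (gradient A g U (x t)) (f (t *\<^sub>R \<omega>) (x t))"
  shows "\<epsilon> * (norm a)\<^sup>2 \<le> (h' / 2 - (h / 2)\<^sup>2) * (norm a)\<^sup>2 + a \<bullet> (Mx t *v a)"
proof -
  have unit: "\<epsilon> \<le> h' / 2 - (h / 2)\<^sup>2 + z \<bullet> (Mx t *v z)" if z: "norm z = 1" for z
  proof -
    define \<eta> where "\<eta> = (\<lambda>c. \<Sum>i\<in>UNIV. z $ i *\<^sub>R E t i c)"
    note q = matrix_quadratic_form[where a = z and t = t, folded \<eta>_def]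
    have n1: "tnorm g (x t) \<eta> = 1" using q(3) z by simp
    note cT = cov_deriv_f_tangent[OF q(2), of "t *\<^sub>R \<omega>"] and RT = curvature_tangent[OF q(2) vel_tangent vel_tangent]
    have "z \<bullet> (Mx t *v z) = g (x t) (cov_deriv A g (f (t *\<^sub>R \<omega>)) (x t) \<eta>) \<eta> - g (x t) (curvature A g (x t) \<eta> (vel t) (vel t)) \<eta>"
      using metric_linear[OF cT RT q(2), of 1 "-1"] by (simp add: q(1) variational_rhs_def)
    moreover have "g (x t) (curvature A g (x t) \<eta> (vel t) (vel t)) \<eta> \<le> K_max A g (x t) * (tnorm g (x t) (vel t))\<^sup>2"
      using sectional_curvature_le_K_max[OF q(2) vel_tangent] n1 by simp
    moreover have "2 * K_max A g (x t) * (tnorm g (x t) (vel t))\<^sup>2 \<le> mu_min A g U (x t) * (tnorm g (x t) (vel t))\<^sup>2"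
      by (rule mult_right_mono[OF mu]) simp
    moreover have "mu_min A g U (x t) * (tnorm g (x t) (vel t))\<^sup>2 \<le> g (x t) (hessian A g U (x t) (vel t)) (vel t) - (1/2) * h\<^sup>2"
      unfolding h_def by (rule mu_min_le[OF U vel_tangent])
    moreover have arith: "d \<le> (H + F) / 2 - h2 / 4 + q"
      if "q = cv - Rm" "Rm \<le> KT" "2 * KT \<le> muT" "muT \<le> H - (1/2) * h2" "d \<le> cv + (1/2) * F"
      for d H F h2 q cv Rm KT muT :: real using that by argo
    ultimately have "\<epsilon> \<le> h' / 2 - h\<^sup>2 / 4 + z \<bullet> (Mx t *v z)"
      using mono[OF q(2) n1] unfolding h'_def mult.assoc by (intro arith)
    then show ?thesis by (simp add: power_divide)
  qed
  show ?thesis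
  proof (cases "a = 0")
    case False
    define z where "z = (1 / norm a) *\<^sub>R a"
    have z: "norm z = 1" "a = norm a *\<^sub>R z" using False by (simp_all add: z_def)
    have "a \<bullet> (Mx t *v a) = (norm a)\<^sup>2 * (z \<bullet> (Mx t *v z))"
      by (subst (1 2) z(2)) (simp add: matrix_vector_mult_scaleR power2_eq_square)
    then show ?thesis using mult_left_mono[OF unit[OF z(1)], of "(norm a)\<^sup>2"] by (simp add: algebra_simps)
  qed simp
qed

lemma dichotomy_of_uniform_monotonicity:
  assumes U: "smooth_function A U" and \<epsilon>: "\<epsilon> > 0"
    and mono: "\<And>t \<eta>. \<eta> \<in> tangent_space A (x t) \<Longrightarrow> tnorm g (x t) \<eta> = 1 \<Longrightarrow>
      \<epsilon> \<le> g (x t) (cov_deriv A g (f (t *\<^sub>R \<omega>)) (x t) \<eta>) \<eta> + (1/2) * g (x t) (gradient A g U (x t)) (f (t *\<^sub>R \<omega>) (x t))"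
    and mu: "\<And>t. 2 * K_max A g (x t) \<le> mu_min A g U (x t)"
  shows "exponential_dichotomy (variational_system A g f \<omega> x E)"
proof -
  define M where "M t = Blinfun ((*v) (Mx t))" for t
  have M: "M t v = Mx t *v v" for t v
    unfolding M_def by (simp add: bounded_linear_Blinfun_apply matrix_vector_mul_bounded_linear)
  have "(\<lambda>t. Blinfun (\<lambda>(a, b). (b, M t a))) = variational_system A g f \<omega> x E"
    by (simp add: variational_system_def M fun_eq_iff)
  moreover have "exponential_dichotomy (\<lambda>t. Blinfun (\<lambda>(a, b). (b, M t a)))"
  proof -
    obtain C where C: "\<And>t i j. \<bar>Mx t $ i $ j\<bar> \<le> C" using matrix_bounded by blast
    obtain C2 where C2: "\<And>t. \<bar>g (x t) (gradient A g U (x t)) (vel t)\<bar> \<le> C2" using potential_derivative_bounded[OF U] by blast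
    let ?h = "\<lambda>t. g (x t) (gradient A g U (x t)) (vel t)"
    let ?h' = "\<lambda>t. g (x t) (hessian A g U (x t) (vel t)) (vel t) + g (x t) (gradient A g U (x t)) (f (t *\<^sub>R \<omega>) (x t))"
    have cont: "continuous_on UNIV (\<lambda>t. Mx t *v e)" for e
      unfolding matrix_vector_mult_def
      by (intro continuous_on_vec_lambda continuous_on_sum continuous_on_mult matrix_continuous continuous_on_const)
    have Mc: "continuous_on UNIV M"
      by (rule continuous_on_blinfun_componentwise) (simp add: M cont)
    have Mb: "norm (M t) \<le> (\<Sum>e\<in>(Basis::(real^'n) set). \<Sum>i\<in>(UNIV::'n set). \<Sum>j\<in>(UNIV::'n set). C)" for t
    proof (rule order_trans[OF norm_blinfun_euclidean_le sum_mono])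
      fix e :: "real^'n" assume e: "e \<in> Basis"
      have "norm (M t e) \<le> (\<Sum>i\<in>UNIV. \<bar>(Mx t *v e) $ i\<bar>)" unfolding M by (rule norm_le_l1_cart)
      also have "\<dots> \<le> (\<Sum>i\<in>(UNIV::'n set). \<Sum>j\<in>(UNIV::'n set). C)"
      proof (rule sum_mono)
        fix i
        have "\<bar>(Mx t *v e) $ i\<bar> \<le> (\<Sum>j\<in>UNIV. \<bar>Mx t $ i $ j * e $ j\<bar>)"
          by (simp add: matrix_vector_mult_def)
        also have "\<dots> \<le> (\<Sum>j\<in>(UNIV::'n set). C)"
        proof (rule sum_mono)
          fix j
          have "\<bar>e $ j\<bar> \<le> 1" using component_le_norm_cart[of e j] e by simp
          then have "\<bar>Mx t $ i $ j\<bar> * \<bar>e $ j\<bar> \<le> C * 1" using C[of t i j] by (intro mult_mono) auto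
          then show "\<bar>Mx t $ i $ j * e $ j\<bar> \<le> C" by (simp add: abs_mult)
        qed
        finally show "\<bar>(Mx t *v e) $ i\<bar> \<le> (\<Sum>j\<in>(UNIV::'n set). C)" .
      qed
      finally show "norm (M t e) \<le> (\<Sum>i\<in>(UNIV::'n set). \<Sum>j\<in>(UNIV::'n set). C)" .
    qed
    show ?thesis
    proof (rule second_order_dichotomy[OF Mc Mb _ _ \<epsilon>])
      show "((\<lambda>t. ?h t / 2) has_real_derivative ?h' t / 2) (at t)" for t
        by (intro DERIV_cdivide potential_derivative_along U)
      show "\<bar>?h t / 2\<bar> \<le> C2" for t using C2[of t] by (simp add: abs_le_iff) 
      show "\<epsilon> * (norm y)\<^sup>2 \<le> (?h' t / 2 - (?h t / 2)\<^sup>2) * (norm y)\<^sup>2 + y \<bullet> M t y" for t y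
        unfolding M by (rule monotone_estimate[OF U mono mu])
    qed
  qed
  ultimately show ?thesis by simp
qed

end

end

theorem theorem3:
  fixes A :: "('a::{t2_space, second_countable_topology}, 'n::finite) chart set"
    and g :: "('a, 'n) riem_metric"
    and f :: "real ^ 'k::finite \<Rightarrow> 'a \<Rightarrow> ('a, 'n) tvec"
    and \<omega> :: "real ^ 'k"
    and D :: "'a set"
    and x :: "real \<Rightarrow> 'a"
  assumes "smooth_atlas A"
    and "riemannian_metric A g"
    and "connected (UNIV :: 'a set)"
    and "Metric_space.mcomplete UNIV (riem_dist A g)"
    and "rationally_independent \<omega>"
    and "smooth_torus_family A f"
    and "open D" and "connected D" and "D \<noteq> {}"
    and "Metric_space.mbounded UNIV (riem_dist A g) D"
    and "U_monotone A g f D"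
    and "solution A g f \<omega> x"
    and "\<forall>t. x t \<in> D"
    and "bdd_above (range (\<lambda>t. tnorm g (x t) (velocity A UNIV x t)))"
  shows "hyperbolic A g f \<omega> x"
proof -
  interpret riemannian_manifold A g by unfold_locales (rule assms)+
  obtain U where U: "smooth_function A U"
    and lambda: "\<And>\<phi> p. p \<in> closure D \<Longrightarrow> lambda_min A g f \<phi> p + (1/2) * g p (gradient A g U p) (f \<phi> p) > 0"
    and mu: "\<And>p. p \<in> D \<Longrightarrow> mu_min A g U p \<ge> 2 * K_max A g p"
    using assms(11) unfolding U_monotone_def by blast
  obtain S where S: "\<And>t. tnorm g (x t) (velocity A UNIV x t) \<le> S"
    using assms(14) unfolding bdd_above_def by blast
  have K: "compact (closure D)" by (rule bounded_closure_compact[OF assms(3,4,10)])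
  have xD: "x t \<in> D" "x t \<in> closure D" for t using assms(13) closure_subset by blast+
  interpret compact_solution A g f x \<omega> "closure D" S
    by unfold_locales (use assms(6,12) K xD S in \<open>auto simp: solution_def\<close>)
  obtain \<epsilon> where \<epsilon>: "\<epsilon> > 0" and mono: "\<And>q \<phi> \<eta>. q \<in> closure D \<Longrightarrow> \<eta> \<in> tangent_space A q \<Longrightarrow> tnorm g q \<eta> = 1 \<Longrightarrow>
    \<epsilon> \<le> g q (cov_deriv A g (f \<phi>) q \<eta>) \<eta> + (1/2) * g q (gradient A g U q) (f \<phi> q)"
    using uniform_monotonicity[OF K U lambda] by metis
  obtain E where E: "parallel_orthonormal_frame A g x E" using parallel_frame_exists by blast
  have "exponential_dichotomy (variational_system A g f \<omega> x E)"
    by (rule dichotomy_of_uniform_monotonicity[OF E U \<epsilon> mono mu]) (simp_all add: xD)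
  then show ?thesis using E unfolding hyperbolic_def by blast
qed

end
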